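(* Let $\Omega\subset\mathbb{R}^d$, $d\in\mathbb{N}$, be a bounded domain, let $m\in\mathbb{N}$, and let $\boldsymbol{u}\in H^1(\Omega)^m$ satisfy $$\int_\Omega\nabla\boldsymbol{u}:\nabla\boldsymbol{v}\,\mathrm{d}x=0\qquad\text{for all }\boldsymbol{v}\in H^1_0(\Omega)^m.$$ Let $\boldsymbol{U}\in H^1(\Omega)^m$, let $K:=\operatorname{conv\,hull}\boldsymbol{U}(\partial\Omega)$, and let $\boldsymbol{U}^*:=\Pi_K\boldsymbol{U}$, i.e. $\boldsymbol{U}^*(x)=\Pi_K(\boldsymbol{U}(x))$ for $x\in\Omega$, where $\Pi_K\colon\mathbb{R}^m\to K$ is the closest point projection onto $K$. Then $\boldsymbol{U}^*\in H^1(\Omega)^m$ satisfies the discrete convex hull property $$\boldsymbol{U}^*(\Omega)\subset\operatorname{conv\,hull}\boldsymbol{U}^*(\partial\Omega),$$ and $$\boldsymbol{U}^*-\boldsymbol{U}\in H^1_0(\Omega)^m,\qquad \frac12\int_\Omega|\nabla\boldsymbol{U}^*|^2\,\mathrm{d}x\le\frac12\int_\Omega|\nabla\boldsymbol{U}|^2\,\mathrm{d}x.$$ Moreover, if $\boldsymbol{u}-\boldsymbol{U}\in H^1_0(\Omega)^m$, then $$|||\boldsymbol{u}-\boldsymbol{U}^*|||\le|||\boldsymbol{u}-\boldsymbol{U}|||,\qquad\text{where } |||\boldsymbol{v}|||^2:=\int_\Omega|\nabla\boldsymbol{v}|^2\,\mathrm{d}x.$$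
   Context: $H^1(\Omega)^m$ is the space of $\mathbb{R}^m$-valued functions whose components lie in the Sobolev space $H^1(\Omega)$, and $H^1_0(\Omega)^m$ is the subspace of functions with vanishing trace on $\partial\Omega$ (components in the closure of $C_c^\infty(\Omega)$ in $H^1(\Omega)$). $A:B$ is the Frobenius inner product of matrices and $|\cdot|$ denotes the Euclidean norm of vectors and the Frobenius norm of matrices. For a nonempty closed convex set $K\subset\mathbb{R}^m$, $\Pi_Kx:=\operatorname{argmin}_{y\in K}|x-y|$. For $\boldsymbol{V}\in H^1(\Omega)^m$, boundary values are understood in the Sobolev (trace) sense and $\operatorname{conv\,hull}\boldsymbol{V}(\partial\Omega)$ denotes the closed convex hull of the boundary values, i.e. the intersection of all closed half-spaces $\{y\in\mathbb{R}^m:\nu\cdot y\le a\}$ ($\nu\in\mathbb{R}^m$, $|\nu|=1$, $a\in\mathbb{R}$) for which $(\nu\cdot\boldsymbol{V}-a)^+\in H^1_0(\Omega)$, where $w^+=\max\{0,w\}$; if there are no such half-spaces, it is $\mathbb{R}^m$. The inclusion $\boldsymbol{V}(\Omega)\subset K$ means $\boldsymbol{V}(x)\in K$ for almost every $x\in\Omega$. *)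

theory Defs
  imports "HOL-Analysis.Analysis"
begin

text \<open>
  Functions on an open set \<open>\<Omega>\<close> are represented by total functions; none of the notions below
  depends on the values outside \<open>\<Omega>\<close> (test functions are extended by zero).  As usual, Sobolev
  functions are represented by arbitrary elements of their almost-everywhere classes.
\<close>

definition partial :: "'d::finite \<Rightarrow> (real^'d \<Rightarrow> real) \<Rightarrow> real^'d \<Rightarrow> real" where
  "partial i f x = frechet_derivative f (at x) (axis i 1)"

fun Ck :: "nat \<Rightarrow> (real^'d::finite \<Rightarrow> real) \<Rightarrow> bool" where
  "Ck 0 f \<longleftrightarrow> continuous_on UNIV f"
| "Ck (Suc k) f \<longleftrightarrow> (\<forall>x. f differentiable (at x)) \<and> (\<forall>i. Ck k (partial i f))"

definition Cc_infinity :: "(real^'d::finite) set \<Rightarrow> (real^'d \<Rightarrow> real) set" where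
  "Cc_infinity \<Omega> = {\<phi>. (\<forall>k. Ck k \<phi>) \<and> (\<exists>C. compact C \<and> C \<subseteq> \<Omega> \<and> (\<forall>x. x \<notin> C \<longrightarrow> \<phi> x = 0))}"

definition L2 :: "(real^'d::finite) set \<Rightarrow> (real^'d \<Rightarrow> 'a::euclidean_space) set" where
  "L2 \<Omega> = {f. f \<in> borel_measurable (lebesgue_on \<Omega>) \<and>
              integrable (lebesgue_on \<Omega>) (\<lambda>x. (norm (f x))\<^sup>2)}"

definition is_weak_gradient ::
  "(real^'d::finite) set \<Rightarrow> (real^'d \<Rightarrow> real) \<Rightarrow> (real^'d \<Rightarrow> real^'d) \<Rightarrow> bool" where
  "is_weak_gradient \<Omega> f g \<longleftrightarrow>
     (\<forall>\<phi>\<in>Cc_infinity \<Omega>. \<forall>i. (LINT x|lebesgue_on \<Omega>. f x * partial i \<phi> x)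
                          = - (LINT x|lebesgue_on \<Omega>. g x $ i * \<phi> x))"

definition H1 :: "(real^'d::finite) set \<Rightarrow> (real^'d \<Rightarrow> real) set" where
  "H1 \<Omega> = {f \<in> L2 \<Omega>. \<exists>g\<in>L2 \<Omega>. is_weak_gradient \<Omega> f g}"

text \<open>The weak gradient is unique only up to null sets; \<open>weak_grad\<close> picks a representative.\<close>

definition weak_grad :: "(real^'d::finite) set \<Rightarrow> (real^'d \<Rightarrow> real) \<Rightarrow> real^'d \<Rightarrow> real^'d" where
  "weak_grad \<Omega> f = (SOME g. g \<in> L2 \<Omega> \<and> is_weak_gradient \<Omega> f g)"

definition H1_norm :: "(real^'d::finite) set \<Rightarrow> (real^'d \<Rightarrow> real) \<Rightarrow> real" where
  "H1_norm \<Omega> f = sqrt ((LINT x|lebesgue_on \<Omega>. (f x)\<^sup>2)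
                       + (LINT x|lebesgue_on \<Omega>. (norm (weak_grad \<Omega> f x))\<^sup>2))"

definition H1_0 :: "(real^'d::finite) set \<Rightarrow> (real^'d \<Rightarrow> real) set" where
  "H1_0 \<Omega> = {f \<in> H1 \<Omega>. \<forall>\<epsilon>>0. \<exists>\<phi>\<in>Cc_infinity \<Omega>. H1_norm \<Omega> (\<lambda>x. f x - \<phi> x) < \<epsilon>}"

definition H1_vec :: "(real^'d::finite) set \<Rightarrow> (real^'d \<Rightarrow> real^'m::finite) set" where
  "H1_vec \<Omega> = {v. \<forall>j. (\<lambda>x. v x $ j) \<in> H1 \<Omega>}"

definition H1_0_vec :: "(real^'d::finite) set \<Rightarrow> (real^'d \<Rightarrow> real^'m::finite) set" where
  "H1_0_vec \<Omega> = {v. \<forall>j. (\<lambda>x. v x $ j) \<in> H1_0 \<Omega>}"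

text \<open>
  The Jacobian, with the gradients of the components as rows.  On the type \<open>real^'d^'m\<close> the
  library's \<open>inner\<close> and \<open>norm\<close> are the Frobenius inner product and the Frobenius norm.
\<close>

definition weak_jac ::
  "(real^'d::finite) set \<Rightarrow> (real^'d \<Rightarrow> real^'m::finite) \<Rightarrow> real^'d \<Rightarrow> real^'d^'m" where
  "weak_jac \<Omega> v x = (\<chi> j. weak_grad \<Omega> (\<lambda>y. v y $ j) x)"

definition energy_norm :: "(real^'d::finite) set \<Rightarrow> (real^'d \<Rightarrow> real^'m::finite) \<Rightarrow> real" where
  "energy_norm \<Omega> v = sqrt (LINT x|lebesgue_on \<Omega>. (norm (weak_jac \<Omega> v x))\<^sup>2)"

text \<open>The closed convex hull of the boundary values; the empty intersection is \<open>UNIV\<close>.\<close>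

definition boundary_hull ::
  "(real^'d::finite) set \<Rightarrow> (real^'d \<Rightarrow> real^'m::finite) \<Rightarrow> (real^'m) set" where
  "boundary_hull \<Omega> V =
     \<Inter> {{y. \<nu> \<bullet> y \<le> a} | \<nu> a. norm \<nu> = 1 \<and> (\<lambda>x. max 0 (\<nu> \<bullet> V x - a)) \<in> H1_0 \<Omega>}"

end

theory Submission
  imports Defs
begin

text \<open>
  The projection \<open>\<Pi>\<close> onto a nonempty closed convex set \<open>K\<close> is \<open>1\<close>-Lipschitz.  Composition with a
  Lipschitz map preserves \<open>H\<^sup>1\<close> and multiplies the Dirichlet energy by at most the square of the
  Lipschitz constant (\<open>Lipschitz_weak_jacobian\<close>): for mollified maps the difference quotients show
  that \<open>\<bar>\<integral> F(U) \<bullet> div \<phi>\<bar> \<le> L \<parallel>\<nabla>U\<parallel> \<parallel>\<phi>\<parallel>\<close>, this passes to the limit, and the Riesz representation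
  theorem (\<open>L2_Riesz\<close>) turns the bound into a weak Jacobian.  This gives \<open>U\<^sup>* \<in> H\<^sup>1\<close> and the energy
  estimate, once \<open>K\<close> is known to be nonempty.

  The boundary condition \<open>U\<^sup>* - U \<in> H\<^sup>1\<^sub>0\<close> rests on two properties of \<open>H\<^sup>1\<^sub>0\<close>.  It contains the \<open>H\<^sup>1\<close>
  functions \<open>g\<close> with \<open>0 \<le> g \<le> h\<close> for some \<open>h \<in> H\<^sup>1\<^sub>0\<close> (\<open>H1_0_sandwich\<close>), and it is closed under \<open>L\<^sup>2\<close>
  limits of sequences with bounded gradients (\<open>H1_0_closed\<close>).  By these, the pairs \<open>(\<nu>, a)\<close> with
  \<open>(\<nu> \<bullet> U - a)\<^sup>+ \<in> H\<^sup>1\<^sub>0\<close> form a closed convex cone.  It does not contain \<open>(0, -1)\<close>, because nonzero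
  constants do not have zero boundary values.  Separating \<open>(0, -1)\<close> from the cone yields a
  point of \<open>K\<close> (\<open>boundary_hull_nonempty\<close>); separating any pair outside the cone shows that every
  half-space containing \<open>K\<close> belongs to the cone (\<open>halfspace_superset_hull\<close>).  The distance from \<open>U\<close>
  to \<open>K\<close> is the supremum of \<open>(\<nu> \<bullet> U - a)\<^sup>+\<close> over countably many supporting half-spaces of \<open>K\<close>, so
  it lies in \<open>H\<^sup>1\<^sub>0\<close> (\<open>distance_to_hull_H1_0\<close>), and it dominates \<open>\<bar>U\<^sup>* - U\<bar>\<close>.  Since \<open>U\<^sup>*\<close> and \<open>U\<close> have the
  same boundary values, \<open>K\<close> is contained in the hull of the boundary values of \<open>U\<^sup>*\<close>, which is the
  convex hull property.

  If \<open>u - U \<in> H\<^sup>1\<^sub>0\<close>, testing the equation for \<open>u\<close> with \<open>u - W\<close> gives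
  \<open>\<parallel>\<nabla>(u - W)\<parallel>\<^sup>2 = \<parallel>\<nabla>W\<parallel>\<^sup>2 - \<parallel>\<nabla>u\<parallel>\<^sup>2\<close> for \<open>W = U\<close> and \<open>W = U\<^sup>*\<close> (\<open>weakly_harmonic_Pythagoras\<close>), and the
  last claim follows from the energy estimate.
\<close>

section \<open>Smooth functions\<close>

lemma partial_eq:
  assumes "(f has_derivative D) (at x)"
  shows "partial i f x = D (axis i 1)"
  unfolding partial_def using frechet_derivative_at[OF assms] by simp

lemma Ck_Suc_imp_Ck: "Ck (Suc k) f \<Longrightarrow> Ck k f"
proof (induction k arbitrary: f)
  case 0
  then have "f differentiable (at x)" for x by simp
  then show ?case
    by (simp add: continuous_at_imp_continuous_on differentiable_imp_continuous_within)
next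
  case (Suc k)
  then show ?case by (metis Ck.simps(2))
qed

lemma Ck_const: "Ck k (\<lambda>x. c)"
proof (induction k arbitrary: c)
  case (Suc k)
  have "partial i (\<lambda>x. c) = (\<lambda>x::real^'a. 0)" for i
    by (rule ext, subst partial_eq[where D="\<lambda>h. 0"]) (auto intro: derivative_eq_intros)
  then show ?case using Suc by simp
qed simp

lemma partial_add:
  assumes "f differentiable (at x)" "g differentiable (at x)"
  shows "partial i (\<lambda>x. f x + g x) x = partial i f x + partial i g x"
  by (subst partial_eq[OF has_derivative_add[OF assms[THEN frechet_derivative_works[THEN iffD1]]]])
     (simp add: partial_def)

lemma partial_mult:
  assumes "f differentiable (at x)" "g differentiable (at x)"
  shows "partial i (\<lambda>x. f x * g x) x = f x * partial i g x + partial i f x * g x"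
  by (subst partial_eq[OF has_derivative_mult[OF assms[THEN frechet_derivative_works[THEN iffD1]]]])
     (simp add: partial_def)

lemma Ck_add: "Ck k f \<Longrightarrow> Ck k g \<Longrightarrow> Ck k (\<lambda>x. f x + g x)"
proof (induction k arbitrary: f g)
  case 0 then show ?case by (auto intro: continuous_intros)
next
  case (Suc k)
  have "partial i (\<lambda>x. f x + g x) = (\<lambda>x. partial i f x + partial i g x)" for i
    using Suc.prems by (intro ext partial_add) auto
  then show ?case using Suc by (auto intro: differentiable_add)
qed

lemma Ck_mult: "Ck k f \<Longrightarrow> Ck k g \<Longrightarrow> Ck k (\<lambda>x. f x * g x)"
proof (induction k arbitrary: f g)
  case 0 then show ?case by (auto intro: continuous_intros)
next
  case (Suc k)
  have "partial i (\<lambda>x. f x * g x) = (\<lambda>x. f x * partial i g x + partial i f x * g x)" for i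
    using Suc.prems by (intro ext partial_mult) auto
  moreover have "Ck k f" "Ck k g" using Suc.prems Ck_Suc_imp_Ck by blast+
  ultimately show ?case using Suc by (auto intro!: Ck_add differentiable_mult)
qed

lemma Ck_cmult: "Ck k f \<Longrightarrow> Ck k (\<lambda>x. c * f x)"
  by (intro Ck_mult Ck_const)

lemma Ck_prod:
  "finite I \<Longrightarrow> (\<And>i. i \<in> I \<Longrightarrow> Ck k (f i)) \<Longrightarrow> Ck k (\<lambda>x. \<Prod>i\<in>I. f i x)"
  by (induction I rule: finite_induct) (auto intro!: Ck_const Ck_mult)

lemma Ck_component: "Ck k (\<lambda>x. x $ i)"
proof (cases k)
  case (Suc l)
  have *: "((\<lambda>x::real^'a. x $ i) has_derivative (\<lambda>x. x $ i)) (at x)" for x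
    by (intro bounded_linear_imp_has_derivative bounded_linear_vec_nth)
  have "partial j (\<lambda>x. x $ i) = (\<lambda>x::real^'a. axis j 1 $ i)" for j
    using partial_eq[OF *] by blast
  then show ?thesis using Suc * by (auto simp: Ck_const differentiable_def)
qed (auto intro: continuous_intros)

text \<open>
  The functions vanishing for \<open>t \<le> 0\<close> and equal to \<open>p (1/t) exp (-1/t)\<close> for \<open>t > 0\<close>, with a
  polynomial \<open>p\<close>, are closed under differentiation; this makes all of them smooth.
\<close>

definition flat :: "real poly \<Rightarrow> real \<Rightarrow> real" where
  "flat p t = (if t > 0 then poly p (1/t) * exp (- (1/t)) else 0)"

lemma poly_exp_tendsto_0: "((\<lambda>s. poly p s * exp (- s)) \<longlongrightarrow> 0) at_top" for p :: "real poly"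
proof -
  have "((\<lambda>s. \<Sum>i\<le>degree p. coeff p i * (s ^ i / exp s)) \<longlongrightarrow> (\<Sum>i\<le>degree p. coeff p i * 0)) at_top"
    by (intro tendsto_intros tendsto_power_div_exp_0)
  then show ?thesis
    by (simp add: poly_altdef sum_distrib_right exp_minus divide_inverse mult.assoc)
qed

lemma flat_has_derivative:
  "(flat p has_real_derivative flat ([:0,0,1:] * (p - pderiv p)) t) (at t)"
proof (cases t "0::real" rule: linorder_cases)
  case less
  have "((\<lambda>t. 0) has_real_derivative 0) (at t)" by simp
  then show ?thesis
    using less by (rule_tac has_field_derivative_transform_within_open[where S="{..<0}" and f="\<lambda>t. 0"])
       (auto simp: flat_def)
next
  case equal
  have "((\<lambda>h. poly ([:0,1:] * p) (inverse h) * exp (- inverse h)) \<longlongrightarrow> 0) (at_right 0)"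
    using poly_exp_tendsto_0 filterlim_inverse_at_top_right by (rule filterlim_compose)
  then have r: "((\<lambda>h. flat p h / h) \<longlongrightarrow> 0) (at_right 0)"
    by (rule tendsto_cong[THEN iffD1, rotated])
       (auto simp: eventually_at_right_field flat_def field_simps intro!: exI[of _ 1])
  have l: "((\<lambda>h. flat p h / h) \<longlongrightarrow> 0) (at_left 0)"
    by (rule tendsto_eventually) (auto simp: eventually_at_left_field flat_def intro!: exI[of _ "-1"])
  have "((\<lambda>h. flat p h / h) \<longlongrightarrow> 0) (at 0)"
    using filterlim_split_at[OF l r] .
  then show ?thesis
    using equal by (simp add: has_field_derivative_iff flat_def)
next
  case greater
  have "((\<lambda>t. poly p (1/t) * exp (- (1/t))) has_real_derivative
      flat ([:0,0,1:] * (p - pderiv p)) t) (at t)"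
    using greater
    by (auto intro!: derivative_eq_intros poly_DERIV[THEN DERIV_chain2] simp: flat_def field_simps power2_eq_square)
  then show ?thesis
    using greater
    by (rule_tac has_field_derivative_transform_within_open[where S="{0<..}" and f="\<lambda>t. poly p (1/t) * exp (- (1/t))"])
       (auto simp: flat_def)
qed

lemma Ck_flat: "Ck k (\<lambda>x. flat p (c * x $ i + b))"
proof (induction k arbitrary: p)
  case 0
  have "continuous_on UNIV (flat p)"
    using flat_has_derivative by (meson DERIV_isCont continuous_at_imp_continuous_on)
  then show ?case
    by (auto intro!: continuous_intros continuous_on_compose2[of UNIV "flat p"])
next
  case (Suc k)
  let ?q = "[:0,0,1:] * (p - pderiv p)"
  have a: "((\<lambda>x::real^'a. c * x $ i + b) has_derivative (\<lambda>h. c * h $ i)) (at x)" for x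
    by (auto intro!: derivative_eq_intros bounded_linear_imp_has_derivative bounded_linear_vec_nth)
  have *: "((\<lambda>x::real^'a. flat p (c * x $ i + b)) has_derivative
      (\<lambda>h. flat ?q (c * x $ i + b) * (c * h $ i))) (at x)" for x
    using has_derivative_compose[OF a flat_has_derivative[unfolded has_field_derivative_def]] by simp
  have "partial j (\<lambda>x::real^'a. flat p (c * x $ i + b))
      = (\<lambda>x. (c * axis j 1 $ i) * flat ?q (c * x $ i + b))" for j
    using partial_eq[OF *] by (simp add: fun_eq_iff mult.commute)
  moreover have "Ck k (\<lambda>x::real^'a. (c * axis j 1 $ i) * flat ?q (c * x $ i + b))" for j
    using Ck_cmult[OF Suc] by blast
  ultimately show ?case using * by (simp add: differentiable_def) blast
qed

lemma flat_1: "flat 1 t = (if t > 0 then exp (- (1/t)) else 0)"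
  by (simp add: flat_def)

lemma flat_1_bounds: "0 \<le> flat 1 t" "flat 1 t \<le> 1"
  by (auto simp: flat_1)

lemma flat_1_tendsto_1: "(flat 1 \<longlongrightarrow> 1) at_top"
proof -
  have "((\<lambda>t::real. exp (- (1/t))) \<longlongrightarrow> exp (- 0)) at_top"
    by (intro tendsto_intros tendsto_divide_0[OF tendsto_const] filterlim_at_top_imp_at_infinity filterlim_ident)
  then show ?thesis
    by (simp, elim tendsto_cong[THEN iffD1, rotated])
       (auto simp: flat_1 intro: eventually_mono[OF eventually_gt_at_top[of 0]])
qed

text \<open>For \<open>n > 0\<close>, a smooth function that is positive exactly on the open box with corners \<open>a + 1/n\<close> and
  \<open>b - 1/n\<close>; for \<open>n \<rightarrow> \<infinity>\<close> it tends to the indicator function of the open box with corners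
  \<open>a\<close> and \<open>b\<close>.\<close>

definition box_bump :: "real \<Rightarrow> real^'d::finite \<Rightarrow> real^'d \<Rightarrow> real^'d \<Rightarrow> real" where
  "box_bump n a b x =
     (\<Prod>i\<in>UNIV. flat 1 (n * x $ i + (- n * a $ i - 1)) * flat 1 ((- n) * x $ i + (n * b $ i - 1)))"

lemma Ck_box_bump: "Ck k (box_bump n a b)"
proof -
  have "Ck k (\<lambda>x. box_bump n a b x)"
    unfolding box_bump_def by (intro Ck_prod Ck_mult Ck_flat) auto
  then show ?thesis by simp
qed

lemma box_bump_bounds: "0 \<le> box_bump n a b x" "box_bump n a b x \<le> 1"
  unfolding box_bump_def
  by (auto intro!: prod_nonneg prod_le_1 mult_nonneg_nonneg mult_le_one flat_1_bounds)

lemma box_bump_pos_iff: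
  assumes "n > 0"
  shows "box_bump n a b x > 0 \<longleftrightarrow> (\<forall>i. a $ i + 1/n < x $ i \<and> x $ i < b $ i - 1/n)"
proof -
  have "box_bump n a b x > 0 \<longleftrightarrow>
      (\<forall>i. flat 1 (n * x $ i + (- n * a $ i - 1)) \<noteq> 0 \<and> flat 1 ((- n) * x $ i + (n * b $ i - 1)) \<noteq> 0)"
    using box_bump_bounds(1)[of n a b x] unfolding box_bump_def
    by (auto simp: less_le prod_zero_iff)
  also have "\<dots> \<longleftrightarrow> (\<forall>i. a $ i + 1/n < x $ i \<and> x $ i < b $ i - 1/n)"
    using assms by (auto simp: flat_1 field_simps split: if_splits)
  finally show ?thesis .
qed

lemma box_bump_nonzero:
  assumes "n > 0" "box_bump n a b x \<noteq> 0"
  shows "x \<in> cbox (a + (\<chi> i. 1/n)) (b - (\<chi> i. 1/n))"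
proof -
  have "box_bump n a b x > 0" using assms box_bump_bounds(1)[of n a b x] by simp
  then show ?thesis using assms by (auto simp: box_bump_pos_iff mem_box_cart less_imp_le)
qed

lemma box_bump_tendsto: "(\<lambda>n. box_bump (real n) a b x) \<longlonglongrightarrow> indicator (box a b) x"
proof (cases "x \<in> box a b")
  case True
  have lin: "filterlim (\<lambda>n. c * real n - 1) at_top sequentially" if "c > 0" for c :: real
    using that filterlim_tendsto_add_at_top[OF tendsto_const[of "-1"]
        filterlim_tendsto_pos_mult_at_top[OF tendsto_const that filterlim_real_sequentially]] by simp
  have "(\<lambda>n. flat 1 (real n * x $ i + (- real n * a $ i - 1)) *
             flat 1 ((- real n) * x $ i + (real n * b $ i - 1))) \<longlonglongrightarrow> 1 * 1" for i
  proof (intro tendsto_mult)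
    have "0 < x $ i - a $ i" "0 < b $ i - x $ i" using True by (auto simp: mem_box_cart)
    note * = this[THEN lin, THEN filterlim_compose[OF flat_1_tendsto_1]]
    show "(\<lambda>n. flat 1 (real n * x $ i + (- real n * a $ i - 1))) \<longlonglongrightarrow> 1"
      using *(1) by (simp add: algebra_simps)
    show "(\<lambda>n. flat 1 (- real n * x $ i + (real n * b $ i - 1))) \<longlonglongrightarrow> 1"
      using *(2) by (simp add: algebra_simps)
  qed
  then have "(\<lambda>n. box_bump (real n) a b x) \<longlonglongrightarrow> (\<Prod>i::'a\<in>UNIV. 1)"
    unfolding box_bump_def by (intro tendsto_prod) simp
  then show ?thesis using True by simp
next
  case False
  have "box_bump (real n) a b x = 0" if n: "n > 0" for n
  proof (rule ccontr)
    assume "box_bump (real n) a b x \<noteq> 0"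
    then have "box_bump (real n) a b x > 0" using box_bump_bounds(1)[of n a b x] by simp
    then have "\<forall>i. a $ i < x $ i \<and> x $ i < b $ i"
      using n by (simp add: box_bump_pos_iff) (smt (verit) divide_pos_pos of_nat_0_less_iff)
    then show False using False by (auto simp: mem_box_cart)
  qed
  then have "eventually (\<lambda>n. box_bump (real n) a b x = 0) sequentially"
    by (auto intro: eventually_mono[OF eventually_gt_at_top[of 0]])
  then show ?thesis using False by (simp add: tendsto_eventually)
qed

section \<open>The space of square integrable functions\<close>

text \<open>The inner product and the norm of \<open>L\<^sup>2(\<Omega>)\<close>, on functions rather than on classes modulo null
  sets; \<open>L2_norm\<close> is therefore only a seminorm.\<close>

definition L2_inner :: "(real^'d::finite) set \<Rightarrow> (real^'d \<Rightarrow> 'a::euclidean_space) \<Rightarrow> (real^'d \<Rightarrow> 'a) \<Rightarrow> real" where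
  "L2_inner \<Omega> f g = (LINT x|lebesgue_on \<Omega>. f x \<bullet> g x)"

definition L2_norm :: "(real^'d::finite) set \<Rightarrow> (real^'d \<Rightarrow> 'a::euclidean_space) \<Rightarrow> real" where
  "L2_norm \<Omega> f = sqrt (L2_inner \<Omega> f f)"

lemma L2_measurable: "f \<in> L2 \<Omega> \<Longrightarrow> f \<in> borel_measurable (lebesgue_on \<Omega>)"
  and L2_integrable_square: "f \<in> L2 \<Omega> \<Longrightarrow> integrable (lebesgue_on \<Omega>) (\<lambda>x. (norm (f x))\<^sup>2)"
  by (auto simp: L2_def)

lemma L2_bound:
  assumes "f \<in> borel_measurable (lebesgue_on \<Omega>)" "g \<in> L2 \<Omega>"
    and "AE x in lebesgue_on \<Omega>. norm (f x) \<le> norm (g x)"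
  shows "f \<in> L2 \<Omega>"
proof -
  have "integrable (lebesgue_on \<Omega>) (\<lambda>x. (norm (f x))\<^sup>2)"
    by (rule Bochner_Integration.integrable_bound[OF L2_integrable_square[OF assms(2)]])
       (use assms in \<open>auto elim!: eventually_mono intro: power_mono\<close>)
  then show ?thesis using assms by (simp add: L2_def)
qed

lemma L2_bound_fun:
  assumes "f \<in> borel_measurable (lebesgue_on \<Omega>)" "g \<in> L2 \<Omega>"
    and "\<And>x. x \<in> \<Omega> \<Longrightarrow> norm (f x) \<le> norm (g x)"
  shows "f \<in> L2 \<Omega>"
  by (rule L2_bound[OF assms(1,2)]) (use assms(3) in \<open>auto intro!: AE_I2\<close>)

lemma L2_cmult: "f \<in> L2 \<Omega> \<Longrightarrow> (\<lambda>x. c *\<^sub>R f x) \<in> L2 \<Omega>"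
  by (auto simp: L2_def power_mult_distrib)

lemma L2_add:
  assumes "f \<in> L2 \<Omega>" "g \<in> L2 \<Omega>"
  shows "(\<lambda>x. f x + g x) \<in> L2 \<Omega>"
proof -
  have m: "f \<in> borel_measurable (lebesgue_on \<Omega>)" "g \<in> borel_measurable (lebesgue_on \<Omega>)"
    using assms L2_measurable by blast+
  have b: "(norm (f x + g x))\<^sup>2 \<le> 2 * (norm (f x))\<^sup>2 + 2 * (norm (g x))\<^sup>2" for x
  proof -
    have "(norm (f x + g x))\<^sup>2 \<le> (norm (f x) + norm (g x))\<^sup>2"
      by (intro power_mono norm_triangle_ineq) auto
    then show ?thesis
      using sum_squares_bound[of "norm (f x)" "norm (g x)"] by (simp add: power2_sum)
  qed
  have "integrable (lebesgue_on \<Omega>) (\<lambda>x. (norm (f x + g x))\<^sup>2)"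
    by (rule Bochner_Integration.integrable_bound[where f="\<lambda>x. 2 * (norm (f x))\<^sup>2 + 2 * (norm (g x))\<^sup>2"])
       (use m b L2_integrable_square[OF assms(1)] L2_integrable_square[OF assms(2)] in auto)
  then show ?thesis using m by (simp add: L2_def)
qed

lemma L2_diff: "f \<in> L2 \<Omega> \<Longrightarrow> g \<in> L2 \<Omega> \<Longrightarrow> (\<lambda>x. f x - g x) \<in> L2 \<Omega>"
  using L2_add[of f \<Omega> "\<lambda>x. (-1) *\<^sub>R g x"] L2_cmult[of g \<Omega> "-1"] by simp

lemma L2_zero: "(\<lambda>x. 0) \<in> L2 \<Omega>"
  by (simp add: L2_def)

lemma L2_inner_integrable:
  assumes "f \<in> L2 \<Omega>" "g \<in> L2 \<Omega>"
  shows "integrable (lebesgue_on \<Omega>) (\<lambda>x. f x \<bullet> g x)"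
proof (rule Bochner_Integration.integrable_bound[where f="\<lambda>x. (norm (f x))\<^sup>2 + (norm (g x))\<^sup>2"])
  have "\<bar>f x \<bullet> g x\<bar> \<le> (norm (f x))\<^sup>2 + (norm (g x))\<^sup>2" for x
  proof -
    have "\<bar>f x \<bullet> g x\<bar> \<le> norm (f x) * norm (g x)" by (rule Cauchy_Schwarz_ineq2)
    also have "\<dots> \<le> (norm (f x))\<^sup>2 + (norm (g x))\<^sup>2"
      using sum_squares_bound[of "norm (f x)" "norm (g x)"]
        mult_nonneg_nonneg[OF norm_ge_zero[of "f x"] norm_ge_zero[of "g x"]] by linarith
    finally show ?thesis .
  qed
  then show "AE x in lebesgue_on \<Omega>. norm (f x \<bullet> g x) \<le> norm ((norm (f x))\<^sup>2 + (norm (g x))\<^sup>2)"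
    by auto
qed (use assms in \<open>auto simp: L2_def\<close>)

lemma L2_inner_add_left:
  "f \<in> L2 \<Omega> \<Longrightarrow> g \<in> L2 \<Omega> \<Longrightarrow> h \<in> L2 \<Omega> \<Longrightarrow>
    L2_inner \<Omega> (\<lambda>x. f x + g x) h = L2_inner \<Omega> f h + L2_inner \<Omega> g h"
  by (simp add: L2_inner_def inner_add_left L2_inner_integrable)

lemma L2_inner_scaleR_left: "L2_inner \<Omega> (\<lambda>x. c *\<^sub>R f x) h = c * L2_inner \<Omega> f h"
  by (simp add: L2_inner_def)

lemma L2_inner_diff_left:
  "f \<in> L2 \<Omega> \<Longrightarrow> g \<in> L2 \<Omega> \<Longrightarrow> h \<in> L2 \<Omega> \<Longrightarrow>
    L2_inner \<Omega> (\<lambda>x. f x - g x) h = L2_inner \<Omega> f h - L2_inner \<Omega> g h"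
  by (simp add: L2_inner_def inner_diff_left L2_inner_integrable)

lemma L2_inner_commute: "L2_inner \<Omega> f g = L2_inner \<Omega> g f"
  by (simp add: L2_inner_def inner_commute)

lemma L2_inner_ge_0: "0 \<le> L2_inner \<Omega> f f"
  by (simp add: L2_inner_def)

lemma L2_norm_ge_0: "0 \<le> L2_norm \<Omega> f"
  by (simp add: L2_norm_def L2_inner_ge_0)

lemma L2_norm_square: "(L2_norm \<Omega> f)\<^sup>2 = L2_inner \<Omega> f f"
  by (simp add: L2_norm_def L2_inner_ge_0)

lemma L2_norm_square_integral: "(L2_norm \<Omega> f)\<^sup>2 = (LINT x|lebesgue_on \<Omega>. (norm (f x))\<^sup>2)"
  by (simp add: L2_norm_square L2_inner_def power2_norm_eq_inner)

lemma L2_norm_cong: "(\<And>x. x \<in> \<Omega> \<Longrightarrow> norm (f x) = norm (g x)) \<Longrightarrow> L2_norm \<Omega> f = L2_norm \<Omega> g"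
  unfolding L2_norm_def L2_inner_def power2_norm_eq_inner[symmetric]
  by (auto intro!: arg_cong[where f=sqrt] Bochner_Integration.integral_cong)

lemma L2_norm_cong_AE:
  assumes "AE x in lebesgue_on \<Omega>. f x = g x"
    "f \<in> borel_measurable (lebesgue_on \<Omega>)" "g \<in> borel_measurable (lebesgue_on \<Omega>)"
  shows "L2_norm \<Omega> f = L2_norm \<Omega> g"
  unfolding L2_norm_def L2_inner_def
  by (intro arg_cong[where f=sqrt] integral_cong_AE) (use assms in auto)

lemma L2_norm_scaleR: "L2_norm \<Omega> (\<lambda>x. c *\<^sub>R f x) = \<bar>c\<bar> * L2_norm \<Omega> f"
  by (simp add: L2_norm_def L2_inner_def real_sqrt_mult mult.assoc[symmetric]
      power2_eq_square[symmetric])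

lemma L2_norm_mono:
  assumes "f \<in> borel_measurable (lebesgue_on \<Omega>)" "g \<in> L2 \<Omega>"
    and "\<And>x. x \<in> \<Omega> \<Longrightarrow> norm (f x) \<le> norm (g x)"
  shows "L2_norm \<Omega> f \<le> L2_norm \<Omega> g"
proof -
  have "f \<in> L2 \<Omega>" using assms by (rule L2_bound_fun)
  then have "(L2_norm \<Omega> f)\<^sup>2 \<le> (L2_norm \<Omega> g)\<^sup>2"
    unfolding L2_norm_square_integral
    by (intro integral_mono L2_integrable_square assms(2) power_mono) (auto simp: assms(3))
  then show ?thesis by (rule power2_le_imp_le[OF _ L2_norm_ge_0])
qed

lemma L2_inner_Cauchy_Schwarz:
  assumes f: "f \<in> L2 \<Omega>" and g: "g \<in> L2 \<Omega>"
  shows "\<bar>L2_inner \<Omega> f g\<bar> \<le> L2_norm \<Omega> f * L2_norm \<Omega> g"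
proof -
  define A B C where "A = L2_inner \<Omega> f f" and "B = L2_inner \<Omega> f g" and "C = L2_inner \<Omega> g g"
  have q: "0 \<le> A - 2 * t * B + t\<^sup>2 * C" for t
  proof -
    have "0 \<le> L2_inner \<Omega> (\<lambda>x. f x - t *\<^sub>R g x) (\<lambda>x. f x - t *\<^sub>R g x)" by (rule L2_inner_ge_0)
    also have "\<dots> = (LINT x|lebesgue_on \<Omega>. f x \<bullet> f x - 2 * t * (f x \<bullet> g x) + t\<^sup>2 * (g x \<bullet> g x))"
      unfolding L2_inner_def
      by (intro Bochner_Integration.integral_cong refl)
         (simp add: inner_diff_left inner_diff_right inner_commute power2_eq_square algebra_simps)
    also have "\<dots> = A - 2 * t * B + t\<^sup>2 * C"
      unfolding A_def B_def C_def L2_inner_def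
      using L2_inner_integrable[OF f f] L2_inner_integrable[OF f g] L2_inner_integrable[OF g g]
      by simp
    finally show ?thesis .
  qed
  have "B\<^sup>2 \<le> A * C"
  proof (cases "C = 0")
    case True
    have "B = 0"
    proof (rule ccontr)
      assume "B \<noteq> 0"
      then show False using q[of "(A + 1) / (2 * B)"] True by simp
    qed
    then show ?thesis using True by simp
  next
    case False
    then have "C > 0" using L2_inner_ge_0[of \<Omega> g] by (simp add: C_def)
    then show ?thesis using q[of "B / C"] by (simp add: field_simps power2_eq_square)
  qed
  then have "sqrt (B\<^sup>2) \<le> sqrt (A * C)" by (rule real_sqrt_le_mono)
  then show ?thesis by (simp add: A_def B_def C_def L2_norm_def real_sqrt_mult)
qed

lemma L2_norm_triangle:
  assumes f: "f \<in> L2 \<Omega>" and g: "g \<in> L2 \<Omega>"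
  shows "L2_norm \<Omega> (\<lambda>x. f x + g x) \<le> L2_norm \<Omega> f + L2_norm \<Omega> g"
proof (rule power2_le_imp_le)
  have "(L2_norm \<Omega> (\<lambda>x. f x + g x))\<^sup>2 = (L2_norm \<Omega> f)\<^sup>2 + 2 * L2_inner \<Omega> f g + (L2_norm \<Omega> g)\<^sup>2"
    unfolding L2_norm_square
    using L2_inner_integrable[OF f f] L2_inner_integrable[OF f g] L2_inner_integrable[OF g g]
    by (simp add: L2_inner_def inner_add_left inner_add_right inner_commute)
  also have "\<dots> \<le> (L2_norm \<Omega> f + L2_norm \<Omega> g)\<^sup>2"
    using L2_inner_Cauchy_Schwarz[OF f g] by (simp add: power2_sum)
  finally show "(L2_norm \<Omega> (\<lambda>x. f x + g x))\<^sup>2 \<le> (L2_norm \<Omega> f + L2_norm \<Omega> g)\<^sup>2" .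
qed (simp add: L2_norm_ge_0)

lemma L2_norm_triangle_diff:
  assumes "f \<in> L2 \<Omega>" "g \<in> L2 \<Omega>" "h \<in> L2 \<Omega>"
  shows "L2_norm \<Omega> (\<lambda>x. f x - h x) \<le> L2_norm \<Omega> (\<lambda>x. f x - g x) + L2_norm \<Omega> (\<lambda>x. g x - h x)"
  using L2_norm_triangle[of "\<lambda>x. f x - g x" \<Omega> "\<lambda>x. g x - h x"] assms by (simp add: L2_diff)

lemma L2_norm_minus_commute: "L2_norm \<Omega> (\<lambda>x. f x - g x) = L2_norm \<Omega> (\<lambda>x. g x - f x)"
  by (rule L2_norm_cong) (simp add: norm_minus_commute)

lemma L2_norm_diff_le:
  assumes "f \<in> L2 \<Omega>" "g \<in> L2 \<Omega>"
  shows "L2_norm \<Omega> f \<le> L2_norm \<Omega> g + L2_norm \<Omega> (\<lambda>x. f x - g x)"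
  using L2_norm_triangle[OF assms(2) L2_diff[OF assms]] by simp

lemma L2_norm_eq_0_AE:
  assumes "f \<in> L2 \<Omega>" "L2_norm \<Omega> f = 0"
  shows "AE x in lebesgue_on \<Omega>. f x = 0"
proof -
  have "(LINT x|lebesgue_on \<Omega>. (norm (f x))\<^sup>2) = 0"
    using assms(2) by (simp flip: L2_norm_square_integral)
  then show ?thesis
    using integral_nonneg_eq_0_iff_AE[OF L2_integrable_square[OF assms(1)]] by auto
qed

lemma L2_inner_tendsto_left:
  assumes f: "\<And>n. f n \<in> L2 \<Omega>" "g \<in> L2 \<Omega>" "h \<in> L2 \<Omega>"
    and "(\<lambda>n. L2_norm \<Omega> (\<lambda>x. f n x - g x)) \<longlonglongrightarrow> 0"
  shows "(\<lambda>n. L2_inner \<Omega> (f n) h) \<longlonglongrightarrow> L2_inner \<Omega> g h"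
proof (rule LIM_zero_cancel, rule Lim_null_comparison)
  show "\<forall>\<^sub>F n in sequentially. norm (L2_inner \<Omega> (f n) h - L2_inner \<Omega> g h)
      \<le> L2_norm \<Omega> (\<lambda>x. f n x - g x) * L2_norm \<Omega> h"
    using L2_inner_Cauchy_Schwarz[OF L2_diff[OF f(1,2)] f(3)]
    by (intro always_eventually) (simp add: L2_inner_diff_left f)
  show "(\<lambda>n. L2_norm \<Omega> (\<lambda>x. f n x - g x) * L2_norm \<Omega> h) \<longlonglongrightarrow> 0"
    using tendsto_mult_right[OF assms(4)] by simp
qed

lemma L2_norm_tendsto:
  assumes f: "\<And>n. f n \<in> L2 \<Omega>" "g \<in> L2 \<Omega>"
    and l: "(\<lambda>n. L2_norm \<Omega> (\<lambda>x. f n x - g x)) \<longlonglongrightarrow> 0"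
  shows "(\<lambda>n. L2_norm \<Omega> (f n)) \<longlonglongrightarrow> L2_norm \<Omega> g"
proof (rule LIM_zero_cancel, rule Lim_null_comparison[OF _ l])
  have "\<bar>L2_norm \<Omega> (f n) - L2_norm \<Omega> g\<bar> \<le> L2_norm \<Omega> (\<lambda>x. f n x - g x)" for n
    using L2_norm_diff_le[OF f(1)[of n] f(2)] L2_norm_diff_le[OF f(2) f(1)[of n]]
      L2_norm_minus_commute[of \<Omega> "f n" g] by linarith
  then show "\<forall>\<^sub>F n in sequentially. norm (L2_norm \<Omega> (f n) - L2_norm \<Omega> g)
      \<le> L2_norm \<Omega> (\<lambda>x. f n x - g x)" by simp
qed

text \<open>Riesz--Fischer: passing to a subsequence with \<open>\<Sum>\<^sub>k 4\<^sup>k \<parallel>f\<^sub>k\<^sub>+\<^sub>1 - f\<^sub>k\<parallel>\<^sup>2 < \<infinity>\<close> forces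
  pointwise convergence almost everywhere, and the Fatou lemma gives convergence in norm.\<close>

theorem L2_complete:
  fixes f :: "nat \<Rightarrow> real^'d::finite \<Rightarrow> 'a::euclidean_space"
  assumes f: "\<And>n. f n \<in> L2 \<Omega>"
    and Cauchy: "\<And>e. e > 0 \<Longrightarrow> \<exists>N. \<forall>m\<ge>N. \<forall>n\<ge>N. L2_norm \<Omega> (\<lambda>x. f m x - f n x) < e"
  obtains g where "g \<in> L2 \<Omega>" "(\<lambda>n. L2_norm \<Omega> (\<lambda>x. f n x - g x)) \<longlonglongrightarrow> 0"
proof -
  let ?M = "lebesgue_on \<Omega>"
  have [measurable]: "f n \<in> borel_measurable ?M" for n using f L2_measurable by blast
  have nn: "(\<integral>\<^sup>+x. ennreal ((norm (h x))\<^sup>2) \<partial>?M) = ennreal ((L2_norm \<Omega> h)\<^sup>2)"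
    if "h \<in> L2 \<Omega>" for h :: "real^'d \<Rightarrow> 'a"
    unfolding L2_norm_square_integral by (intro nn_integral_eq_integral L2_integrable_square that) auto
  have "\<forall>k::nat. \<exists>N. \<forall>m\<ge>N. \<forall>n\<ge>N. L2_norm \<Omega> (\<lambda>x. f m x - f n x) < (1/4)^k"
    using Cauchy by simp
  then obtain N where N: "\<And>k m n. m \<ge> N k \<Longrightarrow> n \<ge> N k \<Longrightarrow> L2_norm \<Omega> (\<lambda>x. f m x - f n x) < (1/4)^k"
    by metis
  define r where "r k = (\<Sum>i\<le>k. N i) + k" for k
  have r_ge: "r k \<ge> N k" for k unfolding r_def by (induction k) auto
  have r_mono: "r k \<le> r (Suc k)" for k unfolding r_def by simp
  have r_k: "r k \<ge> k" for k by (simp add: r_def)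
  have mono_r: "k \<le> j \<Longrightarrow> r k \<le> r j" for k j using r_mono by (rule lift_Suc_mono_le)
  define d where "d k x = f (r (Suc k)) x - f (r k) x" for k x
  have d: "d k \<in> L2 \<Omega>" for k unfolding d_def by (intro L2_diff f)
  have [measurable]: "d k \<in> borel_measurable ?M" for k using d L2_measurable by blast
  have dn: "(L2_norm \<Omega> (d k))\<^sup>2 \<le> (1/16)^k" for k
  proof -
    have "L2_norm \<Omega> (d k) \<le> (1/4)^k"
      unfolding d_def using r_ge[of k] r_mono[of k] by (intro less_imp_le[OF N]) auto
    then have "(L2_norm \<Omega> (d k))\<^sup>2 \<le> ((1/4)^k)\<^sup>2" by (intro power_mono L2_norm_ge_0)
    then show ?thesis by (simp add: power_mult[symmetric] mult.commute power2_eq_square power_mult_distrib[symmetric])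
  qed
  have "(\<integral>\<^sup>+x. (\<Sum>k. ennreal (4^k * (norm (d k x))\<^sup>2)) \<partial>?M)
      = (\<Sum>k. \<integral>\<^sup>+x. ennreal (4^k * (norm (d k x))\<^sup>2) \<partial>?M)"
    by (intro nn_integral_suminf) measurable
  also have "\<dots> = (\<Sum>k. ennreal (4^k * (L2_norm \<Omega> (d k))\<^sup>2))"
    by (simp add: ennreal_mult nn_integral_cmult nn[OF d])
  also have "\<dots> \<le> (\<Sum>k. ennreal ((1/4)^k))"
  proof (intro suminf_le ennreal_leI)
    fix k
    have "4^k * (L2_norm \<Omega> (d k))\<^sup>2 \<le> 4^k * (1/16)^k" by (intro mult_left_mono dn) auto
    also have "\<dots> = (1/4)^k" by (simp add: power_mult_distrib[symmetric])
    finally show "4^k * (L2_norm \<Omega> (d k))\<^sup>2 \<le> (1/4)^k" .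
  qed auto
  also have "\<dots> = ennreal (\<Sum>k. (1/4)^k)"
    by (intro suminf_ennreal2 summable_geometric) auto
  also have "\<dots> < \<infinity>" unfolding infinity_ennreal_def by (rule ennreal_less_top)
  finally have "(\<integral>\<^sup>+x. (\<Sum>k. ennreal (4^k * (norm (d k x))\<^sup>2)) \<partial>?M) \<noteq> \<infinity>" by simp
  then have fin: "AE x in ?M. (\<Sum>k. ennreal (4^k * (norm (d k x))\<^sup>2)) \<noteq> \<infinity>"
    by (intro nn_integral_noteq_infinite) measurable
  have conv: "AE x in ?M. convergent (\<lambda>k. f (r k) x)"
    using fin
  proof eventually_elim
    fix x assume "(\<Sum>k. ennreal (4^k * (norm (d k x))\<^sup>2)) \<noteq> \<infinity>"
    then have "summable (\<lambda>k. 4^k * (norm (d k x))\<^sup>2)"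
      by (intro summable_suminf_not_top) (auto simp: top_unique infinity_ennreal_def)
    then obtain B where B: "\<And>k. 4^k * (norm (d k x))\<^sup>2 \<le> B"
      using summable_imp_Bseq[of "\<lambda>k. 4^k * (norm (d k x))\<^sup>2"] unfolding Bseq_def by auto
    have "norm (d k x) \<le> sqrt B * (1/2)^k" for k
    proof -
      have "(2^k * norm (d k x))\<^sup>2 \<le> B"
        using B[of k] by (simp add: power_mult_distrib power_mult[symmetric] mult.commute[of k])
           (simp add: power_mult)
      then have "2^k * norm (d k x) \<le> sqrt B" by (rule real_le_rsqrt)
      then show ?thesis by (simp add: field_simps)
    qed
    note le = this
    have sm: "summable (\<lambda>k. sqrt B * (1/2)^k)" by (intro summable_mult summable_geometric) simp
    have "summable (\<lambda>k. d k x)"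
      by (rule summable_comparison_test'[OF sm, of 0]) (rule le)
    then have "convergent (\<lambda>n. \<Sum>k<n. d k x)" by (simp add: summable_iff_convergent)
    moreover have "(\<Sum>k<n. d k x) = f (r n) x - f (r 0) x" for n
      unfolding d_def by (rule sum_lessThan_telescope)
    ultimately have "convergent (\<lambda>n. f (r n) x - f (r 0) x)" by simp
    then have "convergent (\<lambda>n. f (r n) x - f (r 0) x + f (r 0) x)"
      by (intro convergent_add convergent_const)
    then show "convergent (\<lambda>k. f (r k) x)" by simp
  qed
  define g where "g x = lim (\<lambda>k. f (r k) x)" for x
  have [measurable]: "g \<in> borel_measurable ?M" unfolding g_def by measurable
  have lim: "AE x in ?M. (\<lambda>k. f (r k) x) \<longlonglongrightarrow> g x"
    using conv unfolding g_def by eventually_elim (simp add: convergent_LIMSEQ_iff)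
  have fatou: "(\<integral>\<^sup>+x. ennreal ((norm (f n x - g x))\<^sup>2) \<partial>?M) \<le> ennreal (e\<^sup>2)"
    if e: "\<And>m. m \<ge> M \<Longrightarrow> L2_norm \<Omega> (\<lambda>x. f n x - f m x) \<le> e" for n M e
  proof -
    have "(\<integral>\<^sup>+x. ennreal ((norm (f n x - g x))\<^sup>2) \<partial>?M)
        = (\<integral>\<^sup>+x. liminf (\<lambda>k. ennreal ((norm (f n x - f (r k) x))\<^sup>2)) \<partial>?M)"
    proof (rule nn_integral_cong_AE, use lim in eventually_elim)
      fix x assume "(\<lambda>k. f (r k) x) \<longlonglongrightarrow> g x"
      then have "(\<lambda>k. ennreal ((norm (f n x - f (r k) x))\<^sup>2)) \<longlonglongrightarrow> ennreal ((norm (f n x - g x))\<^sup>2)"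
        by (intro tendsto_intros tendsto_ennrealI)
      then show "ennreal ((norm (f n x - g x))\<^sup>2) = liminf (\<lambda>k. ennreal ((norm (f n x - f (r k) x))\<^sup>2))"
        by (intro lim_imp_Liminf[symmetric]) auto
    qed
    also have "\<dots> \<le> liminf (\<lambda>k. \<integral>\<^sup>+x. ennreal ((norm (f n x - f (r k) x))\<^sup>2) \<partial>?M)"
      by (intro nn_integral_liminf) measurable
    also have "\<dots> = liminf (\<lambda>k. ennreal ((L2_norm \<Omega> (\<lambda>x. f n x - f (r k) x))\<^sup>2))"
      using nn[OF L2_diff[OF f[of n] f]] by simp
    also have "\<dots> \<le> liminf (\<lambda>k::nat. ennreal (e\<^sup>2))"
    proof (rule Liminf_mono)
      show "\<forall>\<^sub>F k in sequentially. ennreal ((L2_norm \<Omega> (\<lambda>x. f n x - f (r k) x))\<^sup>2) \<le> ennreal (e\<^sup>2)"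
        using eventually_ge_at_top[of M]
      proof eventually_elim
        fix k assume "k \<ge> M"
        then have "L2_norm \<Omega> (\<lambda>x. f n x - f (r k) x) \<le> e" using r_k[of k] by (intro e) auto
        then show "ennreal ((L2_norm \<Omega> (\<lambda>x. f n x - f (r k) x))\<^sup>2) \<le> ennreal (e\<^sup>2)"
          by (intro ennreal_leI power_mono L2_norm_ge_0)
      qed
    qed
    also have "\<dots> = ennreal (e\<^sup>2)" by (simp add: Liminf_const)
    finally show ?thesis .
  qed
  have fin_L2: "h \<in> L2 \<Omega>" if "h \<in> borel_measurable ?M" "(\<integral>\<^sup>+x. ennreal ((norm (h x))\<^sup>2) \<partial>?M) \<le> ennreal c"
    for h :: "real^'d \<Rightarrow> 'a" and c
    using that le_less_trans[OF that(2) ennreal_less_top]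
    by (auto simp: L2_def intro!: integrableI_bounded)
  obtain N1 where N1: "\<And>m n. m \<ge> N1 \<Longrightarrow> n \<ge> N1 \<Longrightarrow> L2_norm \<Omega> (\<lambda>x. f m x - f n x) < 1"
    using Cauchy[of 1] by auto
  have "(\<lambda>x. f N1 x - g x) \<in> L2 \<Omega>"
    by (rule fin_L2[OF _ fatou[of N1 N1 1]]) (auto intro: less_imp_le N1)
  then have g: "g \<in> L2 \<Omega>" using L2_diff[OF f[of N1]] by fastforce
  have "(\<lambda>n. L2_norm \<Omega> (\<lambda>x. f n x - g x)) \<longlonglongrightarrow> 0"
  proof (rule LIMSEQ_I)
    fix e :: real assume e: "e > 0"
    then obtain N2 where N2: "\<And>m n. m \<ge> N2 \<Longrightarrow> n \<ge> N2 \<Longrightarrow> L2_norm \<Omega> (\<lambda>x. f m x - f n x) < e/2"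
      using Cauchy[of "e/2"] by auto
    have "L2_norm \<Omega> (\<lambda>x. f n x - g x) \<le> e/2" if "n \<ge> N2" for n
    proof -
      have "ennreal ((L2_norm \<Omega> (\<lambda>x. f n x - g x))\<^sup>2) \<le> ennreal ((e/2)\<^sup>2)"
        using fatou[of N2 n "e/2"] N2 that nn[OF L2_diff[OF f[of n] g]] by (simp add: less_imp_le)
      then have "(L2_norm \<Omega> (\<lambda>x. f n x - g x))\<^sup>2 \<le> (e/2)\<^sup>2" by (simp add: ennreal_le_iff)
      then show ?thesis by (rule power2_le_imp_le) (use e in simp)
    qed
    then have "norm (L2_norm \<Omega> (\<lambda>x. f n x - g x) - 0) < e" if "n \<ge> N2" for n
      using e that L2_norm_ge_0[of \<Omega> "\<lambda>x. f n x - g x"] by fastforce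
    then show "\<exists>no. \<forall>n\<ge>no. norm (L2_norm \<Omega> (\<lambda>x. f n x - g x) - 0) < e"
      by blast
  qed
  with g show thesis by (rule that)
qed

text \<open>The Riesz representation theorem for a functional on a subspace of \<open>L\<^sup>2\<close> that need not be
  closed.  The representing function is the limit of a minimising sequence of
  \<open>v \<mapsto> \<parallel>v\<parallel>\<^sup>2 - 2 T v\<close>, hence it lies in the closure of the subspace.\<close>

theorem L2_Riesz:
  fixes V :: "(real^'d::finite \<Rightarrow> 'a::euclidean_space) set"
  assumes VL2: "V \<subseteq> L2 \<Omega>" and V0: "V \<noteq> {}"
    and Vadd: "\<And>f g. f \<in> V \<Longrightarrow> g \<in> V \<Longrightarrow> (\<lambda>x. f x + g x) \<in> V"
    and Vscale: "\<And>c f. f \<in> V \<Longrightarrow> (\<lambda>x. c *\<^sub>R f x) \<in> V"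
    and Tadd: "\<And>f g. f \<in> V \<Longrightarrow> g \<in> V \<Longrightarrow> T (\<lambda>x. f x + g x) = T f + T g"
    and Tscale: "\<And>c f. f \<in> V \<Longrightarrow> T (\<lambda>x. c *\<^sub>R f x) = c * T f"
    and Tbound: "\<And>f. f \<in> V \<Longrightarrow> \<bar>T f\<bar> \<le> C * L2_norm \<Omega> f"
  obtains g v where "g \<in> L2 \<Omega>" "\<And>f. f \<in> V \<Longrightarrow> T f = L2_inner \<Omega> g f" "L2_norm \<Omega> g \<le> \<bar>C\<bar>"
    "\<And>n::nat. v n \<in> V" "(\<lambda>n. L2_norm \<Omega> (\<lambda>x. v n x - g x)) \<longlonglongrightarrow> 0"
proof -
  define J where "J f = L2_inner \<Omega> f f - 2 * T f" for f
  have L: "f \<in> L2 \<Omega>" if "f \<in> V" for f using that VL2 by auto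
  have Tb: "\<bar>T f\<bar> \<le> \<bar>C\<bar> * L2_norm \<Omega> f" if "f \<in> V" for f
    using Tbound[OF that] mult_right_mono[OF abs_ge_self L2_norm_ge_0, of C \<Omega> f] by linarith
  have J_bound: "J f \<ge> - C\<^sup>2" if "f \<in> V" for f
    using Tb[OF that] sum_squares_bound[of "\<bar>C\<bar>" "L2_norm \<Omega> f"]
    unfolding J_def L2_norm_square[symmetric] by (auto simp: power2_eq_square)
  define m where "m = Inf (J ` V)"
  have bdd: "bdd_below (J ` V)" using J_bound by (intro bdd_belowI2)
  have m: "m \<le> J f" if "f \<in> V" for f unfolding m_def using bdd that by (intro cINF_lower)
  have "\<exists>f\<in>V. J f < m + 1 / real (Suc n)" for n
    using cInf_lessD[of "J ` V" "m + 1 / real (Suc n)"] V0 unfolding m_def by auto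
  then obtain v where v: "\<And>n. v n \<in> V" "\<And>n. J (v n) < m + 1 / real (Suc n)" by metis
  have parallelogram: "(L2_norm \<Omega> (\<lambda>x. f x - h x))\<^sup>2
      = 2 * J f + 2 * J h - 4 * J (\<lambda>x. (1/2) *\<^sub>R (f x + h x))" if "f \<in> V" "h \<in> V" for f h
  proof -
    have fh: "(\<lambda>x. f x + h x) \<in> V" using that Vadd by blast
    have "L2_inner \<Omega> (\<lambda>x. f x - h x) (\<lambda>x. f x - h x)
        = (LINT x|lebesgue_on \<Omega>. 2 * (f x \<bullet> f x) + 2 * (h x \<bullet> h x) - (f x + h x) \<bullet> (f x + h x))"
      unfolding L2_inner_def by (intro Bochner_Integration.integral_cong refl)
        (simp add: inner_diff_left inner_diff_right inner_add_left inner_add_right inner_commute)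
    also have "\<dots> = 2 * L2_inner \<Omega> f f + 2 * L2_inner \<Omega> h h
        - L2_inner \<Omega> (\<lambda>x. f x + h x) (\<lambda>x. f x + h x)"
      unfolding L2_inner_def
      using that[THEN L] L[OF fh] by (simp add: L2_inner_integrable)
    moreover have "J (\<lambda>x. (1/2) *\<^sub>R (f x + h x))
        = (1/4) * L2_inner \<Omega> (\<lambda>x. f x + h x) (\<lambda>x. f x + h x) - (T f + T h)"
    proof -
      have "T (\<lambda>x. (1/2) *\<^sub>R (f x + h x)) = (1/2) * (T f + T h)"
        by (simp only: Tscale[OF fh] Tadd[OF that])
      moreover have "L2_inner \<Omega> (\<lambda>x. (1/2) *\<^sub>R (f x + h x)) (\<lambda>x. (1/2) *\<^sub>R (f x + h x))
          = (1/4) * L2_inner \<Omega> (\<lambda>x. f x + h x) (\<lambda>x. f x + h x)"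
        unfolding L2_inner_def inner_scaleR_left inner_scaleR_right by simp
      ultimately show ?thesis by (simp add: J_def)
    qed
    ultimately show ?thesis by (simp add: J_def L2_norm_square)
  qed
  have dist: "(L2_norm \<Omega> (\<lambda>x. v n x - v k x))\<^sup>2 \<le> 2 / real (Suc n) + 2 / real (Suc k)" for n k
    using parallelogram[OF v(1)[of n] v(1)[of k]] v(2)[of n] v(2)[of k]
      m[OF Vscale[OF Vadd[OF v(1)[of n] v(1)[of k]], of "1/2"]] by simp
  obtain g where g: "g \<in> L2 \<Omega>" and lim: "(\<lambda>n. L2_norm \<Omega> (\<lambda>x. v n x - g x)) \<longlonglongrightarrow> 0"
  proof (rule L2_complete[of v \<Omega>])
    show "v n \<in> L2 \<Omega>" for n using v(1) L by blast
    fix e :: real assume e: "e > 0"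
    have "(\<lambda>n. 2 / real (Suc n)) \<longlonglongrightarrow> 0"
      using tendsto_mult_right[OF LIMSEQ_inverse_real_of_nat, of 2] by (simp add: field_simps)
    from order_tendstoD(2)[OF this, of "e\<^sup>2 / 2"] e
    obtain N where N: "\<And>n. n \<ge> N \<Longrightarrow> 2 / real (Suc n) < e\<^sup>2 / 2"
      unfolding eventually_sequentially by auto
    have "L2_norm \<Omega> (\<lambda>x. v n x - v k x) < e" if "n \<ge> N" "k \<ge> N" for n k
      using dist[of n k] N[OF that(1)] N[OF that(2)] e by (intro power2_less_imp_less[of _ e]) auto
    then show "\<exists>N. \<forall>n\<ge>N. \<forall>k\<ge>N. L2_norm \<Omega> (\<lambda>x. v n x - v k x) < e" by blast
  qed
  have rep: "T f = L2_inner \<Omega> g f" if f: "f \<in> V" for f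
  proof -
    have ineq: "0 \<le> 2 * t * (L2_inner \<Omega> g f - T f) + t\<^sup>2 * L2_inner \<Omega> f f" for t
    proof (rule LIMSEQ_le_const)
      have "(\<lambda>n. 1 / real (Suc n) + 2 * t * (L2_inner \<Omega> (v n) f - T f) + t\<^sup>2 * L2_inner \<Omega> f f)
          \<longlonglongrightarrow> 0 + 2 * t * (L2_inner \<Omega> g f - T f) + t\<^sup>2 * L2_inner \<Omega> f f"
        using LIMSEQ_inverse_real_of_nat
        by (intro tendsto_intros L2_inner_tendsto_left g L v(1) f lim) (simp add: inverse_eq_divide)
      then show "(\<lambda>n. 1 / real (Suc n) + 2 * t * (L2_inner \<Omega> (v n) f - T f) + t\<^sup>2 * L2_inner \<Omega> f f)
          \<longlonglongrightarrow> 2 * t * (L2_inner \<Omega> g f - T f) + t\<^sup>2 * L2_inner \<Omega> f f" by simp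
      have "0 \<le> 1 / real (Suc n) + 2 * t * (L2_inner \<Omega> (v n) f - T f) + t\<^sup>2 * L2_inner \<Omega> f f" for n
      proof -
        have tf: "(\<lambda>x. t *\<^sub>R f x) \<in> V" using Vscale f by blast
        note i = L2_inner_integrable[OF L[OF v(1)[of n]] L[OF v(1)[of n]]]
          L2_inner_integrable[OF L[OF v(1)[of n]] L[OF f]] L2_inner_integrable[OF L[OF f] L[OF f]]
        have "L2_inner \<Omega> (\<lambda>x. v n x + t *\<^sub>R f x) (\<lambda>x. v n x + t *\<^sub>R f x)
            = (LINT x|lebesgue_on \<Omega>. v n x \<bullet> v n x + 2 * t * (v n x \<bullet> f x) + t\<^sup>2 * (f x \<bullet> f x))"
          unfolding L2_inner_def by (intro Bochner_Integration.integral_cong refl)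
            (simp add: inner_add_left inner_add_right inner_commute power2_eq_square)
        also have "\<dots> = L2_inner \<Omega> (v n) (v n) + 2 * t * L2_inner \<Omega> (v n) f + t\<^sup>2 * L2_inner \<Omega> f f"
          unfolding L2_inner_def using i by simp
        moreover have "T (\<lambda>x. v n x + t *\<^sub>R f x) = T (v n) + t * T f"
          using Tadd[OF v(1)[of n] tf] Tscale[OF f, of t] by simp
        ultimately show ?thesis
          using m[OF Vadd[OF v(1)[of n] tf]] v(2)[of n] by (simp add: J_def algebra_simps)
      qed
      then show "\<exists>N. \<forall>n\<ge>N. 0 \<le> 1 / real (Suc n) + 2 * t * (L2_inner \<Omega> (v n) f - T f)
          + t\<^sup>2 * L2_inner \<Omega> f f" by blast
    qed
    show ?thesis
    proof (rule ccontr)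
      define a where "a = L2_inner \<Omega> g f - T f"
      define b where "b = L2_inner \<Omega> f f"
      assume "T f \<noteq> L2_inner \<Omega> g f"
      then have a: "a \<noteq> 0" by (simp add: a_def)
      have b: "b \<ge> 0" by (simp add: b_def L2_inner_ge_0)
      define s where "s = 1 / (b + 1)"
      have s: "s > 0" "s * b - 2 < 0" using b by (auto simp: s_def field_simps)
      define t where "t = - a * s"
      have "2 * t * a + t\<^sup>2 * b = a\<^sup>2 * s * (s * b - 2)"
        by (simp add: t_def algebra_simps power2_eq_square)
      also have "\<dots> < 0" using a s by (intro mult_pos_neg mult_pos_pos) auto
      finally show False using ineq[of t] by (simp add: a_def b_def)
    qed
  qed
  have "L2_norm \<Omega> g \<le> \<bar>C\<bar>"
  proof -
    have "(\<lambda>n. L2_inner \<Omega> (v n) g) \<longlonglongrightarrow> L2_inner \<Omega> g g"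
      by (intro L2_inner_tendsto_left g L v(1) lim)
    moreover have "(\<lambda>n. \<bar>C\<bar> * L2_norm \<Omega> (v n)) \<longlonglongrightarrow> \<bar>C\<bar> * L2_norm \<Omega> g"
      by (intro tendsto_intros L2_norm_tendsto g L v(1) lim)
    moreover have "L2_inner \<Omega> (v n) g \<le> \<bar>C\<bar> * L2_norm \<Omega> (v n)" for n
      using Tb[OF v(1)[of n]] rep[OF v(1)[of n]] L2_inner_commute[of \<Omega> "v n" g] by simp
    ultimately have "L2_inner \<Omega> g g \<le> \<bar>C\<bar> * L2_norm \<Omega> g"
      by (intro LIMSEQ_le) auto
    then have "L2_norm \<Omega> g * L2_norm \<Omega> g \<le> \<bar>C\<bar> * L2_norm \<Omega> g"
      by (simp add: L2_norm_square[symmetric] power2_eq_square)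
    then show ?thesis
      using L2_norm_ge_0[of \<Omega> g] by (cases "L2_norm \<Omega> g = 0") auto
  qed
  then show thesis using that g rep v(1) lim by blast
qed

section \<open>Test functions\<close>

lemma partial_eq_0_outside:
  assumes "closed C" "\<And>x. x \<notin> C \<Longrightarrow> f x = 0" "x \<notin> C"
  shows "partial i f x = 0"
proof -
  have "(f has_derivative (\<lambda>h. 0)) (at x)"
    by (rule has_derivative_transform_within_open[OF has_derivative_const[of 0], of "- C"])
       (use assms in auto)
  then show ?thesis by (simp add: partial_eq)
qed

lemma Cc_Ck: "\<phi> \<in> Cc_infinity \<Omega> \<Longrightarrow> Ck k \<phi>"
  by (simp add: Cc_infinity_def)

lemma Cc_differentiable: "\<phi> \<in> Cc_infinity \<Omega> \<Longrightarrow> \<phi> differentiable (at x)"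
  using Cc_Ck[of \<phi> \<Omega> "Suc 0"] by simp

lemma Cc_continuous: "\<phi> \<in> Cc_infinity \<Omega> \<Longrightarrow> continuous_on S \<phi>"
  using Cc_Ck[of \<phi> \<Omega> 0] by (auto intro: continuous_on_subset)

lemma Cc_support:
  assumes "\<phi> \<in> Cc_infinity \<Omega>"
  obtains C where "compact C" "C \<subseteq> \<Omega>" "\<And>x. x \<notin> C \<Longrightarrow> \<phi> x = 0"
  using assms by (auto simp: Cc_infinity_def)

lemma Cc_outside: "\<phi> \<in> Cc_infinity \<Omega> \<Longrightarrow> x \<notin> \<Omega> \<Longrightarrow> \<phi> x = 0"
  by (meson Cc_support subsetD)

lemma Cc_infinity_mono: "\<Omega> \<subseteq> \<Omega>' \<Longrightarrow> Cc_infinity \<Omega> \<subseteq> Cc_infinity \<Omega>'"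
  unfolding Cc_infinity_def by blast

lemma Cc_zero: "(\<lambda>x. 0) \<in> Cc_infinity \<Omega>"
  unfolding Cc_infinity_def by (auto intro!: Ck_const exI[of _ "{}"])

lemma Cc_add:
  assumes "\<phi> \<in> Cc_infinity \<Omega>" "\<psi> \<in> Cc_infinity \<Omega>"
  shows "(\<lambda>x. \<phi> x + \<psi> x) \<in> Cc_infinity \<Omega>"
proof -
  obtain C D where "compact C" "C \<subseteq> \<Omega>" "\<And>x. x \<notin> C \<Longrightarrow> \<phi> x = 0"
    "compact D" "D \<subseteq> \<Omega>" "\<And>x. x \<notin> D \<Longrightarrow> \<psi> x = 0"
    using assms Cc_support by metis
  then show ?thesis
    using assms by (auto simp: Cc_infinity_def intro!: Ck_add exI[of _ "C \<union> D"])
qed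

lemma Cc_mult_smooth:
  assumes "\<phi> \<in> Cc_infinity \<Omega>" "\<And>k. Ck k f"
  shows "(\<lambda>x. f x * \<phi> x) \<in> Cc_infinity \<Omega>"
proof -
  obtain C where "compact C" "C \<subseteq> \<Omega>" "\<And>x. x \<notin> C \<Longrightarrow> \<phi> x = 0"
    using assms Cc_support by metis
  then show ?thesis
    using assms by (auto simp: Cc_infinity_def intro!: Ck_mult exI[of _ "C"])
qed

lemma Cc_cmult: "\<phi> \<in> Cc_infinity \<Omega> \<Longrightarrow> (\<lambda>x. c * \<phi> x) \<in> Cc_infinity \<Omega>"
  by (intro Cc_mult_smooth Ck_const)

lemma Cc_partial:
  assumes "\<phi> \<in> Cc_infinity \<Omega>"
  shows "partial i \<phi> \<in> Cc_infinity \<Omega>"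
proof -
  obtain C where C: "compact C" "C \<subseteq> \<Omega>" "\<And>x. x \<notin> C \<Longrightarrow> \<phi> x = 0"
    using assms Cc_support by metis
  moreover have "Ck k (partial i \<phi>)" for k using Cc_Ck[OF assms, of "Suc k"] by simp
  moreover have "partial i \<phi> x = 0" if "x \<notin> C" for x
    using partial_eq_0_outside C that compact_imp_closed by metis
  ultimately show ?thesis by (auto simp: Cc_infinity_def)
qed

lemma Cc_bounded:
  assumes "\<phi> \<in> Cc_infinity \<Omega>"
  obtains B where "B > 0" "\<And>x. \<bar>\<phi> x\<bar> \<le> B"
proof -
  obtain C where C: "compact C" "C \<subseteq> \<Omega>" "\<And>x. x \<notin> C \<Longrightarrow> \<phi> x = 0"
    using assms Cc_support by metis
  have "bounded (\<phi> ` C)"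
    using C(1) Cc_continuous[OF assms] compact_continuous_image compact_imp_bounded by blast
  then obtain B where "B > 0" "\<And>x. x \<in> C \<Longrightarrow> \<bar>\<phi> x\<bar> \<le> B"
    by (auto simp: bounded_pos)
  then show thesis using that[of B] C(3) by (metis abs_zero less_imp_le)
qed

lemma Cc_borel [measurable_dest]: "\<phi> \<in> Cc_infinity \<Omega> \<Longrightarrow> \<phi> \<in> borel_measurable borel"
  by (intro borel_measurable_continuous_onI Cc_continuous)

lemma borel_imp_lebesgue_on: "f \<in> borel_measurable borel \<Longrightarrow> f \<in> borel_measurable (lebesgue_on \<Omega>)"
  by (simp add: borel_measurable_if_D measurable_completion measurable_restrict_space1)

lemma Cc_measurable: "\<phi> \<in> Cc_infinity \<Omega> \<Longrightarrow> \<phi> \<in> borel_measurable (lebesgue_on \<Omega>')"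
  by (intro borel_imp_lebesgue_on Cc_borel)

lemma line_has_derivative:
  assumes "f differentiable (at (x + t *\<^sub>R axis i 1))"
  shows "((\<lambda>t. f (x + t *\<^sub>R axis i 1)) has_real_derivative partial i f (x + t *\<^sub>R axis i 1)) (at t)"
proof -
  let ?D = "frechet_derivative f (at (x + t *\<^sub>R axis i 1))"
  have 1: "(f has_derivative ?D) (at (x + t *\<^sub>R axis i 1))"
    using assms frechet_derivative_works by blast
  have "((\<lambda>t. x + t *\<^sub>R axis i 1) has_derivative (\<lambda>h. h *\<^sub>R axis i 1)) (at t)"
    by (auto intro!: derivative_eq_intros)
  from has_derivative_compose[OF this 1]
  have "((\<lambda>t. f (x + t *\<^sub>R axis i 1)) has_derivative (\<lambda>h. ?D (h *\<^sub>R axis i 1))) (at t)" .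
  moreover have "?D (h *\<^sub>R axis i 1) = partial i f (x + t *\<^sub>R axis i 1) * h" for h
    using has_derivative_bounded_linear[OF 1] by (simp add: linear_simps partial_def)
  ultimately show ?thesis by (simp add: has_field_derivative_def)
qed

lemma difference_quotient_bound:
  assumes "\<And>x. f differentiable (at x)" "\<And>x. \<bar>partial i f x\<bar> \<le> B"
  shows "\<bar>f (x + h *\<^sub>R axis i 1) - f x\<bar> \<le> B * \<bar>h\<bar>"
proof -
  have "norm (f (x + h *\<^sub>R axis i 1) - f (x + 0 *\<^sub>R axis i 1)) \<le> B * norm (h - 0)"
  proof (rule field_differentiable_bound[where S=UNIV
        and f'="\<lambda>t. partial i f (x + t *\<^sub>R axis i 1)" and f="\<lambda>t. f (x + t *\<^sub>R axis i 1)"])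
    show "((\<lambda>t. f (x + t *\<^sub>R axis i 1)) has_field_derivative partial i f (x + t *\<^sub>R axis i 1))
        (at t within UNIV)" for t
      using line_has_derivative[OF assms(1)] .
  qed (use assms in auto)
  then show ?thesis by simp
qed

lemma difference_quotient_tendsto:
  assumes "f differentiable (at x)" "h \<longlonglongrightarrow> 0" "\<And>n::nat. h n \<noteq> 0"
  shows "(\<lambda>n. (f (x + h n *\<^sub>R axis i 1) - f x) / h n) \<longlonglongrightarrow> partial i f x"
proof -
  have "((\<lambda>t. f (x + t *\<^sub>R axis i 1)) has_real_derivative partial i f (x + 0 *\<^sub>R axis i 1)) (at 0)"
    using assms by (intro line_has_derivative) simp
  then have "((\<lambda>t. (f (x + t *\<^sub>R axis i 1) - f x) / t) \<longlongrightarrow> partial i f x) (at 0)"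
    by (simp add: DERIV_def)
  then show ?thesis
    by (rule filterlim_compose) (use assms in \<open>auto simp: filterlim_at\<close>)
qed

lemma lborel_integral_shift:
  fixes f :: "'a::euclidean_space \<Rightarrow> real"
  assumes "f \<in> borel_measurable borel"
  shows "(LINT x|lborel. f (c + x)) = (LINT x|lborel. f x)"
proof -
  have "(LINT x|lborel. f x) = (LINT x|distr lborel borel ((+) c). f x)"
    by (simp add: lborel_distr_plus)
  also have "\<dots> = (LINT x|lborel. f (c + x))"
    using assms by (intro integral_distr) auto
  finally show ?thesis by simp
qed

lemma lborel_integrable_bounded_support:
  fixes f :: "'a::euclidean_space \<Rightarrow> real"
  assumes "f \<in> borel_measurable borel" "\<And>x. x \<notin> cball 0 R \<Longrightarrow> f x = 0" "\<And>x. \<bar>f x\<bar> \<le> B"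
  shows "integrable lborel f"
proof (rule integrableI_bounded_set[where A="cball 0 R" and B=B])
  show "emeasure lborel (cball 0 R :: 'a set) < \<infinity>"
    by (metis emeasure_lborel_cball_finite infinity_ennreal_def)
qed (use assms in auto)

text \<open>Discrete integration by parts; moving the difference quotient from the test function to the
  other factor only needs that factor to be bounded and continuous.\<close>

lemma difference_quotient_integral_tendsto:
  fixes W :: "real^'d::finite \<Rightarrow> real"
  assumes W: "continuous_on UNIV W" and B: "\<And>x. \<bar>W x\<bar> \<le> B"
    and \<phi>: "\<phi> \<in> Cc_infinity \<Omega>"
  shows "(\<lambda>n. LINT x|lborel. (W (x + (1 / real (Suc n)) *\<^sub>R axis i 1) - W x) / (1 / real (Suc n)) * \<phi> x)
    \<longlonglongrightarrow> - (LINT x|lborel. W x * partial i \<phi> x)"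
proof -
  \<comment> \<open>Backward differences of the test function turn into forward differences of \<open>W\<close>.\<close>
  define h where "h n = - (1 / real (Suc n))" for n
  have h0: "h n \<noteq> 0" for n by (simp add: h_def)
  have hlim: "h \<longlonglongrightarrow> 0"
    using tendsto_minus[OF LIMSEQ_inverse_real_of_nat] by (simp add: h_def[abs_def] field_simps)
  have h1: "\<bar>h n\<bar> \<le> 1" for n by (simp add: h_def)
  obtain C where C: "compact C" "\<And>x. x \<notin> C \<Longrightarrow> \<phi> x = 0" using \<phi> Cc_support by metis
  obtain R where R: "C \<subseteq> cball 0 R"
    using compact_imp_bounded[OF C(1)] unfolding bounded_iff by (metis mem_cball_0 subsetI)
  obtain A where A: "\<And>x. \<bar>\<phi> x\<bar> \<le> A" using Cc_bounded[OF \<phi>] by metis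
  obtain L where L: "L > 0" "\<And>x. \<bar>partial i \<phi> x\<bar> \<le> L" using Cc_bounded[OF Cc_partial[OF \<phi>]] by metis
  have [measurable]: "W \<in> borel_measurable borel" using W by (rule borel_measurable_continuous_onI)
  have [measurable]: "\<phi> \<in> borel_measurable borel" "partial i \<phi> \<in> borel_measurable borel"
    by (rule Cc_borel[OF \<phi>], rule Cc_borel[OF Cc_partial[OF \<phi>]])
  have B0: "B \<ge> 0" using B[of 0] by simp
  have out: "\<phi> (x + s *\<^sub>R axis i 1) = 0" if "\<bar>s\<bar> \<le> 1" "x \<notin> cball 0 (R + 1)" for x s
  proof -
    have "norm x - norm (s *\<^sub>R axis i (1::real)) \<le> norm (x + s *\<^sub>R axis i 1)" by (rule norm_diff_ineq)
    then have "x + s *\<^sub>R axis i 1 \<notin> cball 0 R" using that by (simp add: norm_axis_1)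
    then show ?thesis using R C(2) by blast
  qed
  have lim: "(\<lambda>n. LINT x|lborel. W x * ((\<phi> (x + h n *\<^sub>R axis i 1) - \<phi> x) / h n))
      \<longlonglongrightarrow> (LINT x|lborel. W x * partial i \<phi> x)"
  proof (rule integral_dominated_convergence[where w="\<lambda>x. B * L * indicator (cball 0 (R + 1)) x"])
    show "integrable lborel (\<lambda>x::real^'d. B * L * indicator (cball 0 (R + 1)) x)"
      by (rule lborel_integrable_bounded_support[where R="R+1" and B="B*L"])
         (use B0 L in \<open>auto simp: indicator_def\<close>)
    show "AE x in lborel. (\<lambda>n. W x * ((\<phi> (x + h n *\<^sub>R axis i 1) - \<phi> x) / h n)) \<longlonglongrightarrow> W x * partial i \<phi> x"
      by (intro AE_I2 tendsto_intros difference_quotient_tendsto Cc_differentiable[OF \<phi>] hlim h0)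
    show "AE x in lborel. norm (W x * ((\<phi> (x + h n *\<^sub>R axis i 1) - \<phi> x) / h n))
        \<le> B * L * indicator (cball 0 (R + 1)) x" for n
    proof (rule AE_I2)
      fix x :: "real^'d"
      have q: "\<bar>(\<phi> (x + h n *\<^sub>R axis i 1) - \<phi> x) / h n\<bar> \<le> L"
        using difference_quotient_bound[OF Cc_differentiable[OF \<phi>] L(2), of x "h n"] h0[of n]
        by (simp add: divide_le_eq)
      show "norm (W x * ((\<phi> (x + h n *\<^sub>R axis i 1) - \<phi> x) / h n))
          \<le> B * L * indicator (cball 0 (R + 1)) x"
      proof (cases "x \<in> cball 0 (R + 1)")
        case True
        then show ?thesis using mult_mono[OF B[of x] q B0 abs_ge_zero] by (simp add: abs_mult)
      next
        case False
        then show ?thesis using out[OF h1 False, of n] out[of 0 x] by simp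
      qed
    qed
  qed measurable
  have shift: "(LINT x|lborel. W x * ((\<phi> (x + h n *\<^sub>R axis i 1) - \<phi> x) / h n))
      = - (LINT x|lborel. (W (x + (1 / real (Suc n)) *\<^sub>R axis i 1) - W x) / (1 / real (Suc n)) * \<phi> x)" for n
  proof -
    let ?t = "1 / real (Suc n)"
    have int: "integrable lborel (\<lambda>x. W (x + a *\<^sub>R axis i 1) * \<phi> (x + b *\<^sub>R axis i 1))" if "\<bar>b\<bar> \<le> 1" for a b
    proof (rule lborel_integrable_bounded_support[where R="R+1" and B="B*A"])
      show "\<bar>W (x + a *\<^sub>R axis i 1) * \<phi> (x + b *\<^sub>R axis i 1)\<bar> \<le> B * A" for x
        using mult_mono[OF B A B0 abs_ge_zero] by (simp add: abs_mult)
    qed (use that out in auto)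
    have int0: "integrable lborel (\<lambda>x. W (x + a *\<^sub>R axis i 1) * \<phi> x)" for a
      using int[of 0 a] by simp
    have "(LINT x|lborel. W x * ((\<phi> (x + h n *\<^sub>R axis i 1) - \<phi> x) / h n))
        = (LINT x|lborel. (W x * \<phi> (x + h n *\<^sub>R axis i 1) - W x * \<phi> x) / h n)"
      by (simp add: algebra_simps diff_divide_distrib)
    also have "\<dots> = ((LINT x|lborel. W x * \<phi> (x + h n *\<^sub>R axis i 1)) - (LINT x|lborel. W x * \<phi> x)) / h n"
      using int[OF h1, of 0 n] int[of 0 0] by simp
    also have "(LINT x|lborel. W x * \<phi> (x + h n *\<^sub>R axis i 1))
        = (LINT x|lborel. W (?t *\<^sub>R axis i 1 + x) * \<phi> (?t *\<^sub>R axis i 1 + x + h n *\<^sub>R axis i 1))"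
      by (rule lborel_integral_shift[symmetric]) measurable
    also have "\<dots> = (LINT x|lborel. W (x + ?t *\<^sub>R axis i 1) * \<phi> x)"
      by (simp add: h_def algebra_simps)
    also have "(\<dots> - (LINT x|lborel. W x * \<phi> x)) / h n
        = - ((LINT x|lborel. (W (x + ?t *\<^sub>R axis i 1) * \<phi> x - W x * \<phi> x) / ?t))"
      using int0[of ?t] int0[of 0] by (simp add: h_def field_simps)
    also have "\<dots> = - (LINT x|lborel. (W (x + ?t *\<^sub>R axis i 1) - W x) / ?t * \<phi> x)"
      by (simp add: algebra_simps diff_divide_distrib)
    finally show ?thesis .
  qed
  show ?thesis using tendsto_minus[OF lim] unfolding shift by simp
qed

lemma lborel_integral_partial_eq_0:
  assumes "\<phi> \<in> Cc_infinity \<Omega>"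
  shows "(LINT x|lborel. partial i \<phi> x) = 0"
proof -
  have "(\<lambda>n::nat. 0) \<longlonglongrightarrow> - (LINT x|lborel. 1 * partial i \<phi> x)"
    using difference_quotient_integral_tendsto[of "\<lambda>x. 1" 1 \<phi> \<Omega> i] assms by simp
  then show ?thesis using LIMSEQ_unique[OF tendsto_const] by fastforce
qed

section \<open>Bounded open sets and the fundamental lemma of the calculus of variations\<close>

lemma lebesgue_on_integral_eq_lborel:
  fixes f :: "real^'d::finite \<Rightarrow> real"
  assumes "open \<Omega>" "f \<in> borel_measurable borel" "\<And>x. x \<notin> \<Omega> \<Longrightarrow> f x = 0"
  shows "(LINT x|lebesgue_on \<Omega>. f x) = (LINT x|lborel. f x)"
proof -
  have "(LINT x|lebesgue_on \<Omega>. f x) = (LINT x|lebesgue. indicator \<Omega> x *\<^sub>R f x)"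
    using assms(1) by (intro integral_restrict_space) auto
  also have "(\<lambda>x. indicator \<Omega> x *\<^sub>R f x) = f"
  proof
    fix x show "indicator \<Omega> x *\<^sub>R f x = f x" using assms(3)[of x] by (cases "x \<in> \<Omega>") auto
  qed
  finally show ?thesis using assms by (simp add: integral_completion)
qed

text \<open>Boundedness makes the Lebesgue measure on \<open>\<Omega>\<close> finite, so that \<open>L\<^sup>2\<close>
  functions are integrable and constants are square integrable.\<close>

locale bounded_open_set =
  fixes \<Omega> :: "(real^'d::finite) set"
  assumes open_set: "open \<Omega>" and bounded_set: "bounded \<Omega>"
begin

lemma finite_measure_set: "finite_measure (lebesgue_on \<Omega>)"
  using open_set bounded_set
  by (intro finite_measure_lebesgue_on) (simp add: bounded_set_imp_lmeasurable)

lemma L2_bounded: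
  assumes "f \<in> borel_measurable (lebesgue_on \<Omega>)" "\<And>x. x \<in> \<Omega> \<Longrightarrow> norm (f x) \<le> B"
  shows "f \<in> L2 \<Omega>"
proof -
  interpret finite_measure "lebesgue_on \<Omega>" by (rule finite_measure_set)
  have "integrable (lebesgue_on \<Omega>) (\<lambda>x. (norm (f x))\<^sup>2)"
    by (rule integrable_const_bound[where B="B\<^sup>2"]) (use assms in \<open>auto intro!: AE_I2 power_mono\<close>)
  then show ?thesis using assms by (simp add: L2_def)
qed

lemma L2_const: "(\<lambda>x. c) \<in> L2 \<Omega>"
  by (rule L2_bounded[where B="norm c"]) auto

lemma Cc_L2: "\<phi> \<in> Cc_infinity \<Omega>' \<Longrightarrow> \<phi> \<in> L2 \<Omega>"
proof -
  assume \<phi>: "\<phi> \<in> Cc_infinity \<Omega>'"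
  obtain B where "\<And>x. \<bar>\<phi> x\<bar> \<le> B" using Cc_bounded[OF \<phi>] by metis
  then show ?thesis by (intro L2_bounded[where B=B] Cc_measurable[OF \<phi>]) auto
qed

lemma L2_integrable:
  assumes "f \<in> L2 \<Omega>" shows "integrable (lebesgue_on \<Omega>) f"
proof -
  interpret finite_measure "lebesgue_on \<Omega>" by (rule finite_measure_set)
  have "norm (f x) \<le> norm ((norm (f x))\<^sup>2 + 1)" for x
  proof -
    have "norm (f x) \<le> (norm (f x))\<^sup>2 + 1"
      using sum_squares_bound[of "norm (f x)" 1] by simp (smt (verit) norm_ge_zero)
    then show ?thesis by simp
  qed
  note bound = this
  have "integrable (lebesgue_on \<Omega>) (\<lambda>x. (norm (f x))\<^sup>2 + 1)"
    by (intro Bochner_Integration.integrable_add L2_integrable_square assms integrable_const)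
  then show ?thesis
    by (rule Bochner_Integration.integrable_bound[OF _ L2_measurable[OF assms] AE_I2[OF bound]])
qed

lemma integral_partial_eq_0:
  assumes "\<phi> \<in> Cc_infinity \<Omega>"
  shows "(LINT x|lebesgue_on \<Omega>. partial i \<phi> x) = 0"
  using lebesgue_on_integral_eq_lborel[OF open_set Cc_borel[OF Cc_partial[OF assms]]]
    Cc_outside[OF Cc_partial[OF assms]] lborel_integral_partial_eq_0[OF assms] by simp

text \<open>A function orthogonal to all test functions has integral zero over every open box in \<open>\<Omega>\<close>,
  because the indicator function of the box is a bounded pointwise limit of test functions.\<close>

lemma integral_box_eq_0:
  assumes f: "integrable (lebesgue_on \<Omega>) f" and "\<And>\<phi>. \<phi> \<in> Cc_infinity \<Omega> \<Longrightarrow> (LINT x|lebesgue_on \<Omega>. f x * \<phi> x) = 0"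
    and ab: "box a b \<subseteq> \<Omega>"
  shows "(LINT x|lebesgue_on \<Omega>. f x * indicator (box a b) x) = 0"
proof -
  have "(\<lambda>n. LINT x|lebesgue_on \<Omega>. f x * box_bump (real (Suc n)) a b x) \<longlonglongrightarrow> (LINT x|lebesgue_on \<Omega>. f x * indicator (box a b) x)"
  proof (rule integral_dominated_convergence[where w="\<lambda>x. norm (f x)"])
    have "box_bump n a b \<in> borel_measurable borel" for n
      using Ck_box_bump[of 0] by (intro borel_measurable_continuous_onI) simp
    then have [measurable]: "box_bump n a b \<in> borel_measurable (lebesgue_on \<Omega>)" for n
      by (rule borel_imp_lebesgue_on)
    have [measurable]: "(indicator (box a b) :: _ \<Rightarrow> real) \<in> borel_measurable (lebesgue_on \<Omega>)"
      by (intro borel_imp_lebesgue_on) simp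
    have [measurable]: "f \<in> borel_measurable (lebesgue_on \<Omega>)" using f by simp
    show "(\<lambda>x. f x * indicator (box a b) x) \<in> borel_measurable (lebesgue_on \<Omega>)"
      "(\<lambda>x. f x * box_bump (real (Suc n)) a b x) \<in> borel_measurable (lebesgue_on \<Omega>)" for n by measurable
    show "integrable (lebesgue_on \<Omega>) (\<lambda>x. norm (f x))" using f by (rule integrable_norm)
    show "AE x in lebesgue_on \<Omega>. (\<lambda>n. f x * box_bump (real (Suc n)) a b x) \<longlonglongrightarrow> f x * indicator (box a b) x"
      by (intro AE_I2 tendsto_intros LIMSEQ_Suc box_bump_tendsto)
    show "AE x in lebesgue_on \<Omega>. norm (f x * box_bump (real (Suc n)) a b x) \<le> norm (f x)" for n
      using box_bump_bounds[of "real (Suc n)" a b]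
      by (intro AE_I2) (auto simp: abs_mult intro!: mult_left_le)
  qed
  moreover have "box_bump (real (Suc n)) a b \<in> Cc_infinity \<Omega>" for n
  proof -
    let ?C = "cbox (a + (\<chi> i. 1 / real (Suc n))) (b - (\<chi> i. 1 / real (Suc n)))"
    have "?C \<subseteq> box a b"
    proof
      fix x assume x: "x \<in> ?C"
      have "a $ i < x $ i \<and> x $ i < b $ i" for i
      proof -
        have "a $ i + 1 / real (Suc n) \<le> x $ i" "x $ i \<le> b $ i - 1 / real (Suc n)" "1 / real (Suc n) > 0"
          using x by (auto simp: mem_box_cart)
        then show ?thesis by linarith
      qed
      then show "x \<in> box a b" by (simp add: mem_box_cart)
    qed
    moreover have "\<forall>x. x \<notin> ?C \<longrightarrow> box_bump (real (Suc n)) a b x = 0"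
      using box_bump_nonzero[of "real (Suc n)" a b] of_nat_0_less_iff[of "Suc n"] by blast
    ultimately have "compact ?C \<and> ?C \<subseteq> \<Omega> \<and> (\<forall>x. x \<notin> ?C \<longrightarrow> box_bump (real (Suc n)) a b x = 0)"
      using ab compact_cbox by blast
    then show ?thesis unfolding Cc_infinity_def using Ck_box_bump by blast
  qed
  ultimately show ?thesis using assms(2) LIMSEQ_unique[OF tendsto_const] by fastforce
qed

text \<open>Within a box in \<open>\<Omega>\<close>, the open boxes form an intersection-stable generator of the Borel sets,
  so \<open>f\<close> has integral zero over every Borel set there; countably many boxes cover \<open>\<Omega>\<close>.\<close>

theorem fundamental_lemma:
  fixes f :: "real^'d \<Rightarrow> real"
  assumes f: "integrable (lebesgue_on \<Omega>) f" and "\<And>\<phi>. \<phi> \<in> Cc_infinity \<Omega> \<Longrightarrow> (LINT x|lebesgue_on \<Omega>. f x * \<phi> x) = 0"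
  shows "AE x in lebesgue_on \<Omega>. f x = 0"
proof -
  have \<Omega>: "\<Omega> \<inter> space lebesgue \<in> sets lebesgue" using open_set by auto
  have on_box: "AE x in lebesgue. x \<in> box c d \<longrightarrow> f x = 0" if cd: "box c d \<subseteq> \<Omega>" for c d
  proof -
    define F where "F x = indicator (box c d) x * f x" for x
    have "integrable lebesgue (\<lambda>x. indicator \<Omega> x *\<^sub>R f x)"
      by (rule iffD1[OF integrable_restrict_space[OF \<Omega>] f])
    then have "integrable lebesgue (\<lambda>x. indicator (box c d) x *\<^sub>R (indicator \<Omega> x *\<^sub>R f x))"
      by (rule integrable_mult_indicator[rotated]) auto
    moreover have "(\<lambda>x. indicator (box c d) x *\<^sub>R (indicator \<Omega> x *\<^sub>R f x)) = F"
      using cd by (auto simp: F_def fun_eq_iff indicator_def)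
    ultimately have F: "integrable lebesgue F" by simp
    obtain G where [measurable]: "G \<in> borel_measurable lborel" and FG: "AE x in lborel. F x = G x"
      using completion_ex_borel_measurable_real F borel_measurable_integrable by blast
    have FG': "AE x in lebesgue. F x = G x" using FG by (simp add: AE_completion_iff)
    have G: "integrable lborel G"
      using F integrable_cong_AE[of F lebesgue G] FG' by (simp add: integrable_completion measurable_completion)
    have eq: "(LINT x:A|lborel. G x) = (LINT x|lebesgue. indicator A x *\<^sub>R F x)" if "A \<in> sets borel" for A
    proof -
      have "(LINT x:A|lborel. G x) = (LINT x|lebesgue. indicator A x *\<^sub>R G x)"
        unfolding set_lebesgue_integral_def using that by (intro integral_completion[symmetric]) auto
      also have "\<dots> = (LINT x|lebesgue. indicator A x *\<^sub>R F x)"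
      proof (rule integral_cong_AE)
        have [measurable]: "A \<in> sets lebesgue" "F \<in> borel_measurable lebesgue"
          "G \<in> borel_measurable lebesgue"
          using that F by (auto simp: measurable_completion)
        show "(\<lambda>x. indicator A x *\<^sub>R G x) \<in> borel_measurable lebesgue"
          "(\<lambda>x. indicator A x *\<^sub>R F x) \<in> borel_measurable lebesgue" by measurable
      qed (use FG' in \<open>auto elim: eventually_mono\<close>)
      finally show ?thesis .
    qed
    have box0: "(LINT x:box a b|lborel. G x) = 0" for a b
    proof -
      obtain p q where pq: "box a b \<inter> box c d = box p q" using box_Int_box[of a b c d] by blast
      then have "box p q \<subseteq> \<Omega>" using cd by blast
      have "(LINT x:box a b|lborel. G x) = (LINT x|lebesgue. indicator \<Omega> x *\<^sub>R (f x * indicator (box p q) x))"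
        unfolding eq[OF borel_open[OF open_box]]
      proof (intro Bochner_Integration.integral_cong refl)
        fix x
        show "indicator (box a b) x *\<^sub>R F x = indicator \<Omega> x *\<^sub>R (f x * indicator (box p q) x)"
          using cd by (auto simp: F_def indicator_def pq[symmetric])
      qed
      also have "\<dots> = (LINT x|lebesgue_on \<Omega>. f x * indicator (box p q) x)"
        by (rule integral_restrict_space[OF \<Omega>, symmetric])
      also have "\<dots> = 0" using integral_box_eq_0[OF assms \<open>box p q \<subseteq> \<Omega>\<close>] .
      finally show ?thesis .
    qed
    have UN: "(LINT x:UNIV|lborel. G x) = 0"
    proof -
      have "(\<lambda>x. indicator (box c d) x *\<^sub>R F x) = (\<lambda>x. indicator UNIV x *\<^sub>R F x)"
        by (auto simp: F_def fun_eq_iff indicator_def)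
      then show ?thesis using box0[of c d] eq[of UNIV] eq[of "box c d"] by simp
    qed
    have zero: "(LINT x:A|lborel. G x) = 0" if "A \<in> sets borel" for A
    proof -
      have A: "A \<in> sigma_sets UNIV (range (\<lambda>(a, b). box a b :: (real^'d) set))"
        using that by (simp add: borel_eq_box)
      have Int: "Int_stable (range (\<lambda>(a, b). box a b :: (real^'d) set))"
        by (auto simp: Int_stable_def box_Int_box)
      have bor: "B \<in> sets borel" if "B \<in> sigma_sets UNIV (range (\<lambda>(a, b). box a b :: (real^'d) set))" for B
        using that by (simp add: borel_eq_box)
      have si: "set_integrable lborel B G" if "B \<in> sets borel" for B
        unfolding set_integrable_def using G that by (intro integrable_mult_indicator) auto
      have Pow: "range (\<lambda>(a, b). box a b :: (real^'d) set) \<subseteq> Pow UNIV" by simp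
      from Int Pow A show "(LINT x:A|lborel. G x) = 0"
      proof (induction rule: sigma_sets_induct_disjoint)
        case (basic A) then show ?case using box0 by auto
      next
        case (compl A)
        have "(LINT x:UNIV|lborel. G x) = (LINT x:A|lborel. G x) + (LINT x:(UNIV - A)|lborel. G x)"
          using set_integral_Un[of A "UNIV - A" lborel G] si[of A] si[of "UNIV - A"] bor[OF compl(1)]
          by auto
        then show ?case using UN compl by simp
      next
        case (union A)
        have Ai: "A i \<in> sets borel" for i using union(2) bor by blast
        then have "(\<Union>i. A i) \<in> sets borel" by blast
        then have "(LINT x:(\<Union>i. A i)|lborel. G x) = (\<Sum>i. (LINT x:(A i)|lborel. G x))"
          using union(1) Ai by (intro lebesgue_integral_countable_add si)
            (auto simp: disjoint_family_on_def)
        then show ?case using union by simp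
      qed (auto simp: set_lebesgue_integral_def)
    qed
    have "AE x in lborel. G x = 0"
      by (rule density_unique_real[OF G integrable_zero]) (simp add: zero)
    then have "AE x in lebesgue. G x = 0" by (simp add: AE_completion_iff)
    with FG' show ?thesis by eventually_elim (auto simp: F_def indicator_def)
  qed
  obtain \<D> where D: "countable \<D>" "\<D> \<subseteq> Pow \<Omega>" "\<And>X. X \<in> \<D> \<Longrightarrow> \<exists>a b. X = box a b" "\<Union>\<D> = \<Omega>"
    using open_countable_Union_open_box[OF open_set] by metis
  have "AE x in lebesgue. \<forall>X\<in>\<D>. x \<in> X \<longrightarrow> f x = 0"
  proof (rule AE_ball_countable[THEN iffD2, OF D(1)], rule ballI)
    fix X assume X: "X \<in> \<D>"
    then obtain a b where "X = box a b" using D by blast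
    then show "AE x in lebesgue. x \<in> X \<longrightarrow> f x = 0" using on_box X D(2) by blast
  qed
  then have "AE x in lebesgue. x \<in> \<Omega> \<longrightarrow> f x = 0"
    by eventually_elim (use D(4) in blast)
  then show ?thesis using AE_restrict_space_iff[OF \<Omega>] by blast
qed

end

section \<open>Density of test functions and weak limits\<close>

text \<open>Fields whose components with respect to the standard basis are test functions.  The codomain
  is any Euclidean space, so that vector fields, matrix fields and pairs are covered at once.\<close>

definition test_fields :: "(real^'d::finite) set \<Rightarrow> (real^'d \<Rightarrow> 'a::euclidean_space) set" where
  "test_fields \<Omega> = {\<phi>. \<forall>b\<in>Basis. (\<lambda>x. \<phi> x \<bullet> b) \<in> Cc_infinity \<Omega>}"

lemma test_fields_add: "f \<in> test_fields \<Omega> \<Longrightarrow> g \<in> test_fields \<Omega> \<Longrightarrow> (\<lambda>x. f x + g x) \<in> test_fields \<Omega>"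
  by (auto simp: test_fields_def inner_add_left intro: Cc_add)

lemma test_fields_scaleR: "f \<in> test_fields \<Omega> \<Longrightarrow> (\<lambda>x. c *\<^sub>R f x) \<in> test_fields \<Omega>"
  by (auto simp: test_fields_def intro: Cc_cmult)

lemma test_fields_zero: "(\<lambda>x. 0) \<in> test_fields \<Omega>"
  by (auto simp: test_fields_def Cc_zero)

lemma test_fields_scaleR_Basis:
  assumes "\<psi> \<in> Cc_infinity \<Omega>" "b \<in> Basis"
  shows "(\<lambda>x. \<psi> x *\<^sub>R b) \<in> test_fields \<Omega>"
proof -
  have "(\<lambda>x. (\<psi> x *\<^sub>R b) \<bullet> b') = (\<lambda>x. (if b = b' then 1 else 0) * \<psi> x)" if "b' \<in> Basis" for b'
    using assms that by (auto simp: inner_Basis)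
  then show ?thesis
    unfolding test_fields_def using Cc_cmult[OF assms(1)] by simp
qed

lemma L2_componentwise:
  fixes f :: "real^'d::finite \<Rightarrow> 'a::euclidean_space"
  shows "f \<in> L2 \<Omega> \<longleftrightarrow> (\<forall>b\<in>Basis. (\<lambda>x. f x \<bullet> b) \<in> L2 \<Omega>)"
proof safe
  fix b :: 'a assume "f \<in> L2 \<Omega>" "b \<in> Basis"
  have "(\<lambda>x. f x \<bullet> b) \<in> borel_measurable (lebesgue_on \<Omega>)"
    using L2_measurable[OF \<open>f \<in> L2 \<Omega>\<close>] by simp
  then show "(\<lambda>x. f x \<bullet> b) \<in> L2 \<Omega>"
    using \<open>f \<in> L2 \<Omega>\<close> by (rule L2_bound_fun) (simp add: Basis_le_norm \<open>b \<in> Basis\<close>)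
next
  assume "\<forall>b\<in>Basis. (\<lambda>x. f x \<bullet> b) \<in> L2 \<Omega>"
  then have *: "(\<lambda>x. f x \<bullet> b) \<in> L2 \<Omega>" if "b \<in> Basis" for b using that by blast
  have "f \<in> borel_measurable (lebesgue_on \<Omega>)"
    using borel_measurable_euclidean_space[of f "lebesgue_on \<Omega>"] * L2_measurable by blast
  moreover have "integrable (lebesgue_on \<Omega>) (\<lambda>x. \<Sum>b\<in>Basis. (norm (f x \<bullet> b))\<^sup>2)"
    using * L2_integrable_square by (intro Bochner_Integration.integrable_sum) blast
  moreover have "(norm (f x))\<^sup>2 = (\<Sum>b\<in>Basis. (norm (f x \<bullet> b))\<^sup>2)" for x
    unfolding power2_norm_eq_inner euclidean_inner[of "f x" "f x"] by simp
  ultimately show "f \<in> L2 \<Omega>" by (simp add: L2_def)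
qed

context bounded_open_set
begin

lemma test_fields_L2: "f \<in> test_fields \<Omega> \<Longrightarrow> f \<in> L2 \<Omega>"
  unfolding L2_componentwise[of f] by (auto simp: test_fields_def intro: Cc_L2)

lemma orthogonal_test_fields_imp_AE_0:
  fixes f :: "real^'d \<Rightarrow> 'a::euclidean_space"
  assumes f: "f \<in> L2 \<Omega>" and "\<And>\<phi>. \<phi> \<in> test_fields \<Omega> \<Longrightarrow> L2_inner \<Omega> f \<phi> = 0"
  shows "AE x in lebesgue_on \<Omega>. f x = 0"
proof -
  have "AE x in lebesgue_on \<Omega>. f x \<bullet> b = 0" if "b \<in> Basis" for b
  proof (rule fundamental_lemma)
    show "integrable (lebesgue_on \<Omega>) (\<lambda>x. f x \<bullet> b)"
      using f that L2_componentwise by (intro L2_integrable) blast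
    show "(LINT x|lebesgue_on \<Omega>. (f x \<bullet> b) * \<psi> x) = 0" if "\<psi> \<in> Cc_infinity \<Omega>" for \<psi>
      using assms(2)[OF test_fields_scaleR_Basis[OF that \<open>b \<in> Basis\<close>]]
      by (simp add: L2_inner_def mult.commute)
  qed
  then have "AE x in lebesgue_on \<Omega>. \<forall>b\<in>Basis. f x \<bullet> b = 0"
    by (intro AE_finite_allI) auto
  then show ?thesis by eventually_elim (auto intro: euclidean_eqI)
qed

theorem test_fields_dense:
  fixes f :: "real^'d \<Rightarrow> 'a::euclidean_space"
  assumes f: "f \<in> L2 \<Omega>" and e: "e > 0"
  obtains \<phi> where "\<phi> \<in> test_fields \<Omega>" "L2_norm \<Omega> (\<lambda>x. f x - \<phi> x) < e"
proof -
  obtain g v where g: "g \<in> L2 \<Omega>" and rep: "\<And>\<phi>. \<phi> \<in> test_fields \<Omega> \<Longrightarrow> L2_inner \<Omega> f \<phi> = L2_inner \<Omega> g \<phi>"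
    and v: "\<And>n::nat. v n \<in> test_fields \<Omega>" and lim: "(\<lambda>n. L2_norm \<Omega> (\<lambda>x. v n x - g x)) \<longlonglongrightarrow> 0"
  proof (rule L2_Riesz[of "test_fields \<Omega>" \<Omega> "L2_inner \<Omega> f" "L2_norm \<Omega> f"])
    show "test_fields \<Omega> \<noteq> ({} :: (real^'d \<Rightarrow> 'a) set)" using test_fields_zero by blast
    show "L2_inner \<Omega> f (\<lambda>x. p x + q x) = L2_inner \<Omega> f p + L2_inner \<Omega> f q"
      if "p \<in> test_fields \<Omega>" "q \<in> test_fields \<Omega>" for p q
      using L2_inner_add_left[OF test_fields_L2[OF that(1)] test_fields_L2[OF that(2)] f]
      by (simp add: L2_inner_commute)
    show "L2_inner \<Omega> f (\<lambda>x. c *\<^sub>R p x) = c * L2_inner \<Omega> f p" for c p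
      using L2_inner_scaleR_left[of \<Omega> c p f] by (simp add: L2_inner_commute)
    show "\<bar>L2_inner \<Omega> f p\<bar> \<le> L2_norm \<Omega> f * L2_norm \<Omega> p" if "p \<in> test_fields \<Omega>" for p
      by (rule L2_inner_Cauchy_Schwarz[OF f test_fields_L2[OF that]])
  qed (use test_fields_L2 in \<open>auto intro: test_fields_add test_fields_scaleR\<close>)
  have "AE x in lebesgue_on \<Omega>. f x - g x = 0"
    by (rule orthogonal_test_fields_imp_AE_0[OF L2_diff[OF f g]])
       (simp add: L2_inner_diff_left f g test_fields_L2 rep)
  then have "AE x in lebesgue_on \<Omega>. v n x - g x = v n x - f x" for n
    by eventually_elim simp
  then have "L2_norm \<Omega> (\<lambda>x. v n x - g x) = L2_norm \<Omega> (\<lambda>x. v n x - f x)" for n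
    by (rule L2_norm_cong_AE) (intro L2_measurable L2_diff test_fields_L2 v f g)+
  then have "(\<lambda>n. L2_norm \<Omega> (\<lambda>x. f x - v n x)) \<longlonglongrightarrow> 0"
    using lim by (simp add: L2_norm_minus_commute)
  from order_tendstoD(2)[OF this e] obtain n where "L2_norm \<Omega> (\<lambda>x. f x - v n x) < e"
    by (auto simp: eventually_sequentially)
  then show thesis using that v by blast
qed

text \<open>For bounded sequences, weak convergence may be tested on the dense set of test fields.\<close>

lemma weak_convergence_L2:
  fixes v :: "real^'d \<Rightarrow> 'a::euclidean_space"
  assumes vn: "\<And>n::nat. vn n \<in> L2 \<Omega>" and bound: "\<And>n. L2_norm \<Omega> (vn n) \<le> B" and v: "v \<in> L2 \<Omega>"
    and weak: "\<And>\<phi>. \<phi> \<in> test_fields \<Omega> \<Longrightarrow> (\<lambda>n. L2_inner \<Omega> (vn n) \<phi>) \<longlonglongrightarrow> L2_inner \<Omega> v \<phi>"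
    and z: "z \<in> L2 \<Omega>"
  shows "(\<lambda>n. L2_inner \<Omega> (vn n) z) \<longlonglongrightarrow> L2_inner \<Omega> v z"
proof (rule LIMSEQ_I)
  fix e :: real assume e: "e > 0"
  define K where "K = B + L2_norm \<Omega> v + 1"
  have K: "K > 0" using bound[of 0] L2_norm_ge_0[of \<Omega> "vn 0"] L2_norm_ge_0[of \<Omega> v] by (simp add: K_def)
  obtain \<phi> where \<phi>: "\<phi> \<in> test_fields \<Omega>" "L2_norm \<Omega> (\<lambda>x. z x - \<phi> x) < e / (2 * K)"
    using test_fields_dense[OF z, of "e / (2 * K)"] e K by auto
  note \<phi>2 = test_fields_L2[OF \<phi>(1)]
  obtain N where N: "\<And>n. n \<ge> N \<Longrightarrow> \<bar>L2_inner \<Omega> (vn n) \<phi> - L2_inner \<Omega> v \<phi>\<bar> < e / 2"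
    using LIMSEQ_D[OF weak[OF \<phi>(1)], of "e/2"] e by auto
  have "\<bar>L2_inner \<Omega> (vn n) z - L2_inner \<Omega> v z\<bar> < e" if "n \<ge> N" for n
  proof -
    let ?d = "\<lambda>x. vn n x - v x"
    have d: "?d \<in> L2 \<Omega>" by (intro L2_diff vn v)
    have "L2_norm \<Omega> ?d \<le> L2_norm \<Omega> (vn n) + L2_norm \<Omega> v"
      using L2_norm_triangle[OF vn[of n] L2_cmult[OF v, of "-1"]] L2_norm_scaleR[of \<Omega> "-1" v] by simp
    then have dK: "L2_norm \<Omega> ?d \<le> K" using bound[of n] by (simp add: K_def)
    have "\<bar>L2_inner \<Omega> (\<lambda>x. z x - \<phi> x) ?d\<bar> \<le> L2_norm \<Omega> (\<lambda>x. z x - \<phi> x) * L2_norm \<Omega> ?d"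
      by (intro L2_inner_Cauchy_Schwarz L2_diff z \<phi>2 d)
    also have "\<dots> \<le> (e / (2 * K)) * K"
      using \<phi>(2) dK e K by (intro mult_mono L2_norm_ge_0) auto
    finally have 1: "\<bar>L2_inner \<Omega> (\<lambda>x. z x - \<phi> x) ?d\<bar> \<le> e / 2" using K by simp
    have "L2_inner \<Omega> (\<lambda>x. z x - \<phi> x) ?d = L2_inner \<Omega> ?d z - L2_inner \<Omega> ?d \<phi>"
      using L2_inner_diff_left[OF z \<phi>2 d] by (simp add: L2_inner_commute)
    then have "L2_inner \<Omega> (\<lambda>x. z x - \<phi> x) ?d
        = (L2_inner \<Omega> (vn n) z - L2_inner \<Omega> v z) - (L2_inner \<Omega> (vn n) \<phi> - L2_inner \<Omega> v \<phi>)"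
      using L2_inner_diff_left[OF vn[of n] v z] L2_inner_diff_left[OF vn[of n] v \<phi>2] by simp
    then show ?thesis using 1 N[OF that] by linarith
  qed
  then show "\<exists>N. \<forall>n\<ge>N. norm (L2_inner \<Omega> (vn n) z - L2_inner \<Omega> v z) < e" by auto
qed

text \<open>A weak limit of a bounded sequence in a linear subspace of \<open>L\<^sup>2\<close> is a strong limit of
  elements of that subspace: its orthogonal projection onto the closure differs from it by a
  function orthogonal to the whole sequence.\<close>

theorem weak_closure_L2:
  fixes v :: "real^'d \<Rightarrow> 'a::euclidean_space"
  assumes VL2: "V \<subseteq> L2 \<Omega>"
    and Vadd: "\<And>f g. f \<in> V \<Longrightarrow> g \<in> V \<Longrightarrow> (\<lambda>x. f x + g x) \<in> V"
    and Vscale: "\<And>c f. f \<in> V \<Longrightarrow> (\<lambda>x. c *\<^sub>R f x) \<in> V"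
    and vn: "\<And>n::nat. vn n \<in> V" and bound: "\<And>n. L2_norm \<Omega> (vn n) \<le> B" and v: "v \<in> L2 \<Omega>"
    and weak: "\<And>\<phi>. \<phi> \<in> test_fields \<Omega> \<Longrightarrow> (\<lambda>n. L2_inner \<Omega> (vn n) \<phi>) \<longlonglongrightarrow> L2_inner \<Omega> v \<phi>"
  obtains w where "\<And>n::nat. w n \<in> V" "(\<lambda>n. L2_norm \<Omega> (\<lambda>x. w n x - v x)) \<longlonglongrightarrow> 0"
proof -
  have L: "f \<in> L2 \<Omega>" if "f \<in> V" for f using that VL2 by auto
  obtain g w where g: "g \<in> L2 \<Omega>" and rep: "\<And>f. f \<in> V \<Longrightarrow> L2_inner \<Omega> v f = L2_inner \<Omega> g f"
    and w: "\<And>n::nat. w n \<in> V" and lim: "(\<lambda>n. L2_norm \<Omega> (\<lambda>x. w n x - g x)) \<longlonglongrightarrow> 0"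
  proof (rule L2_Riesz[of V \<Omega> "L2_inner \<Omega> v" "L2_norm \<Omega> v"])
    show "V \<noteq> {}" using vn by blast
    show "L2_inner \<Omega> v (\<lambda>x. p x + q x) = L2_inner \<Omega> v p + L2_inner \<Omega> v q"
      if "p \<in> V" "q \<in> V" for p q
      using L2_inner_add_left[OF L[OF that(1)] L[OF that(2)] v] by (simp add: L2_inner_commute)
    show "L2_inner \<Omega> v (\<lambda>x. c *\<^sub>R p x) = c * L2_inner \<Omega> v p" for c p
      using L2_inner_scaleR_left[of \<Omega> c p v] by (simp add: L2_inner_commute)
    show "\<bar>L2_inner \<Omega> v p\<bar> \<le> L2_norm \<Omega> v * L2_norm \<Omega> p" if "p \<in> V" for p
      by (rule L2_inner_Cauchy_Schwarz[OF v L[OF that]])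
  qed (use VL2 Vadd Vscale in auto)
  define z where "z x = v x - g x" for x
  have z: "z \<in> L2 \<Omega>" unfolding z_def by (intro L2_diff v g)
  have orth: "L2_inner \<Omega> f z = 0" if "f \<in> V" for f
    using L2_inner_diff_left[OF v g L[OF that]] rep[OF that]
    by (simp add: z_def[abs_def] L2_inner_commute)
  have "(\<lambda>n. L2_inner \<Omega> (vn n) z) \<longlonglongrightarrow> L2_inner \<Omega> v z"
    by (rule weak_convergence_L2[OF L[OF vn] bound v weak z])
  then have vz: "L2_inner \<Omega> v z = 0" using orth[OF vn] LIMSEQ_unique[OF tendsto_const] by fastforce
  have "(\<lambda>n. L2_inner \<Omega> (w n) z) \<longlonglongrightarrow> L2_inner \<Omega> g z"
    by (rule L2_inner_tendsto_left[OF L[OF w] g z lim])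
  then have gz: "L2_inner \<Omega> g z = 0" using orth[OF w] LIMSEQ_unique[OF tendsto_const] by fastforce
  have "L2_inner \<Omega> z z = 0"
    using L2_inner_diff_left[OF v g z] vz gz by (simp add: z_def[abs_def])
  then have "L2_norm \<Omega> z = 0" by (simp add: L2_norm_def)
  then have "AE x in lebesgue_on \<Omega>. z x = 0" by (rule L2_norm_eq_0_AE[OF z])
  then have "AE x in lebesgue_on \<Omega>. w n x - g x = w n x - v x" for n
    by eventually_elim (simp add: z_def)
  then have "L2_norm \<Omega> (\<lambda>x. w n x - g x) = L2_norm \<Omega> (\<lambda>x. w n x - v x)" for n
    by (rule L2_norm_cong_AE) (intro L2_measurable L2_diff L w v g)+
  then show thesis using that[OF w] lim by simp
qed

end

section \<open>Mollification\<close>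

text \<open>A nonnegative smooth kernel of integral \<open>1\<close> supported in the ball of radius \<open>\<delta>\<close>.\<close>

definition mollifier :: "real \<Rightarrow> (real^'d::finite \<Rightarrow> real) \<Rightarrow> bool" where
  "mollifier \<delta> \<rho> \<longleftrightarrow> \<rho> \<in> Cc_infinity UNIV \<and> (\<forall>x. 0 \<le> \<rho> x) \<and> (\<forall>x. \<rho> x \<noteq> 0 \<longrightarrow> norm x \<le> \<delta>)
     \<and> (LINT x|lborel. \<rho> x) = 1"

lemma mollifier_exists:
  assumes "\<delta> > 0"
  obtains \<rho> :: "real^'d::finite \<Rightarrow> real" where "mollifier \<delta> \<rho>"
proof -
  define n where "n = real CARD('d) / \<delta>"
  have n: "n > 0" using assms by (simp add: n_def)
  define c :: "real^'d" where "c = (\<chi> i. 2 / n)"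
  define \<beta> where "\<beta> = box_bump n (- c) c"
  have pos: "\<beta> x > 0 \<longleftrightarrow> (\<forall>i. - (1/n) < x $ i \<and> x $ i < 1/n)" for x
    unfolding \<beta>_def box_bump_pos_iff[OF n] by (simp add: c_def field_simps)
  have ge0: "\<beta> x \<ge> 0" for x unfolding \<beta>_def by (rule box_bump_bounds)
  have supp: "norm x \<le> \<delta>" if "\<beta> x \<noteq> 0" for x
  proof -
    have x: "\<bar>x $ i\<bar> \<le> 1/n" for i
      using that ge0[of x] pos[of x] by (metis abs_le_iff less_le minus_le_iff)
    have "norm x \<le> (\<Sum>i\<in>UNIV. \<bar>x $ i\<bar>)" by (rule norm_le_l1_cart)
    also have "\<dots> \<le> (\<Sum>i\<in>(UNIV::'d set). 1/n)" by (intro sum_mono x)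
    also have "\<dots> = \<delta>" using assms by (simp add: n_def)
    finally show ?thesis .
  qed
  have \<beta>: "\<beta> \<in> Cc_infinity UNIV"
  proof -
    have "\<forall>x. x \<notin> cball 0 \<delta> \<longrightarrow> \<beta> x = 0" using supp by auto
    then have "\<exists>C. compact C \<and> C \<subseteq> UNIV \<and> (\<forall>x. x \<notin> C \<longrightarrow> \<beta> x = 0)"
      by (intro exI[of _ "cball 0 \<delta>"]) auto
    then show ?thesis unfolding Cc_infinity_def by (simp add: \<beta>_def Ck_box_bump)
  qed
  have cont: "continuous_on UNIV \<beta>" using \<beta> by (rule Cc_continuous)
  have int: "integrable lborel \<beta>"
    by (rule lborel_integrable_bounded_support[of _ \<delta> 1])
       (use Cc_borel[OF \<beta>] supp box_bump_bounds[of n "- c" c] in \<open>auto simp: \<beta>_def\<close>)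
  have "(LINT x|lborel. \<beta> x) \<noteq> 0"
  proof
    assume "(LINT x|lborel. \<beta> x) = 0"
    then have "AE x in lborel. \<beta> x = 0"
      using integral_nonneg_eq_0_iff_AE[OF int] ge0 by simp
    then have "AE x in lebesgue. x \<in> UNIV \<longrightarrow> x \<in> {x. \<beta> x = 0}" by (simp add: AE_completion_iff)
    moreover have "closed {x. \<beta> x = 0}" using cont by (intro closed_Collect_eq) auto
    ultimately have "(0::real^'d) \<in> {x. \<beta> x = 0}"
      using mem_closed_if_AE_lebesgue[of "{x. \<beta> x = 0}" 0] by simp
    moreover have "\<beta> 0 > 0" unfolding pos using n by simp
    ultimately show False by simp
  qed
  moreover have "(LINT x|lborel. \<beta> x) \<ge> 0" using ge0 by simp
  ultimately have I: "(LINT x|lborel. \<beta> x) > 0" by linarith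
  define \<rho> where "\<rho> x = inverse (LINT x|lborel. \<beta> x) * \<beta> x" for x
  have "mollifier \<delta> \<rho>"
    unfolding mollifier_def
  proof (intro conjI allI impI)
    show "\<rho> \<in> Cc_infinity UNIV" unfolding \<rho>_def by (rule Cc_cmult[OF \<beta>])
    show "(LINT x|lborel. \<rho> x) = 1" using I by (simp add: \<rho>_def)
  qed (use ge0 I supp in \<open>auto simp: \<rho>_def\<close>)
  then show thesis by (rule that)
qed

lemma lborel_integral_reflect:
  fixes f :: "'a::euclidean_space \<Rightarrow> real"
  assumes [measurable]: "f \<in> borel_measurable borel"
  shows "(LINT y|lborel. f (x - y)) = (LINT y|lborel. f y)"
proof -
  have "(lborel :: 'a measure) = distr lborel borel (\<lambda>y. x + (- 1) *\<^sub>R y)"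
    using lborel_affine[of "-1" x] by (simp add: density_1)
  then have "(LINT y|lborel. f y) = (LINT y|distr lborel borel (\<lambda>y. x + (- 1) *\<^sub>R y). f y)" by simp
  also have "\<dots> = (LINT y|lborel. f (x + (- 1) *\<^sub>R y))" by (intro integral_distr) auto
  finally show ?thesis by simp
qed

lemma frechet_derivative_eq_sum_partial:
  fixes f :: "real^'d::finite \<Rightarrow> real"
  assumes "f differentiable (at x)"
  shows "frechet_derivative f (at x) h = (\<Sum>i\<in>UNIV. h $ i * partial i f x)"
proof -
  have lin: "bounded_linear (frechet_derivative f (at x))"
    using assms frechet_derivative_works has_derivative_bounded_linear by blast
  have "h = (\<Sum>i\<in>UNIV. h $ i *\<^sub>R axis i 1)"
    using basis_expansion[of h] by (simp add: scalar_mult_eq_scaleR)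
  then have "frechet_derivative f (at x) h = frechet_derivative f (at x) (\<Sum>i\<in>UNIV. h $ i *\<^sub>R axis i 1)"
    by simp
  also have "\<dots> = (\<Sum>i\<in>UNIV. h $ i * partial i f x)"
    using lin by (simp add: linear_simps partial_def bounded_linear.linear linear_sum)
  finally show ?thesis .
qed

lemma Cc_has_derivative:
  assumes "\<phi> \<in> Cc_infinity \<Omega>"
  shows "(\<phi> has_derivative (\<lambda>h. \<Sum>i\<in>UNIV. h $ i * partial i \<phi> x)) (at x)"
  using Cc_differentiable[OF assms] frechet_derivative_works frechet_derivative_eq_sum_partial
  by (metis (no_types, lifting) ext)

lemma Cc_derivative_bound:
  fixes \<phi> :: "real^'d::finite \<Rightarrow> real"
  assumes "\<phi> \<in> Cc_infinity \<Omega>"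
  obtains L where "L \<ge> 0" "\<And>x h. \<bar>\<Sum>i\<in>UNIV. h $ i * partial i \<phi> x\<bar> \<le> L * norm h"
    "\<And>x y. \<bar>\<phi> x - \<phi> y\<bar> \<le> L * norm (x - y)"
proof -
  have "\<forall>i. \<exists>B. \<forall>x. \<bar>partial i \<phi> x\<bar> \<le> B" using Cc_bounded[OF Cc_partial[OF assms]] by metis
  then obtain B where B: "\<And>i x. \<bar>partial i \<phi> x\<bar> \<le> B i" by metis
  define L where "L = (\<Sum>i\<in>UNIV. B i)"
  have Bge: "B i \<ge> 0" for i using B[of i 0] by linarith
  have L0: "L \<ge> 0" unfolding L_def by (intro sum_nonneg Bge)
  have 1: "\<bar>\<Sum>i\<in>UNIV. h $ i * partial i \<phi> x\<bar> \<le> L * norm h" for x h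
  proof -
    have "\<bar>\<Sum>i\<in>UNIV. h $ i * partial i \<phi> x\<bar> \<le> (\<Sum>i\<in>UNIV. \<bar>h $ i * partial i \<phi> x\<bar>)" by (rule sum_abs)
    also have "\<dots> \<le> (\<Sum>i\<in>UNIV. norm h * B i)"
      unfolding abs_mult by (intro sum_mono mult_mono component_le_norm_cart B) auto
    finally show ?thesis by (simp add: L_def sum_distrib_left mult.commute)
  qed
  have "norm (\<phi> x - \<phi> y) \<le> L * norm (x - y)" for x y
  proof (rule differentiable_bound[of UNIV \<phi> "\<lambda>x h. \<Sum>i\<in>UNIV. h $ i * partial i \<phi> x"])
    show "onorm (\<lambda>h. \<Sum>i\<in>UNIV. h $ i * partial i \<phi> x) \<le> L" for x
      by (rule onorm_bound[OF L0]) (use 1 in simp)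
  qed (use Cc_has_derivative[OF assms] in auto)
  then show thesis using that[OF L0 1] by simp
qed

lemma partial_reflect:
  assumes "f differentiable (at (x - y))"
  shows "partial i (\<lambda>y. f (x - y)) y = - partial i f (x - y)"
    and "(\<lambda>y. f (x - y)) differentiable (at y)"
proof -
  let ?D = "frechet_derivative f (at (x - y))"
  have 1: "(f has_derivative ?D) (at (x - y))" using assms frechet_derivative_works by blast
  have "((\<lambda>y. x - y) has_derivative (\<lambda>h. - h)) (at y)" by (auto intro!: derivative_eq_intros)
  from has_derivative_compose[OF this 1]
  have 2: "((\<lambda>y. f (x - y)) has_derivative (\<lambda>h. ?D (- h))) (at y)" .
  then show "(\<lambda>y. f (x - y)) differentiable (at y)" by (auto simp: differentiable_def)
  have "?D (- axis i 1) = - ?D (axis i 1)"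
    using has_derivative_bounded_linear[OF 1] by (simp add: linear_simps)
  then show "partial i (\<lambda>y. f (x - y)) y = - partial i f (x - y)"
    using partial_eq[OF 2] by (simp add: partial_def)
qed

lemma Ck_reflect: "Ck k f \<Longrightarrow> Ck k (\<lambda>y. f (x - y))"
proof (induction k arbitrary: f)
  case 0
  then show ?case by (auto intro!: continuous_on_compose2[of UNIV f] continuous_intros)
next
  case (Suc k)
  have "partial i (\<lambda>y. f (x - y)) = (\<lambda>y. - 1 * partial i f (x - y))" for i
  proof
    fix y
    have "f differentiable (at (x - y))" using Suc.prems by simp
    from partial_reflect(1)[OF this] show "partial i (\<lambda>y. f (x - y)) y = - 1 * partial i f (x - y)"
      by simp
  qed
  moreover have "Ck k (\<lambda>y. - 1 * partial i f (x - y))" for i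
    using Suc by (intro Ck_cmult) auto
  moreover have "(\<lambda>y. f (x - y)) differentiable (at y)" for y
    using partial_reflect(2)[of f x y] Suc.prems by simp
  ultimately show ?case by simp
qed

context bounded_open_set
begin

text \<open>The convolution of \<open>\<rho>\<close> with the extension of \<open>f\<close> by zero; the values of \<open>f\<close> outside \<open>\<Omega>\<close>
  do not matter.\<close>

definition conv :: "(real^'d \<Rightarrow> real) \<Rightarrow> (real^'d \<Rightarrow> real) \<Rightarrow> real^'d \<Rightarrow> real" where
  "conv \<rho> f x = (LINT y|lebesgue_on \<Omega>. \<rho> (x - y) * f y)"

lemma reflect_measurable:
  assumes "\<rho> \<in> Cc_infinity S"
  shows "(\<lambda>y. \<rho> (x - y)) \<in> borel_measurable (lebesgue_on \<Omega>)"
proof -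
  have "Ck 0 (\<lambda>y. \<rho> (x - y))" by (rule Ck_reflect[OF Cc_Ck[OF assms]])
  then show ?thesis by (intro borel_imp_lebesgue_on borel_measurable_continuous_onI) simp
qed

lemma conv_integrable:
  assumes \<rho>: "\<rho> \<in> Cc_infinity S" and f: "integrable (lebesgue_on \<Omega>) f"
  shows "integrable (lebesgue_on \<Omega>) (\<lambda>y. \<rho> (x - y) * f y)"
proof -
  obtain B where B: "\<And>x. \<bar>\<rho> x\<bar> \<le> B" using Cc_bounded[OF \<rho>] by metis
  have "integrable (lebesgue_on \<Omega>) (\<lambda>y. B * f y)" using f by simp
  then show ?thesis
  proof (rule Bochner_Integration.integrable_bound)
    show "(\<lambda>y. \<rho> (x - y) * f y) \<in> borel_measurable (lebesgue_on \<Omega>)"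
      using reflect_measurable[OF \<rho>] f by (intro borel_measurable_times) auto
    have "\<bar>\<rho> (x - y) * f y\<bar> \<le> \<bar>B * f y\<bar>" for y
      using mult_right_mono[OF order_trans[OF B[of "x - y"] abs_ge_self[of B]], of "\<bar>f y\<bar>"]
      by (simp add: abs_mult)
    then show "AE y in lebesgue_on \<Omega>. norm (\<rho> (x - y) * f y) \<le> norm (B * f y)" by simp
  qed
qed

lemma conv_has_derivative:
  assumes \<rho>: "\<rho> \<in> Cc_infinity S" and f: "integrable (lebesgue_on \<Omega>) f"
  shows "(conv \<rho> f has_derivative (\<lambda>h. \<Sum>i\<in>UNIV. h $ i * conv (partial i \<rho>) f x)) (at x)"
proof -
  obtain L where L: "L \<ge> 0" "\<And>x h. \<bar>\<Sum>i\<in>UNIV. h $ i * partial i \<rho> x\<bar> \<le> L * norm h"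
    "\<And>x y. \<bar>\<rho> x - \<rho> y\<bar> \<le> L * norm (x - y)" using Cc_derivative_bound[OF \<rho>] by metis
  let ?D = "\<lambda>h. \<Sum>i\<in>UNIV. h $ i * conv (partial i \<rho>) f x"
  let ?d = "\<lambda>z h. \<Sum>i\<in>UNIV. h $ i * partial i \<rho> z"
  note ci = conv_integrable[OF \<rho> f] conv_integrable[OF Cc_partial[OF \<rho>] f]
  have int_d: "integrable (lebesgue_on \<Omega>) (\<lambda>y. ?d (x - y) h * f y)" for h
    by (simp add: sum_distrib_right mult.assoc) (intro Bochner_Integration.integrable_sum integrable_mult_right ci)
  have D: "?D h = (LINT y|lebesgue_on \<Omega>. ?d (x - y) h * f y)" for h
    unfolding conv_def using ci(2) by (simp add: sum_distrib_right mult.assoc)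
  have lim: "(\<lambda>n. (conv \<rho> f (x + k n) - conv \<rho> f x - ?D (k n)) / norm (k n)) \<longlonglongrightarrow> 0"
    if k: "k \<longlonglongrightarrow> 0" "\<And>n. k n \<noteq> 0" for k :: "nat \<Rightarrow> real^'d"
  proof -
    define q where "q n y = (\<rho> (x + k n - y) - \<rho> (x - y) - ?d (x - y) (k n)) / norm (k n)" for n y
    have eq: "(conv \<rho> f (x + k n) - conv \<rho> f x - ?D (k n)) / norm (k n)
        = (LINT y|lebesgue_on \<Omega>. q n y * f y)" for n
    proof -
      have "conv \<rho> f (x + k n) - conv \<rho> f x - ?D (k n)
          = (LINT y|lebesgue_on \<Omega>. \<rho> (x + k n - y) * f y - \<rho> (x - y) * f y - ?d (x - y) (k n) * f y)"
        unfolding D unfolding conv_def using ci(1) int_d by simp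
      then have "(conv \<rho> f (x + k n) - conv \<rho> f x - ?D (k n)) / norm (k n)
          = (LINT y|lebesgue_on \<Omega>. (\<rho> (x + k n - y) * f y - \<rho> (x - y) * f y - ?d (x - y) (k n) * f y) / norm (k n))"
        by simp
      also have "\<dots> = (LINT y|lebesgue_on \<Omega>. q n y * f y)"
        by (rule Bochner_Integration.integral_cong) (auto simp: q_def left_diff_distrib)
      finally show ?thesis .
    qed
    have q_int: "integrable (lebesgue_on \<Omega>) (\<lambda>y. q n y * f y)" for n
    proof -
      have "integrable (lebesgue_on \<Omega>)
          (\<lambda>y. (\<rho> (x + k n - y) * f y - \<rho> (x - y) * f y - ?d (x - y) (k n) * f y) / norm (k n))"
        by (intro integrable_divide Bochner_Integration.integrable_diff ci int_d)
      then show ?thesis by (simp add: q_def left_diff_distrib)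
    qed
    have "(\<lambda>n. LINT y|lebesgue_on \<Omega>. q n y * f y) \<longlonglongrightarrow> (LINT y|lebesgue_on \<Omega>. 0)"
    proof (rule integral_dominated_convergence[where w="\<lambda>y. (2 * L) * norm (f y)"])
      show "integrable (lebesgue_on \<Omega>) (\<lambda>y. (2 * L) * norm (f y))"
        using f by (intro integrable_mult_right integrable_norm)
      show "(\<lambda>y. q n y * f y) \<in> borel_measurable (lebesgue_on \<Omega>)" for n
        using q_int by (rule borel_measurable_integrable)
      show "AE y in lebesgue_on \<Omega>. (\<lambda>n. q n y * f y) \<longlonglongrightarrow> 0"
      proof (rule AE_I2)
        fix y
        have "((\<lambda>h. norm (\<rho> (x - y + h) - \<rho> (x - y) - ?d (x - y) h) / norm h) \<longlongrightarrow> 0) (at 0)"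
          using Cc_has_derivative[OF \<rho>, of "x - y"] by (simp add: has_derivative_at)
        then have "(\<lambda>n. norm (\<rho> (x - y + k n) - \<rho> (x - y) - ?d (x - y) (k n)) / norm (k n)) \<longlonglongrightarrow> 0"
          by (rule filterlim_compose) (use k in \<open>auto simp: filterlim_at\<close>)
        then have "(\<lambda>n. norm (q n y)) \<longlonglongrightarrow> 0"
          by (simp add: q_def algebra_simps)
        then have "(\<lambda>n. q n y) \<longlonglongrightarrow> 0" by (rule tendsto_norm_zero_cancel)
        then show "(\<lambda>n. q n y * f y) \<longlonglongrightarrow> 0" by (rule tendsto_mult_left_zero)
      qed
      show "AE y in lebesgue_on \<Omega>. norm (q n y * f y) \<le> (2 * L) * norm (f y)" for n
      proof (rule AE_I2)
        fix y
        have "\<bar>\<rho> (x + k n - y) - \<rho> (x - y) - ?d (x - y) (k n)\<bar> \<le> L * norm (k n) + L * norm (k n)"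
        proof -
          have "\<bar>\<rho> (x + k n - y) - \<rho> (x - y)\<bar> \<le> L * norm (k n)"
            using L(3)[of "x + k n - y" "x - y"] by simp
          then show ?thesis using L(2)[of "k n" "x - y"] by linarith
        qed
        then have "\<bar>q n y\<bar> \<le> 2 * L"
          using k(2)[of n] by (simp add: q_def field_simps)
        then show "norm (q n y * f y) \<le> (2 * L) * norm (f y)"
          by (simp add: abs_mult mult_right_mono)
      qed
    qed simp
    then show ?thesis unfolding eq by simp
  qed
  have bl: "bounded_linear ?D"
    by (intro bounded_linear_sum bounded_linear_mult_const bounded_linear_vec_nth)
  have "((\<lambda>h. (conv \<rho> f (x + h) - conv \<rho> f x - ?D h) / norm h) \<longlongrightarrow> 0) (at 0)"
    unfolding tendsto_at_iff_sequentially
  proof (intro allI impI)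
    fix k :: "nat \<Rightarrow> real^'d" assume "\<forall>i. k i \<in> UNIV - {0}" "k \<longlonglongrightarrow> 0"
    then show "((\<lambda>h. (conv \<rho> f (x + h) - conv \<rho> f x - ?D h) / norm h) \<circ> k) \<longlonglongrightarrow> 0"
      using lim[of k] by (simp add: o_def)
  qed
  then have "((\<lambda>h. norm ((conv \<rho> f (x + h) - conv \<rho> f x - ?D h) / norm h)) \<longlongrightarrow> 0) (at 0)"
    by (rule tendsto_norm_zero)
  then show ?thesis unfolding has_derivative_at using bl by simp
qed

lemma partial_conv:
  assumes "\<rho> \<in> Cc_infinity S" "integrable (lebesgue_on \<Omega>) f"
  shows "partial i (conv \<rho> f) = conv (partial i \<rho>) f"
proof
  fix x show "partial i (conv \<rho> f) x = conv (partial i \<rho>) f x"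
    using partial_eq[OF conv_has_derivative[OF assms, of x], of i]
    by (simp add: axis_def if_distrib if_distribR sum.If_cases)
qed

lemma Ck_conv:
  assumes "\<rho> \<in> Cc_infinity S" "integrable (lebesgue_on \<Omega>) f"
  shows "Ck k (conv \<rho> f)"
  using assms(1)
proof (induction k arbitrary: \<rho>)
  case 0
  have "conv \<rho> f differentiable (at x)" for x
    using conv_has_derivative[OF 0 assms(2)] by (auto simp: differentiable_def)
  then show ?case
    by (simp add: continuous_at_imp_continuous_on differentiable_imp_continuous_within)
next
  case (Suc k)
  have "conv \<rho> f differentiable (at x)" for x
    using conv_has_derivative[OF Suc.prems assms(2)] by (auto simp: differentiable_def)
  moreover have "Ck k (partial i (conv \<rho> f))" for i
    unfolding partial_conv[OF Suc.prems assms(2)] using Cc_partial[OF Suc.prems] by (rule Suc.IH)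
  ultimately show ?case by simp
qed

lemma conv_support:
  assumes "mollifier \<delta> \<rho>" "conv \<rho> f x \<noteq> 0"
  shows "\<exists>y\<in>\<Omega>. f y \<noteq> 0 \<and> dist x y \<le> \<delta>"
proof (rule ccontr)
  assume none: "\<not> ?thesis"
  have "\<rho> (x - y) * f y = 0" if "y \<in> \<Omega>" for y
    using assms(1) none that unfolding mollifier_def dist_norm by fastforce
  then have "conv \<rho> f x = (LINT y|lebesgue_on \<Omega>. 0)"
    unfolding conv_def by (intro Bochner_Integration.integral_cong) auto
  then show False using assms(2) by simp
qed

lemma conv_Cc:
  assumes "mollifier \<delta> \<rho>" "integrable (lebesgue_on \<Omega>) f"
    and "compact C" "\<And>y. y \<in> \<Omega> \<Longrightarrow> f y \<noteq> 0 \<Longrightarrow> y \<in> C" "\<And>x y. y \<in> C \<Longrightarrow> dist x y \<le> \<delta> \<Longrightarrow> x \<in> \<Omega>'"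
  shows "conv \<rho> f \<in> Cc_infinity \<Omega>'"
proof -
  have \<rho>: "\<rho> \<in> Cc_infinity UNIV" using assms(1) by (simp add: mollifier_def)
  define D where "D = (\<Union>y\<in>C. cball y \<delta>)"
  have "D = (\<Union>y\<in>C. \<Union>z\<in>cball 0 \<delta>. {y + z})"
  proof -
    have "cball y \<delta> = (\<Union>z\<in>cball 0 \<delta>. {y + z})" for y :: "real^'d"
    proof safe
      fix x assume "x \<in> cball y \<delta>"
      then have "x - y \<in> cball 0 \<delta>" "x = y + (x - y)" by (auto simp: dist_norm norm_minus_commute)
      then show "x \<in> (\<Union>z\<in>cball 0 \<delta>. {y + z})" by blast
    qed (auto simp: dist_norm)
    then show ?thesis unfolding D_def by (rule SUP_cong[OF refl])
  qed
  then have "D = {y + z | y z. y \<in> C \<and> z \<in> cball 0 \<delta>}" by blast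
  then have D: "compact D" using compact_sums[OF assms(3) compact_cball[of 0 \<delta>]] by simp
  have "D \<subseteq> \<Omega>'" using assms(5) by (auto simp: D_def dist_commute)
  moreover have "conv \<rho> f x = 0" if "x \<notin> D" for x
  proof (rule ccontr)
    assume "conv \<rho> f x \<noteq> 0"
    from conv_support[OF assms(1) this] obtain y where "y \<in> \<Omega>" "f y \<noteq> 0" "dist x y \<le> \<delta>" by blast
    then show False using that assms(4)[of y] by (auto simp: D_def dist_commute)
  qed
  ultimately have "\<exists>C. compact C \<and> C \<subseteq> \<Omega>' \<and> (\<forall>x. x \<notin> C \<longrightarrow> conv \<rho> f x = 0)"
    using D by (intro exI[of _ D]) simp
  then show ?thesis unfolding Cc_infinity_def by (simp add: Ck_conv[OF \<rho> assms(2)])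
qed

lemma mollifier_mass:
  assumes "mollifier \<delta> \<rho>"
  shows "integrable lborel (\<lambda>y. \<rho> (x - y))" "(LINT y|lborel. \<rho> (x - y)) = 1"
    "integrable lborel (\<lambda>y. \<rho> (y - x))" "(LINT y|lborel. \<rho> (y - x)) = 1"
proof -
  have \<rho>: "\<rho> \<in> Cc_infinity UNIV" and one: "(LINT x|lborel. \<rho> x) = 1"
    using assms by (auto simp: mollifier_def)
  note m = Cc_borel[OF \<rho>]
  show 1: "(LINT y|lborel. \<rho> (x - y)) = 1" using lborel_integral_reflect[OF m] one by simp
  then show "integrable lborel (\<lambda>y. \<rho> (x - y))"
    using not_integrable_integral_eq by fastforce
  show 2: "(LINT y|lborel. \<rho> (y - x)) = 1" using lborel_integral_shift[OF m, of "- x"] one by simp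
  then show "integrable lborel (\<lambda>y. \<rho> (y - x))"
    using not_integrable_integral_eq by fastforce
qed

text \<open>Mollification does not increase the \<open>L\<^sup>2\<close> norm: Cauchy--Schwarz with respect to the
  weight \<open>\<rho>(x - y)\<close>, followed by Tonelli.\<close>

lemma conv_L2:
  assumes mol: "mollifier \<delta> \<rho>" and f: "f \<in> L2 \<Omega>"
  shows "conv \<rho> f \<in> L2 \<Omega>" "L2_norm \<Omega> (conv \<rho> f) \<le> L2_norm \<Omega> f"
proof -
  have \<rho>: "\<rho> \<in> Cc_infinity UNIV" and \<rho>0: "\<And>x. \<rho> x \<ge> 0" using mol by (auto simp: mollifier_def)
  note [measurable] = Cc_borel[OF \<rho>]
  have \<Omega>: "\<Omega> \<inter> space lebesgue \<in> sets lebesgue" using open_set by auto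
  have [measurable]: "\<Omega> \<in> sets borel" using open_set by simp
  have fi: "integrable (lebesgue_on \<Omega>) f" using f by (rule L2_integrable)
  have f2: "integrable (lebesgue_on \<Omega>) (\<lambda>y. (f y)\<^sup>2)" using L2_integrable_square[OF f] by simp
  obtain B where B: "\<And>x. \<bar>\<rho> x\<bar> \<le> B" using Cc_bounded[OF \<rho>] by metis
  have cs: "(conv \<rho> f x)\<^sup>2 \<le> (LINT y|lebesgue_on \<Omega>. \<rho> (x - y) * (f y)\<^sup>2)" for x
  proof -
    let ?s = "\<lambda>y. sqrt (\<rho> (x - y))"
    have sm: "?s \<in> borel_measurable (lebesgue_on \<Omega>)"
      using reflect_measurable[OF \<rho>, of x] by measurable
    have s_le: "\<bar>?s y\<bar> \<le> sqrt B" for y using B[of "x - y"] \<rho>0[of "x - y"] by simp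
    have s1: "?s \<in> L2 \<Omega>" by (rule L2_bounded[OF sm]) (use s_le in simp)
    have s2: "(\<lambda>y. ?s y * f y) \<in> L2 \<Omega>"
    proof (rule L2_bound_fun[OF _ L2_cmult[OF f, of "sqrt B"]])
      show "(\<lambda>y. ?s y * f y) \<in> borel_measurable (lebesgue_on \<Omega>)"
        using sm L2_measurable[OF f] by (rule borel_measurable_times)
      show "norm (?s y * f y) \<le> norm (sqrt B *\<^sub>R f y)" for y
        using mult_right_mono[OF order_trans[OF s_le[of y] abs_ge_self[of "sqrt B"]], of "\<bar>f y\<bar>"]
        by (simp add: abs_mult)
    qed
    have i: "L2_inner \<Omega> ?s (\<lambda>y. ?s y * f y) = conv \<rho> f x"
      unfolding L2_inner_def conv_def
      by (rule Bochner_Integration.integral_cong) (auto simp: \<rho>0 mult.assoc[symmetric])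
    have n1: "(L2_norm \<Omega> ?s)\<^sup>2 \<le> 1"
    proof -
      have "(L2_norm \<Omega> ?s)\<^sup>2 = (LINT y|lebesgue_on \<Omega>. \<rho> (x - y))"
        unfolding L2_norm_square_integral by (simp add: \<rho>0)
      also have "\<dots> = (LINT y|lebesgue. indicator \<Omega> y *\<^sub>R \<rho> (x - y))"
        by (rule integral_restrict_space[OF \<Omega>])
      also have "\<dots> = (LINT y|lborel. indicator \<Omega> y *\<^sub>R \<rho> (x - y))"
        by (intro integral_completion) measurable
      also have "\<dots> \<le> (LINT y|lborel. \<rho> (x - y))"
        using mollifier_mass(1)[OF mol, of x]
        by (intro integral_mono integrable_mult_indicator) (auto simp: indicator_def \<rho>0)
      finally show ?thesis using mollifier_mass(2)[OF mol] by simp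
    qed
    have n2: "(L2_norm \<Omega> (\<lambda>y. ?s y * f y))\<^sup>2 = (LINT y|lebesgue_on \<Omega>. \<rho> (x - y) * (f y)\<^sup>2)"
      unfolding L2_norm_square_integral by (simp add: power_mult_distrib \<rho>0)
    have "(conv \<rho> f x)\<^sup>2 \<le> (L2_norm \<Omega> ?s * L2_norm \<Omega> (\<lambda>y. ?s y * f y))\<^sup>2"
      using L2_inner_Cauchy_Schwarz[OF s1 s2] unfolding i
      by (metis abs_ge_zero power2_abs power_mono)
    also have "\<dots> \<le> 1 * (L2_norm \<Omega> (\<lambda>y. ?s y * f y))\<^sup>2"
      unfolding power_mult_distrib by (intro mult_right_mono n1) simp
    finally show ?thesis unfolding n2 by simp
  qed
  have "(\<lambda>x. indicator \<Omega> x *\<^sub>R f x) \<in> borel_measurable lebesgue"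
    using L2_measurable[OF f] \<Omega> by (simp add: borel_measurable_restrict_space_iff)
  then obtain g where [measurable]: "g \<in> borel_measurable lborel"
    and fg: "AE x in lborel. indicator \<Omega> x *\<^sub>R f x = g x"
    using completion_ex_borel_measurable_real by blast
  have fg': "AE x in lebesgue. indicator \<Omega> x *\<^sub>R f x = g x" using fg by (simp add: AE_completion_iff)
  have transfer: "(\<integral>\<^sup>+y. ennreal (h y * (f y)\<^sup>2) \<partial>lebesgue_on \<Omega>) = (\<integral>\<^sup>+y. ennreal (h y * (g y)\<^sup>2) \<partial>lborel)"
    if [measurable]: "h \<in> borel_measurable borel" for h
  proof -
    have "(\<integral>\<^sup>+y. ennreal (h y * (f y)\<^sup>2) \<partial>lebesgue_on \<Omega>) = (\<integral>\<^sup>+y. ennreal (h y * (f y)\<^sup>2) * indicator \<Omega> y \<partial>lebesgue)"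
      by (rule nn_integral_restrict_space[OF \<Omega>])
    also have "\<dots> = (\<integral>\<^sup>+y. ennreal (h y * (g y)\<^sup>2) \<partial>lebesgue)"
      by (rule nn_integral_cong_AE, use fg' in eventually_elim) (auto simp: indicator_def split: if_splits)
    also have "\<dots> = (\<integral>\<^sup>+y. ennreal (h y * (g y)\<^sup>2) \<partial>lborel)"
      by (rule nn_integral_completion)
    finally show ?thesis .
  qed
  have conv_m: "conv \<rho> f \<in> borel_measurable borel"
    using Ck_conv[OF \<rho> fi, of 0] by (intro borel_measurable_continuous_onI) simp
  have "(\<integral>\<^sup>+x. ennreal ((conv \<rho> f x)\<^sup>2) \<partial>lebesgue_on \<Omega>)
      = (\<integral>\<^sup>+x. ennreal ((conv \<rho> f x)\<^sup>2) * indicator \<Omega> x \<partial>lebesgue)"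
    by (rule nn_integral_restrict_space[OF \<Omega>])
  also have "\<dots> = (\<integral>\<^sup>+x. ennreal ((conv \<rho> f x)\<^sup>2) * indicator \<Omega> x \<partial>lborel)"
    by (rule nn_integral_completion)
  also have "\<dots> \<le> (\<integral>\<^sup>+x. (\<integral>\<^sup>+y. ennreal (\<rho> (x - y) * (g y)\<^sup>2) \<partial>lborel) \<partial>lborel)"
  proof (rule nn_integral_mono)
    fix x
    have i: "integrable (lebesgue_on \<Omega>) (\<lambda>y. \<rho> (x - y) * (f y)\<^sup>2)" by (rule conv_integrable[OF \<rho> f2])
    have "ennreal ((conv \<rho> f x)\<^sup>2) \<le> ennreal (LINT y|lebesgue_on \<Omega>. \<rho> (x - y) * (f y)\<^sup>2)"
      by (intro ennreal_leI cs)
    also have "\<dots> = (\<integral>\<^sup>+y. ennreal (\<rho> (x - y) * (f y)\<^sup>2) \<partial>lebesgue_on \<Omega>)"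
      by (rule nn_integral_eq_integral[OF i, symmetric]) (simp add: \<rho>0)
    also have "\<dots> = (\<integral>\<^sup>+y. ennreal (\<rho> (x - y) * (g y)\<^sup>2) \<partial>lborel)" by (rule transfer) measurable
    finally show "ennreal ((conv \<rho> f x)\<^sup>2) * indicator \<Omega> x \<le> (\<integral>\<^sup>+y. ennreal (\<rho> (x - y) * (g y)\<^sup>2) \<partial>lborel)"
      by (auto simp: indicator_def)
  qed
  also have "\<dots> = (\<integral>\<^sup>+y. (\<integral>\<^sup>+x. ennreal (\<rho> (x - y) * (g y)\<^sup>2) \<partial>lborel) \<partial>lborel)"
    by (rule lborel_pair.Fubini'[symmetric]) measurable
  also have "\<dots> = (\<integral>\<^sup>+y. ennreal (1 * (g y)\<^sup>2) \<partial>lborel)"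
  proof (rule nn_integral_cong)
    fix y
    have "(\<integral>\<^sup>+x. ennreal (\<rho> (x - y) * (g y)\<^sup>2) \<partial>lborel) = (\<integral>\<^sup>+x. ennreal (\<rho> (x - y)) \<partial>lborel) * ennreal ((g y)\<^sup>2)"
      by (simp add: ennreal_mult' \<rho>0 nn_integral_multc)
    also have "(\<integral>\<^sup>+x. ennreal (\<rho> (x - y)) \<partial>lborel) = ennreal 1"
      using nn_integral_eq_integral[OF mollifier_mass(3)[OF mol, of y]] mollifier_mass(4)[OF mol] \<rho>0 by simp
    finally show "(\<integral>\<^sup>+x. ennreal (\<rho> (x - y) * (g y)\<^sup>2) \<partial>lborel) = ennreal (1 * (g y)\<^sup>2)" by simp
  qed
  also have "\<dots> = (\<integral>\<^sup>+y. ennreal (1 * (f y)\<^sup>2) \<partial>lebesgue_on \<Omega>)" by (rule transfer[symmetric]) simp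
  also have "\<dots> = ennreal ((L2_norm \<Omega> f)\<^sup>2)"
    using nn_integral_eq_integral[OF f2] by (simp add: L2_norm_square_integral)
  finally have le: "(\<integral>\<^sup>+x. ennreal ((conv \<rho> f x)\<^sup>2) \<partial>lebesgue_on \<Omega>) \<le> ennreal ((L2_norm \<Omega> f)\<^sup>2)" .
  have m: "conv \<rho> f \<in> borel_measurable (lebesgue_on \<Omega>)" by (rule borel_imp_lebesgue_on[OF conv_m])
  have i: "integrable (lebesgue_on \<Omega>) (\<lambda>x. (conv \<rho> f x)\<^sup>2)"
    using m le_less_trans[OF le ennreal_less_top] by (intro integrableI_bounded) auto
  then show "conv \<rho> f \<in> L2 \<Omega>" using m by (simp add: L2_def)
  have "ennreal ((L2_norm \<Omega> (conv \<rho> f))\<^sup>2) \<le> ennreal ((L2_norm \<Omega> f)\<^sup>2)"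
    using le nn_integral_eq_integral[OF i] by (simp add: L2_norm_square_integral[of \<Omega> "conv \<rho> f"])
  then have "(L2_norm \<Omega> (conv \<rho> f))\<^sup>2 \<le> (L2_norm \<Omega> f)\<^sup>2" by (simp add: ennreal_le_iff)
  then show "L2_norm \<Omega> (conv \<rho> f) \<le> L2_norm \<Omega> f" by (rule power2_le_imp_le[OF _ L2_norm_ge_0])
qed

lemma conv_Cc_close:
  assumes mol: "mollifier \<delta> \<rho>" and \<phi>: "\<phi> \<in> Cc_infinity \<Omega>"
    and L: "\<And>x y. \<bar>\<phi> x - \<phi> y\<bar> \<le> L * norm (x - y)" "L \<ge> 0"
  shows "\<bar>conv \<rho> \<phi> x - \<phi> x\<bar> \<le> L * \<delta>"
proof -
  have \<rho>: "\<rho> \<in> Cc_infinity UNIV" and \<rho>0: "\<And>x. \<rho> x \<ge> 0" and supp: "\<And>x. \<rho> x \<noteq> 0 \<Longrightarrow> norm x \<le> \<delta>"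
    using mol by (auto simp: mollifier_def)
  note [measurable] = Cc_borel[OF \<rho>] Cc_borel[OF \<phi>]
  note mass = mollifier_mass(1,2)[OF mol, of x]
  have b: "\<bar>\<rho> (x - y) * (\<phi> y - \<phi> x)\<bar> \<le> L * \<delta> * \<rho> (x - y)" for y
  proof (cases "\<rho> (x - y) = 0")
    case False
    then have "norm (y - x) \<le> \<delta>" using supp by (metis norm_minus_commute)
    then have "\<bar>\<phi> y - \<phi> x\<bar> \<le> L * \<delta>" using L(1)[of y x] mult_left_mono[OF _ L(2)] by fastforce
    from mult_left_mono[OF this \<rho>0[of "x - y"]] show ?thesis
      using \<rho>0[of "x - y"] by (simp add: abs_mult mult.commute)
  qed simp
  have i1: "integrable lborel (\<lambda>y. \<rho> (x - y) * (\<phi> y - \<phi> x))"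
    by (rule Bochner_Integration.integrable_bound[where f="\<lambda>y. L * \<delta> * \<rho> (x - y)"])
       (use mass(1) order_trans[OF b abs_ge_self] in auto)
  have i2: "integrable lborel (\<lambda>y. \<rho> (x - y) * \<phi> x)" using mass(1) by simp
  have "conv \<rho> \<phi> x = (LINT y|lborel. \<rho> (x - y) * \<phi> y)"
    unfolding conv_def by (rule lebesgue_on_integral_eq_lborel[OF open_set]) (use Cc_outside[OF \<phi>] in auto)
  also have "\<dots> = (LINT y|lborel. \<rho> (x - y) * (\<phi> y - \<phi> x) + \<rho> (x - y) * \<phi> x)"
    by (simp add: algebra_simps)
  also have "\<dots> = (LINT y|lborel. \<rho> (x - y) * (\<phi> y - \<phi> x)) + \<phi> x"
    using i1 i2 mass by (subst Bochner_Integration.integral_add) auto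
  finally have "conv \<rho> \<phi> x - \<phi> x = (LINT y|lborel. \<rho> (x - y) * (\<phi> y - \<phi> x))" by simp
  also have "\<bar>\<dots>\<bar> \<le> (LINT y|lborel. \<bar>\<rho> (x - y) * (\<phi> y - \<phi> x)\<bar>)" by (rule integral_abs_bound)
  also have "\<dots> \<le> (LINT y|lborel. L * \<delta> * \<rho> (x - y))"
    using i1 mass(1) b by (intro integral_mono) auto
  finally show ?thesis using mass by simp
qed

lemma conv_diff:
  assumes "\<rho> \<in> Cc_infinity S" "integrable (lebesgue_on \<Omega>) f" "integrable (lebesgue_on \<Omega>) g"
  shows "conv \<rho> (\<lambda>x. f x - g x) x = conv \<rho> f x - conv \<rho> g x"
  unfolding conv_def right_diff_distrib
  using conv_integrable[OF assms(1,2)] conv_integrable[OF assms(1,3)] by simp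

theorem conv_tendsto_L2:
  assumes mol: "\<And>n. mollifier (\<delta> n) (\<rho> n)" and \<delta>: "\<delta> \<longlonglongrightarrow> 0" and f: "f \<in> L2 \<Omega>"
  shows "(\<lambda>n. L2_norm \<Omega> (\<lambda>x. conv (\<rho> n) f x - f x)) \<longlonglongrightarrow> 0"
proof (rule LIMSEQ_I)
  fix e :: real assume e: "e > 0"
  have \<rho>: "\<rho> n \<in> Cc_infinity UNIV" for n using mol[of n] by (simp add: mollifier_def)
  obtain \<phi>' where \<phi>': "\<phi>' \<in> test_fields \<Omega>" "L2_norm \<Omega> (\<lambda>x. f x - \<phi>' x) < e / 3"
    using test_fields_dense[OF f, of "e / 3"] e by auto
  define \<phi> where "\<phi> = \<phi>'"
  have \<phi>: "\<phi> \<in> Cc_infinity \<Omega>" and close: "L2_norm \<Omega> (\<lambda>x. f x - \<phi> x) < e / 3"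
    using \<phi>' by (auto simp: test_fields_def \<phi>_def)
  have \<phi>2: "\<phi> \<in> L2 \<Omega>" using \<phi> by (rule Cc_L2)
  obtain L where L: "L \<ge> 0" "\<And>x y. \<bar>\<phi> x - \<phi> y\<bar> \<le> L * norm (x - y)"
    using Cc_derivative_bound[OF \<phi>] by metis
  define K where "K = L2_norm \<Omega> (\<lambda>x. 1 :: real)"
  have "(\<lambda>n. (L * \<delta> n) * K) \<longlonglongrightarrow> (L * 0) * K" by (intro tendsto_intros \<delta>)
  from LIMSEQ_D[OF this, of "e/3"] e obtain N where N: "\<And>n. n \<ge> N \<Longrightarrow> \<bar>(L * \<delta> n) * K\<bar> < e / 3" by auto
  have "L2_norm \<Omega> (\<lambda>x. conv (\<rho> n) f x - f x) < e" if "n \<ge> N" for n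
  proof -
    have c: "conv (\<rho> n) f \<in> L2 \<Omega>" "conv (\<rho> n) \<phi> \<in> L2 \<Omega>" using conv_L2[OF mol] f \<phi>2 by auto
    have "conv (\<rho> n) (\<lambda>x. f x - \<phi> x) = (\<lambda>x. conv (\<rho> n) f x - conv (\<rho> n) \<phi> x)"
      by (rule ext, rule conv_diff[OF \<rho> L2_integrable[OF f] L2_integrable[OF \<phi>2]])
    then have 1: "L2_norm \<Omega> (\<lambda>x. conv (\<rho> n) f x - conv (\<rho> n) \<phi> x) < e / 3"
      using conv_L2(2)[OF mol[of n] L2_diff[OF f \<phi>2]] close by (simp only: le_less_trans)
    have "L2_norm \<Omega> (\<lambda>x. conv (\<rho> n) \<phi> x - \<phi> x) \<le> L2_norm \<Omega> (\<lambda>x. (L * \<delta> n) *\<^sub>R (1::real))"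
    proof (rule L2_norm_mono)
      show "norm (conv (\<rho> n) \<phi> x - \<phi> x) \<le> norm ((L * \<delta> n) *\<^sub>R (1::real))" for x
        using conv_Cc_close[OF mol \<phi> L(2,1), of n x] by simp
    qed (intro L2_measurable L2_diff c \<phi>2, rule L2_const)
    also have "\<dots> = \<bar>(L * \<delta> n) * K\<bar>"
      by (simp only: L2_norm_scaleR K_def[symmetric] abs_mult) (simp add: K_def L2_norm_ge_0)
    finally have 2: "L2_norm \<Omega> (\<lambda>x. conv (\<rho> n) \<phi> x - \<phi> x) < e / 3" using N[OF that] by simp
    have "L2_norm \<Omega> (\<lambda>x. conv (\<rho> n) f x - f x)
        \<le> L2_norm \<Omega> (\<lambda>x. conv (\<rho> n) f x - conv (\<rho> n) \<phi> x) + L2_norm \<Omega> (\<lambda>x. conv (\<rho> n) \<phi> x - f x)"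
      by (intro L2_norm_triangle_diff c f)
    also have "L2_norm \<Omega> (\<lambda>x. conv (\<rho> n) \<phi> x - f x)
        \<le> L2_norm \<Omega> (\<lambda>x. conv (\<rho> n) \<phi> x - \<phi> x) + L2_norm \<Omega> (\<lambda>x. \<phi> x - f x)"
      by (intro L2_norm_triangle_diff c \<phi>2 f)
    finally show ?thesis using 1 2 close by (simp add: L2_norm_minus_commute[of \<Omega> \<phi> f])
  qed
  then show "\<exists>N. \<forall>n\<ge>N. norm (L2_norm \<Omega> (\<lambda>x. conv (\<rho> n) f x - f x) - 0) < e"
    by (intro exI[of _ N]) (simp add: L2_norm_ge_0)
qed

lemma mollifier_sequence:
  obtains \<delta> and \<rho> :: "nat \<Rightarrow> real^'d \<Rightarrow> real"
  where "\<And>n. mollifier (\<delta> n) (\<rho> n)" "\<delta> \<longlonglongrightarrow> 0" "\<And>n. \<delta> n > 0"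
proof -
  define \<delta> where "\<delta> n = inverse (real (Suc n))" for n
  have "\<forall>n. \<exists>\<rho>::real^'d \<Rightarrow> real. mollifier (\<delta> n) \<rho>"
    using mollifier_exists unfolding \<delta>_def by (metis inverse_positive_iff_positive of_nat_0_less_iff zero_less_Suc)
  then obtain \<rho> :: "nat \<Rightarrow> real^'d \<Rightarrow> real" where "\<And>n. mollifier (\<delta> n) (\<rho> n)" by metis
  moreover have "\<delta> \<longlonglongrightarrow> 0" unfolding \<delta>_def by (rule LIMSEQ_inverse_real_of_nat)
  ultimately show thesis by (intro that) (auto simp: \<delta>_def)
qed

text \<open>Where the kernel does not reach the boundary, differentiation commutes with mollification.\<close>

lemma partial_conv_weak_gradient:
  assumes mol: "mollifier \<delta> \<rho>" and f: "f \<in> L2 \<Omega>" and wg: "is_weak_gradient \<Omega> f g"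
    and x: "cball x \<delta> \<subseteq> \<Omega>"
  shows "partial i (conv \<rho> f) x = conv \<rho> (\<lambda>y. g y $ i) x"
proof -
  have \<rho>: "\<rho> \<in> Cc_infinity UNIV" and supp: "\<And>x. \<rho> x \<noteq> 0 \<Longrightarrow> norm x \<le> \<delta>"
    using mol by (auto simp: mollifier_def)
  let ?\<psi> = "\<lambda>y. \<rho> (x - y)"
  have "\<forall>y. y \<notin> cball x \<delta> \<longrightarrow> ?\<psi> y = 0" using supp by (force simp: dist_norm)
  then have "\<exists>C. compact C \<and> C \<subseteq> \<Omega> \<and> (\<forall>y. y \<notin> C \<longrightarrow> ?\<psi> y = 0)"
    by (intro exI[of _ "cball x \<delta>"] conjI compact_cball x)
  then have \<psi>: "?\<psi> \<in> Cc_infinity \<Omega>"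
    unfolding Cc_infinity_def by (simp add: Ck_reflect Cc_Ck[OF \<rho>])
  have p: "partial i ?\<psi> y = - partial i \<rho> (x - y)" for y
    by (rule partial_reflect[OF Cc_differentiable[OF \<rho>]])
  have "partial i (conv \<rho> f) x = (LINT y|lebesgue_on \<Omega>. partial i \<rho> (x - y) * f y)"
    by (simp add: partial_conv[OF \<rho> L2_integrable[OF f]] conv_def)
  also have "\<dots> = - (LINT y|lebesgue_on \<Omega>. f y * partial i ?\<psi> y)"
    by (simp add: p mult.commute)
  also have "\<dots> = (LINT y|lebesgue_on \<Omega>. g y $ i * ?\<psi> y)"
    using wg \<psi> unfolding is_weak_gradient_def by simp
  finally show ?thesis by (simp add: conv_def mult.commute)
qed

end

section \<open>Weak gradients\<close>

lemma L2_vec_iff: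
  fixes v :: "real^'d::finite \<Rightarrow> 'a::euclidean_space^'n::finite"
  shows "v \<in> L2 \<Omega> \<longleftrightarrow> (\<forall>j. (\<lambda>x. v x $ j) \<in> L2 \<Omega>)"
  unfolding L2_componentwise[of v] L2_componentwise[of "\<lambda>x. v x $ _"]
  by (auto simp: Basis_vec_def inner_axis)

lemma L2_inner_vec:
  fixes v w :: "real^'d::finite \<Rightarrow> 'a::euclidean_space^'n::finite"
  assumes "v \<in> L2 \<Omega>" "w \<in> L2 \<Omega>"
  shows "L2_inner \<Omega> v w = (\<Sum>j\<in>UNIV. L2_inner \<Omega> (\<lambda>x. v x $ j) (\<lambda>x. w x $ j))"
  using assms unfolding L2_inner_def inner_vec_def L2_vec_iff
  by (intro Bochner_Integration.integral_sum L2_inner_integrable) auto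

lemma L2_norm_vec:
  fixes v :: "real^'d::finite \<Rightarrow> 'a::euclidean_space^'n::finite"
  assumes "v \<in> L2 \<Omega>"
  shows "(L2_norm \<Omega> v)\<^sup>2 = (\<Sum>j\<in>UNIV. (L2_norm \<Omega> (\<lambda>x. v x $ j))\<^sup>2)"
  unfolding L2_norm_square by (rule L2_inner_vec[OF assms assms])

lemma L2_norm_vec_tendsto_0:
  fixes v :: "nat \<Rightarrow> real^'d::finite \<Rightarrow> 'a::euclidean_space^'n::finite"
  assumes v: "\<And>n. v n \<in> L2 \<Omega>" and lim: "\<And>j. (\<lambda>n. L2_norm \<Omega> (\<lambda>x. v n x $ j)) \<longlonglongrightarrow> 0"
  shows "(\<lambda>n. L2_norm \<Omega> (v n)) \<longlonglongrightarrow> 0"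
proof -
  have "(\<lambda>n. sqrt (\<Sum>j\<in>UNIV. (L2_norm \<Omega> (\<lambda>x. v n x $ j))\<^sup>2)) \<longlonglongrightarrow> sqrt (\<Sum>j\<in>(UNIV::'n set). 0\<^sup>2)"
    by (intro tendsto_intros lim)
  moreover have "sqrt (\<Sum>j\<in>UNIV. (L2_norm \<Omega> (\<lambda>x. v n x $ j))\<^sup>2) = L2_norm \<Omega> (v n)" for n
    unfolding L2_norm_vec[OF v, symmetric] by (simp add: L2_norm_ge_0)
  ultimately show ?thesis by simp
qed

lemma L2_Pair:
  assumes "f \<in> L2 \<Omega>" "g \<in> L2 \<Omega>"
  shows "(\<lambda>x. (f x, g x)) \<in> L2 \<Omega>"
  using assms by (auto simp: L2_def norm_Pair intro: borel_measurable_Pair)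

lemma L2_inner_Pair:
  assumes "f \<in> L2 \<Omega>" "g \<in> L2 \<Omega>" "p \<in> L2 \<Omega>" "q \<in> L2 \<Omega>"
  shows "L2_inner \<Omega> (\<lambda>x. (f x, g x)) (\<lambda>x. (p x, q x)) = L2_inner \<Omega> f p + L2_inner \<Omega> g q"
  using L2_inner_integrable[OF assms(1,3)] L2_inner_integrable[OF assms(2,4)]
  by (simp add: L2_inner_def)

lemma L2_norm_Pair:
  assumes "f \<in> L2 \<Omega>" "g \<in> L2 \<Omega>"
  shows "(L2_norm \<Omega> (\<lambda>x. (f x, g x)))\<^sup>2 = (L2_norm \<Omega> f)\<^sup>2 + (L2_norm \<Omega> g)\<^sup>2"
  unfolding L2_norm_square by (rule L2_inner_Pair[OF assms assms])

lemma L2_cong: "(\<And>x. x \<in> \<Omega> \<Longrightarrow> f x = g x) \<Longrightarrow> f \<in> L2 \<Omega> \<longleftrightarrow> g \<in> L2 \<Omega>"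
  unfolding L2_def mem_Collect_eq
  by (intro conj_cong measurable_cong Bochner_Integration.integrable_cong) auto

text \<open>An element of the Sobolev space together with a representative of its weak gradient.\<close>

definition has_weak_gradient ::
  "(real^'d::finite) set \<Rightarrow> (real^'d \<Rightarrow> real) \<Rightarrow> (real^'d \<Rightarrow> real^'d) \<Rightarrow> bool" where
  "has_weak_gradient \<Omega> f g \<longleftrightarrow> f \<in> L2 \<Omega> \<and> g \<in> L2 \<Omega> \<and> is_weak_gradient \<Omega> f g"

text \<open>The classical gradient, used for test functions and mollified functions.\<close>

definition gradient :: "(real^'d::finite \<Rightarrow> real) \<Rightarrow> real^'d \<Rightarrow> real^'d" where
  "gradient \<phi> x = (\<chi> i. partial i \<phi> x)"

lemma has_weak_gradient_L2:
  "has_weak_gradient \<Omega> f g \<Longrightarrow> f \<in> L2 \<Omega>" "has_weak_gradient \<Omega> f g \<Longrightarrow> g \<in> L2 \<Omega>"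
  by (simp_all add: has_weak_gradient_def)

lemma H1_iff: "f \<in> H1 \<Omega> \<longleftrightarrow> (\<exists>g. has_weak_gradient \<Omega> f g)"
  by (auto simp: H1_def has_weak_gradient_def)

lemma H1_weak_grad: "f \<in> H1 \<Omega> \<Longrightarrow> has_weak_gradient \<Omega> f (weak_grad \<Omega> f)"
  unfolding weak_grad_def has_weak_gradient_def H1_def
  using someI_ex[of "\<lambda>g. g \<in> L2 \<Omega> \<and> is_weak_gradient \<Omega> f g"] by auto

lemma has_weak_gradient_cong:
  assumes "\<And>x. x \<in> \<Omega> \<Longrightarrow> f x = f' x" "has_weak_gradient \<Omega> f g"
  shows "has_weak_gradient \<Omega> f' g"
proof -
  have "(LINT x|lebesgue_on \<Omega>. f' x * partial i \<phi> x) = (LINT x|lebesgue_on \<Omega>. f x * partial i \<phi> x)" for i \<phi>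
    by (rule Bochner_Integration.integral_cong) (use assms(1) in auto)
  then show ?thesis
    using assms L2_cong[of \<Omega> f f'] by (simp add: has_weak_gradient_def is_weak_gradient_def)
qed

context bounded_open_set
begin

lemma is_weak_gradient_iff:
  "is_weak_gradient \<Omega> f g \<longleftrightarrow>
    (\<forall>\<phi>\<in>Cc_infinity \<Omega>. \<forall>i. L2_inner \<Omega> f (partial i \<phi>) = - L2_inner \<Omega> (\<lambda>x. g x $ i) \<phi>)"
  by (simp add: is_weak_gradient_def L2_inner_def)

lemma has_weak_gradientD:
  assumes "has_weak_gradient \<Omega> f g" "\<phi> \<in> Cc_infinity \<Omega>"
  shows "L2_inner \<Omega> f (partial i \<phi>) = - L2_inner \<Omega> (\<lambda>x. g x $ i) \<phi>"
  using assms by (simp add: has_weak_gradient_def is_weak_gradient_iff)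

lemma has_weak_gradientI:
  assumes "f \<in> L2 \<Omega>" "g \<in> L2 \<Omega>"
    "\<And>\<phi> i. \<phi> \<in> Cc_infinity \<Omega> \<Longrightarrow> L2_inner \<Omega> f (partial i \<phi>) = - L2_inner \<Omega> (\<lambda>x. g x $ i) \<phi>"
  shows "has_weak_gradient \<Omega> f g"
  using assms by (simp add: has_weak_gradient_def is_weak_gradient_iff)

lemma L2_nth: "(g :: real^'d \<Rightarrow> 'a::euclidean_space^'n::finite) \<in> L2 \<Omega> \<Longrightarrow> (\<lambda>x. g x $ i) \<in> L2 \<Omega>"
  using L2_vec_iff by blast

lemma has_weak_gradient_add:
  assumes "has_weak_gradient \<Omega> f g" "has_weak_gradient \<Omega> f' g'"
  shows "has_weak_gradient \<Omega> (\<lambda>x. f x + f' x) (\<lambda>x. g x + g' x)"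
proof -
  note L = has_weak_gradient_L2[OF assms(1)] has_weak_gradient_L2[OF assms(2)]
  show ?thesis
  proof (rule has_weak_gradientI)
    fix \<phi> i assume \<phi>: "\<phi> \<in> Cc_infinity \<Omega>"
    show "L2_inner \<Omega> (\<lambda>x. f x + f' x) (partial i \<phi>) = - L2_inner \<Omega> (\<lambda>x. (g x + g' x) $ i) \<phi>"
      using L2_inner_add_left[OF L(1,3) Cc_L2[OF Cc_partial[OF \<phi>]]]
        L2_inner_add_left[OF L2_nth[OF L(2)] L2_nth[OF L(4)] Cc_L2[OF \<phi>]]
        has_weak_gradientD[OF assms(1) \<phi>] has_weak_gradientD[OF assms(2) \<phi>] by simp
  qed (intro L2_add L)+
qed

lemma has_weak_gradient_cmult:
  assumes "has_weak_gradient \<Omega> f g"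
  shows "has_weak_gradient \<Omega> (\<lambda>x. c * f x) (\<lambda>x. c *\<^sub>R g x)"
proof (rule has_weak_gradientI)
  show "(\<lambda>x. c * f x) \<in> L2 \<Omega>" "(\<lambda>x. c *\<^sub>R g x) \<in> L2 \<Omega>"
    using L2_cmult[OF has_weak_gradient_L2(1)[OF assms], of c]
      L2_cmult[OF has_weak_gradient_L2(2)[OF assms], of c] by simp_all
  show "L2_inner \<Omega> (\<lambda>x. c * f x) (partial i \<phi>) = - L2_inner \<Omega> (\<lambda>x. (c *\<^sub>R g x) $ i) \<phi>"
    if "\<phi> \<in> Cc_infinity \<Omega>" for \<phi> i
    using L2_inner_scaleR_left[of \<Omega> c f "partial i \<phi>"] L2_inner_scaleR_left[of \<Omega> c "\<lambda>x. g x $ i" \<phi>]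
      has_weak_gradientD[OF assms that, of i] by simp
qed

lemma has_weak_gradient_diff:
  assumes "has_weak_gradient \<Omega> f g" "has_weak_gradient \<Omega> f' g'"
  shows "has_weak_gradient \<Omega> (\<lambda>x. f x - f' x) (\<lambda>x. g x - g' x)"
  using has_weak_gradient_add[OF assms(1) has_weak_gradient_cmult[OF assms(2), of "-1"]] by simp

lemma gradient_test_field: "\<phi> \<in> Cc_infinity \<Omega>' \<Longrightarrow> gradient \<phi> \<in> test_fields \<Omega>'"
  by (auto simp: test_fields_def gradient_def Basis_vec_def inner_axis intro: Cc_partial)

lemma has_weak_gradient_Cc:
  assumes \<phi>: "\<phi> \<in> Cc_infinity \<Omega>"
  shows "has_weak_gradient \<Omega> \<phi> (gradient \<phi>)"
proof (rule has_weak_gradientI)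
  show "\<phi> \<in> L2 \<Omega>" "gradient \<phi> \<in> L2 \<Omega>"
    using \<phi> by (auto intro: Cc_L2 test_fields_L2 gradient_test_field)
  fix \<psi> i assume \<psi>: "\<psi> \<in> Cc_infinity \<Omega>"
  have "(\<lambda>x. \<phi> x * \<psi> x) \<in> Cc_infinity \<Omega>" by (rule Cc_mult_smooth[OF \<psi> Cc_Ck[OF \<phi>]])
  then have "0 = (LINT x|lebesgue_on \<Omega>. partial i (\<lambda>x. \<phi> x * \<psi> x) x)"
    by (simp add: integral_partial_eq_0)
  also have "\<dots> = (LINT x|lebesgue_on \<Omega>. \<phi> x \<bullet> partial i \<psi> x + partial i \<phi> x \<bullet> \<psi> x)"
    by (simp add: partial_mult Cc_differentiable[OF \<phi>] Cc_differentiable[OF \<psi>])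
  also have "\<dots> = L2_inner \<Omega> \<phi> (partial i \<psi>) + L2_inner \<Omega> (partial i \<phi>) \<psi>"
    unfolding L2_inner_def
    using L2_inner_integrable[OF Cc_L2[OF \<phi>] Cc_L2[OF Cc_partial[OF \<psi>]]]
      L2_inner_integrable[OF Cc_L2[OF Cc_partial[OF \<phi>]] Cc_L2[OF \<psi>]]
    by (intro Bochner_Integration.integral_add)
  finally show "L2_inner \<Omega> \<phi> (partial i \<psi>) = - L2_inner \<Omega> (\<lambda>x. gradient \<phi> x $ i) \<psi>"
    by (simp add: gradient_def)
qed

lemma weak_gradient_unique:
  assumes "has_weak_gradient \<Omega> f g" "has_weak_gradient \<Omega> f g'"
  shows "AE x in lebesgue_on \<Omega>. g x = g' x"
proof -
  note L = has_weak_gradient_L2(2)[OF assms(1)] has_weak_gradient_L2(2)[OF assms(2)]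
  have "AE x in lebesgue_on \<Omega>. g x - g' x = 0"
  proof (rule orthogonal_test_fields_imp_AE_0[OF L2_diff[OF L]])
    fix \<phi> :: "real^'d \<Rightarrow> real^'d" assume \<phi>: "\<phi> \<in> test_fields \<Omega>"
    have "L2_inner \<Omega> (\<lambda>x. g x $ i - g' x $ i) (\<lambda>x. \<phi> x $ i) = 0" for i
    proof -
      have c: "(\<lambda>x. \<phi> x $ i) \<in> Cc_infinity \<Omega>"
        using \<phi> by (auto simp: test_fields_def Basis_vec_def inner_axis)
      then show ?thesis
        using has_weak_gradientD[OF assms(1) c, of i] has_weak_gradientD[OF assms(2) c, of i]
        by (simp add: L2_inner_diff_left L2_nth L Cc_L2)
    qed
    then show "L2_inner \<Omega> (\<lambda>x. g x - g' x) \<phi> = 0"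
      by (simp add: L2_inner_vec[OF L2_diff[OF L] test_fields_L2[OF \<phi>]])
  qed
  then show ?thesis by eventually_elim simp
qed

lemma weak_grad_AE:
  assumes "has_weak_gradient \<Omega> f g"
  shows "AE x in lebesgue_on \<Omega>. weak_grad \<Omega> f x = g x"
  using assms H1_iff H1_weak_grad by (intro weak_gradient_unique) auto

lemma L2_norm_weak_grad:
  assumes "has_weak_gradient \<Omega> f g"
  shows "L2_norm \<Omega> (weak_grad \<Omega> f) = L2_norm \<Omega> g"
  using weak_grad_AE[OF assms] assms H1_weak_grad[of f \<Omega>] H1_iff[of f \<Omega>]
  by (intro L2_norm_cong_AE) (auto dest: has_weak_gradient_L2 intro: L2_measurable)

lemma test_field_component_Cc:
  "(\<phi> :: real^'d \<Rightarrow> real^'n::finite) \<in> test_fields \<Omega>' \<Longrightarrow> (\<lambda>x. \<phi> x $ i) \<in> Cc_infinity \<Omega>'"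
  by (auto simp: test_fields_def Basis_vec_def inner_axis)

lemma test_field_row:
  "(\<phi> :: real^'d \<Rightarrow> real^'k::finite^'n::finite) \<in> test_fields \<Omega>' \<Longrightarrow> (\<lambda>x. \<phi> x $ j) \<in> test_fields \<Omega>'"
  by (force simp: test_fields_def Basis_vec_def inner_axis)

text \<open>If the integral of \<open>f\<close> against the divergence of test fields is bounded by the \<open>L\<^sup>2\<close> norm of
  the field, then the Riesz theorem provides a weak Jacobian of \<open>f\<close>, with the same bound.\<close>

lemma weak_jacobian_exists:
  fixes f :: "real^'d \<Rightarrow> real^'n::finite"
  assumes f: "f \<in> L2 \<Omega>"
    and bound: "\<And>\<phi> :: real^'d \<Rightarrow> real^'d^'n. \<phi> \<in> test_fields \<Omega> \<Longrightarrow>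
      \<bar>\<Sum>j\<in>UNIV. \<Sum>i\<in>UNIV. L2_inner \<Omega> (\<lambda>x. f x $ j) (partial i (\<lambda>x. \<phi> x $ j $ i))\<bar> \<le> C * L2_norm \<Omega> \<phi>"
  obtains G :: "real^'d \<Rightarrow> real^'d^'n" where
    "\<And>j. has_weak_gradient \<Omega> (\<lambda>x. f x $ j) (\<lambda>x. G x $ j)" "G \<in> L2 \<Omega>" "L2_norm \<Omega> G \<le> \<bar>C\<bar>"
proof -
  define T :: "(real^'d \<Rightarrow> real^'d^'n) \<Rightarrow> real" where
    "T \<phi> = - (\<Sum>j\<in>UNIV. \<Sum>i\<in>UNIV. L2_inner \<Omega> (\<lambda>x. f x $ j) (partial i (\<lambda>x. \<phi> x $ j $ i)))" for \<phi>
  note fj = L2_nth[OF f]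
  have comp: "(\<lambda>x. \<phi> x $ j $ i) \<in> Cc_infinity \<Omega>" if "\<phi> \<in> test_fields \<Omega>" for \<phi> :: "real^'d \<Rightarrow> real^'d^'n" and j i
    using test_field_component_Cc[OF test_field_row[OF that]] .
  have pL2: "partial i (\<lambda>x. \<phi> x $ j $ i) \<in> L2 \<Omega>" if "\<phi> \<in> test_fields \<Omega>" for \<phi> :: "real^'d \<Rightarrow> real^'d^'n" and j i
    by (rule Cc_L2[OF Cc_partial[OF comp[OF that]]])
  obtain G where G: "G \<in> L2 \<Omega>" "\<And>\<phi>. \<phi> \<in> test_fields \<Omega> \<Longrightarrow> T \<phi> = L2_inner \<Omega> G \<phi>" "L2_norm \<Omega> G \<le> \<bar>C\<bar>"
  proof (rule L2_Riesz[of "test_fields \<Omega> :: (real^'d \<Rightarrow> real^'d^'n) set" \<Omega> T C])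
    show "test_fields \<Omega> \<noteq> ({} :: (real^'d \<Rightarrow> real^'d^'n) set)" using test_fields_zero by blast
    fix p :: "real^'d \<Rightarrow> real^'d^'n" assume p: "p \<in> test_fields \<Omega>"
    show "\<bar>T p\<bar> \<le> C * L2_norm \<Omega> p" using bound[OF p] by (simp add: T_def)
    show "T (\<lambda>x. c *\<^sub>R p x) = c * T p" for c
    proof -
      have "L2_inner \<Omega> (\<lambda>x. f x $ j) (partial i (\<lambda>x. (c *\<^sub>R p x) $ j $ i))
          = c * L2_inner \<Omega> (\<lambda>x. f x $ j) (partial i (\<lambda>x. p x $ j $ i))" for i j
      proof -
        have "partial i (\<lambda>x. c * p x $ j $ i) = (\<lambda>x. c *\<^sub>R partial i (\<lambda>x. p x $ j $ i) x)"
        proof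
          fix x :: "real^'d"
          have "(\<lambda>x. c :: real) differentiable (at x)" by simp
          from partial_mult[OF this Cc_differentiable[OF comp[OF p]], of i j i]
          show "partial i (\<lambda>x. c * p x $ j $ i) x = c *\<^sub>R partial i (\<lambda>x. p x $ j $ i) x"
            by (simp add: partial_eq[OF has_derivative_const])
        qed
        then show ?thesis
          using L2_inner_scaleR_left[of \<Omega> c "partial i (\<lambda>x. p x $ j $ i)" "\<lambda>x. f x $ j"]
          by (simp add: L2_inner_commute)
      qed
      then show ?thesis by (simp add: T_def sum_distrib_left)
    qed
    show "T (\<lambda>x. p x + q x) = T p + T q" if q: "q \<in> test_fields \<Omega>" for q
    proof -
      have "L2_inner \<Omega> (\<lambda>x. f x $ j) (partial i (\<lambda>x. (p x + q x) $ j $ i))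
          = L2_inner \<Omega> (\<lambda>x. f x $ j) (partial i (\<lambda>x. p x $ j $ i))
            + L2_inner \<Omega> (\<lambda>x. f x $ j) (partial i (\<lambda>x. q x $ j $ i))" for i j
      proof -
        have "partial i (\<lambda>x. p x $ j $ i + q x $ j $ i)
            = (\<lambda>x. partial i (\<lambda>x. p x $ j $ i) x + partial i (\<lambda>x. q x $ j $ i) x)"
          by (intro ext partial_add Cc_differentiable[OF comp[OF p]] Cc_differentiable[OF comp[OF q]])
        then show ?thesis
          using L2_inner_add_left[OF pL2[OF p] pL2[OF q] fj] by (simp add: L2_inner_commute)
      qed
      then show ?thesis by (simp add: T_def sum.distrib)
    qed
  qed (use test_fields_L2 in \<open>auto intro: test_fields_add test_fields_scaleR\<close>)
  have "has_weak_gradient \<Omega> (\<lambda>x. f x $ j) (\<lambda>x. G x $ j)" for j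
  proof (rule has_weak_gradientI[OF fj L2_nth[OF G(1)]])
    fix \<psi> i assume \<psi>: "\<psi> \<in> Cc_infinity \<Omega>"
    define \<phi> :: "real^'d \<Rightarrow> real^'d^'n" where "\<phi> x = \<psi> x *\<^sub>R axis j (axis i 1)" for x
    have "axis j (axis i (1::real)) \<in> (Basis :: (real^'d^'n) set)"
      by (simp add: axis_in_Basis_iff)
    then have \<phi>: "\<phi> \<in> test_fields \<Omega>"
      unfolding \<phi>_def by (rule test_fields_scaleR_Basis[OF \<psi>])
    have c: "(\<lambda>x. \<phi> x $ k $ l) = (\<lambda>x. if k = j \<and> l = i then \<psi> x else 0)" for k l
      by (auto simp: \<phi>_def axis_def)
    have p0: "partial l (\<lambda>x. 0) = (\<lambda>x::real^'d. 0)" for l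
      by (rule ext) (simp add: partial_eq[OF has_derivative_const])
    have "L2_inner \<Omega> (\<lambda>x. f x $ k) (partial l (\<lambda>x. \<phi> x $ k $ l))
        = (if k = j \<and> l = i then L2_inner \<Omega> (\<lambda>x. f x $ j) (partial i \<psi>) else 0)" for k l
      unfolding c by (auto simp: p0 L2_inner_def)
    then have "T \<phi> = - (\<Sum>k\<in>UNIV. \<Sum>l\<in>UNIV. if k = j \<and> l = i then L2_inner \<Omega> (\<lambda>x. f x $ j) (partial i \<psi>) else 0)"
      by (simp add: T_def)
    also have "\<dots> = - (\<Sum>k\<in>UNIV. if k = j then L2_inner \<Omega> (\<lambda>x. f x $ j) (partial i \<psi>) else 0)"
      by (intro arg_cong[where f=uminus] sum.cong) auto
    finally have "T \<phi> = - L2_inner \<Omega> (\<lambda>x. f x $ j) (partial i \<psi>)" by simp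
    moreover have "L2_inner \<Omega> G \<phi> = L2_inner \<Omega> (\<lambda>x. G x $ j $ i) \<psi>"
      unfolding L2_inner_def by (simp add: \<phi>_def inner_axis mult.commute)
    ultimately show "L2_inner \<Omega> (\<lambda>x. f x $ j) (partial i \<psi>) = - L2_inner \<Omega> (\<lambda>x. G x $ j $ i) \<psi>"
      using G(2)[OF \<phi>] by simp
  qed
  then show thesis using that G by blast
qed

end

section \<open>Lipschitz functions of Sobolev maps\<close>

lemma lborel_integrable_continuous_support:
  fixes f :: "'a::euclidean_space \<Rightarrow> real"
  assumes "continuous_on UNIV f" "\<And>x. x \<notin> cball 0 R \<Longrightarrow> f x = 0"
  shows "integrable lborel f"
proof -
  have "bounded (f ` cball 0 R)"
    using assms(1) by (intro compact_imp_bounded compact_continuous_image compact_cball)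
      (rule continuous_on_subset, auto)
  then obtain B where B: "\<And>x. x \<in> cball 0 R \<Longrightarrow> \<bar>f x\<bar> \<le> B" "B > 0"
    unfolding bounded_pos by (metis imageI real_norm_def)
  have b: "\<bar>f x\<bar> \<le> B" for x using B assms(2)[of x] by (cases "x \<in> cball 0 R") auto
  show ?thesis
    by (rule lborel_integrable_bounded_support[OF borel_measurable_continuous_onI[OF assms(1)] assms(2) b])
qed

lemma test_fields_bounded_support:
  fixes \<phi> :: "real^'d::finite \<Rightarrow> real^'k::finite^'n::finite"
  assumes "\<phi> \<in> test_fields \<Omega>"
  obtains C where "compact C" "C \<subseteq> \<Omega>" "\<And>x. x \<notin> C \<Longrightarrow> \<phi> x = 0"
proof -
  have "\<forall>b\<in>Basis. \<exists>C. compact C \<and> C \<subseteq> \<Omega> \<and> (\<forall>x. x \<notin> C \<longrightarrow> \<phi> x \<bullet> b = 0)"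
    using assms by (auto simp: test_fields_def Cc_infinity_def)
  then obtain C where C: "\<And>b. b \<in> Basis \<Longrightarrow> compact (C b) \<and> C b \<subseteq> \<Omega> \<and> (\<forall>x. x \<notin> C b \<longrightarrow> \<phi> x \<bullet> b = 0)"
    by metis
  show thesis
  proof (rule that)
    show "compact (\<Union>b\<in>Basis. C b)" using C by (intro compact_UN) auto
    show "(\<Union>b\<in>Basis. C b) \<subseteq> \<Omega>" using C by blast
    show "\<phi> x = 0" if "x \<notin> (\<Union>b\<in>Basis. C b)" for x
    proof (rule euclidean_eqI)
      fix b :: "real^'k^'n" assume "b \<in> Basis"
      then have "\<phi> x \<bullet> b = 0" using that C by blast
      then show "\<phi> x \<bullet> b = 0 \<bullet> b" by simp
    qed
  qed
qed

lemma Lipschitz_continuous: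
  assumes "\<And>y z. norm (F y - F z) \<le> L * norm (y - z)" "L \<ge> 0"
  shows "continuous_on S F"
  using assms by (intro lipschitz_on_continuous_on[of L] lipschitz_onI) (auto simp: dist_norm)

text \<open>The chain rule inequality for a smooth map \<open>V\<close> in weak form.  The difference quotients of
  \<open>F \<circ> V\<close> in direction \<open>i\<close> are at most \<open>L\<close> times those of \<open>V\<close>; summing over \<open>i\<close> with the
  Cauchy--Schwarz inequality produces the Frobenius norms.\<close>

lemma Lipschitz_difference_quotient_estimate:
  fixes F :: "real^'m::finite \<Rightarrow> real^'n::finite" and V :: "real^'d::finite \<Rightarrow> real^'m"
    and \<phi> :: "real^'d \<Rightarrow> real^'d^'n"
  assumes F: "\<And>y z. norm (F y - F z) \<le> L * norm (y - z)" and L: "L \<ge> 0"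
    and V: "\<And>k. (\<lambda>x. V x $ k) \<in> Cc_infinity UNIV"
    and \<phi>: "\<phi> \<in> test_fields \<Omega>"
  shows "\<bar>\<Sum>j\<in>UNIV. \<Sum>i\<in>UNIV. LINT x|lborel. F (V x) $ j * partial i (\<lambda>x. \<phi> x $ j $ i) x\<bar>
    \<le> (LINT x|lborel. L * (norm (\<chi> k. gradient (\<lambda>x. V x $ k) x) * norm (\<phi> x)))"
proof -
  define h where "h n = 1 / real (Suc n)" for n
  have h: "h n > 0" for n by (simp add: h_def)
  have hlim: "h \<longlonglongrightarrow> 0"
    using LIMSEQ_inverse_real_of_nat by (simp add: h_def[abs_def] inverse_eq_divide)
  have \<phi>c: "(\<lambda>x. \<phi> x $ j $ i) \<in> Cc_infinity \<Omega>" for i j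
    using \<phi> by (force simp: test_fields_def Basis_vec_def inner_axis)
  obtain C where C: "compact C" "\<And>x. x \<notin> C \<Longrightarrow> \<phi> x = 0"
    using test_fields_bounded_support[OF \<phi>] by metis
  obtain R where R: "C \<subseteq> cball 0 R"
    using compact_imp_bounded[OF C(1)] unfolding bounded_iff by (metis mem_cball_0 subsetI)
  have \<phi>0: "\<phi> x = 0" if "x \<notin> cball 0 R" for x using that R C(2) by blast
  have contF: "continuous_on UNIV F" by (rule Lipschitz_continuous[OF F L])
  have contV: "continuous_on UNIV V"
    using Cc_continuous[OF V] by (intro continuous_on_vec_lambda[of UNIV "\<lambda>k x. V x $ k", simplified])
  have contFV: "continuous_on UNIV (\<lambda>x. F (V x))"
    by (rule continuous_on_compose2[OF contF contV]) auto
  have cont\<phi>: "continuous_on UNIV (\<lambda>x. \<phi> x $ j $ i)" for i j by (rule Cc_continuous[OF \<phi>c])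
  have "\<forall>k. \<exists>B. \<forall>x. \<bar>V x $ k\<bar> \<le> B" using Cc_bounded[OF V] by metis
  then obtain BV where BV: "\<And>k x. \<bar>V x $ k\<bar> \<le> BV k" by metis
  have FB: "\<bar>F (V x) $ j\<bar> \<le> norm (F 0) + L * (\<Sum>k\<in>UNIV. BV k)" for x j
  proof -
    have "\<bar>F (V x) $ j\<bar> \<le> norm (F (V x))" by (rule component_le_norm_cart)
    also have "\<dots> \<le> norm (F 0) + norm (F (V x) - F 0)" using norm_triangle_sub by blast
    also have "norm (F (V x) - F 0) \<le> L * norm (V x)" using F[of "V x" 0] by simp
    also have "norm (V x) \<le> (\<Sum>k\<in>UNIV. BV k)"
      by (rule order_trans[OF norm_le_l1_cart]) (intro sum_mono BV)
    finally show ?thesis using L by (simp add: mult_left_mono)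
  qed
  have "\<forall>i k. \<exists>B. \<forall>x. \<bar>partial i (\<lambda>x. V x $ k) x\<bar> \<le> B" using Cc_bounded[OF Cc_partial[OF V]] by metis
  then obtain BD where BD: "\<And>i k x. \<bar>partial i (\<lambda>x. V x $ k) x\<bar> \<le> BD i k" by metis
  let ?e = "\<lambda>i. axis i (1::real) :: real^'d"
  define q where "q n i x = (1 / h n) *\<^sub>R (V (x + h n *\<^sub>R ?e i) - V x)" for n i x
  have qk: "q n i x $ k = (V (x + h n *\<^sub>R ?e i) $ k - V x $ k) / h n" for n i x k
    by (simp add: q_def)
  have q_bound: "norm (q n i x) \<le> (\<Sum>k\<in>UNIV. BD i k)" for n i x
  proof -
    have "\<bar>q n i x $ k\<bar> \<le> BD i k" for k
      using difference_quotient_bound[OF Cc_differentiable[OF V] BD, of x "h n" i k] h[of n]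
      by (simp add: qk divide_le_eq)
    then show ?thesis by (intro order_trans[OF norm_le_l1_cart] sum_mono)
  qed
  have q_lim: "(\<lambda>n. q n i x) \<longlonglongrightarrow> (\<chi> k. partial i (\<lambda>x. V x $ k) x)" for i x
  proof (rule vec_tendstoI)
    fix k
    have "h n \<noteq> 0" for n using h[of n] by simp
    then show "(\<lambda>n. q n i x $ k) \<longlonglongrightarrow> (\<chi> k. partial i (\<lambda>x. V x $ k) x) $ k"
      unfolding qk using difference_quotient_tendsto[OF Cc_differentiable[OF V[of k]] hlim, of x i] by simp
  qed
  define col where "col i x = (\<chi> j. \<phi> x $ j $ i)" for i x
  define t where "t n j i x = (F (V (x + h n *\<^sub>R ?e i)) $ j - F (V x) $ j) / h n * \<phi> x $ j $ i" for n j i x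
  define r where "r n x = L * (\<Sum>i\<in>UNIV. norm (q n i x) * norm (col i x))" for n x
  have shift_cont: "continuous_on UNIV (\<lambda>x. G (x + c))" if "continuous_on UNIV G"
    for G :: "real^'d \<Rightarrow> 'z::topological_space" and c
    by (rule continuous_on_compose2[OF that]) (auto intro: continuous_intros)
  have contcol: "continuous_on UNIV (col i)" for i
    unfolding col_def by (intro continuous_on_vec_lambda cont\<phi>)
  have t_int: "integrable lborel (t n j i)" for n j i
  proof (rule lborel_integrable_continuous_support[where R=R])
    have hn: "\<forall>x\<in>UNIV. h n \<noteq> 0" using h[of n] by simp
    show "continuous_on UNIV (t n j i)"
      unfolding t_def using contFV shift_cont[OF contFV] hn
      by (intro continuous_on_mult continuous_on_divide continuous_on_diff cont\<phi> continuous_on_const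
          continuous_on_component) auto
  qed (simp add: t_def \<phi>0)
  have r_int: "integrable lborel (r n)" for n
  proof (rule lborel_integrable_continuous_support[where R=R])
    show "continuous_on UNIV (r n)"
      unfolding r_def q_def using contV shift_cont[OF contV] contcol
      by (intro continuous_on_mult continuous_on_sum continuous_on_const continuous_on_norm
          continuous_on_scaleR continuous_on_diff)
  qed (simp add: r_def col_def \<phi>0 flip: zero_vec_def)
  have t_le: "\<bar>\<Sum>j\<in>UNIV. \<Sum>i\<in>UNIV. t n j i x\<bar> \<le> r n x" for n x
  proof -
    let ?d = "\<lambda>i. (1 / h n) *\<^sub>R (F (V (x + h n *\<^sub>R ?e i)) - F (V x))"
    have "(\<Sum>j\<in>UNIV. \<Sum>i\<in>UNIV. t n j i x) = (\<Sum>i\<in>UNIV. \<Sum>j\<in>UNIV. t n j i x)" by (rule sum.swap)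
    also have "\<dots> = (\<Sum>i\<in>UNIV. ?d i \<bullet> col i x)" by (simp add: t_def inner_vec_def col_def)
    finally have "\<bar>\<Sum>j\<in>UNIV. \<Sum>i\<in>UNIV. t n j i x\<bar> \<le> (\<Sum>i\<in>UNIV. \<bar>?d i \<bullet> col i x\<bar>)"
      by (simp only: sum_abs)
    also have "\<dots> \<le> (\<Sum>i\<in>UNIV. (L * norm (q n i x)) * norm (col i x))"
    proof (rule sum_mono)
      fix i
      have "norm (?d i) \<le> L * norm (q n i x)"
        using F[of "V (x + h n *\<^sub>R ?e i)" "V x"] h[of n] by (simp add: q_def divide_right_mono)
      then show "\<bar>?d i \<bullet> col i x\<bar> \<le> (L * norm (q n i x)) * norm (col i x)"
        using Cauchy_Schwarz_ineq2[of "?d i" "col i x"] by (meson mult_right_mono norm_ge_zero order_trans)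
    qed
    also have "\<dots> = r n x" by (simp add: r_def sum_distrib_left mult.assoc)
    finally show ?thesis .
  qed
  define r\<^sub>0 where "r\<^sub>0 x = L * (\<Sum>i\<in>UNIV. norm (\<chi> k. partial i (\<lambda>x. V x $ k) x) * norm (col i x))" for x
  have r0_le: "r\<^sub>0 x \<le> L * (norm (\<chi> k. gradient (\<lambda>x. V x $ k) x) * norm (\<phi> x))" for x
  proof -
    let ?a = "\<chi> i. norm (\<chi> k. partial i (\<lambda>x. V x $ k) x)" and ?b = "\<chi> i. norm (col i x)"
    have "(\<Sum>i\<in>UNIV. norm (\<chi> k. partial i (\<lambda>x. V x $ k) x) * norm (col i x)) = ?a \<bullet> ?b"
      by (simp add: inner_vec_def)
    also have "\<dots> \<le> norm ?a * norm ?b" by (rule norm_cauchy_schwarz)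
    also have "norm ?a = norm (\<chi> k. gradient (\<lambda>x. V x $ k) x)"
    proof -
      have "(norm ?a)\<^sup>2 = (\<Sum>i\<in>UNIV. \<Sum>k\<in>UNIV. (partial i (\<lambda>x. V x $ k) x)\<^sup>2)"
        by (simp add: power2_norm_eq_inner inner_vec_def power2_eq_square[symmetric])
      also have "\<dots> = (\<Sum>k\<in>UNIV. \<Sum>i\<in>UNIV. (partial i (\<lambda>x. V x $ k) x)\<^sup>2)" by (rule sum.swap)
      also have "\<dots> = (norm (\<chi> k. gradient (\<lambda>x. V x $ k) x))\<^sup>2"
        unfolding power2_norm_eq_inner inner_vec_def gradient_def by (simp add: power2_eq_square)
      finally show ?thesis by (simp add: power2_eq_iff_nonneg)
    qed
    also have "norm ?b = norm (\<phi> x)"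
    proof -
      have "(norm ?b)\<^sup>2 = (\<Sum>i\<in>UNIV. \<Sum>j\<in>UNIV. (\<phi> x $ j $ i)\<^sup>2)"
        by (simp add: power2_norm_eq_inner inner_vec_def power2_eq_square[symmetric] col_def)
      also have "\<dots> = (\<Sum>j\<in>UNIV. \<Sum>i\<in>UNIV. (\<phi> x $ j $ i)\<^sup>2)" by (rule sum.swap)
      also have "\<dots> = (norm (\<phi> x))\<^sup>2"
        unfolding power2_norm_eq_inner inner_vec_def by (simp add: power2_eq_square)
      finally show ?thesis by (simp add: power2_eq_iff_nonneg)
    qed
    finally show ?thesis unfolding r\<^sub>0_def by (rule mult_left_mono[OF _ L])
  qed
  have colnorm: "integrable lborel (\<lambda>x. norm (col i x))" for i
    by (rule lborel_integrable_continuous_support[where R=R])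
       (use contcol in \<open>auto intro: continuous_on_norm simp: col_def \<phi>0 simp flip: zero_vec_def\<close>)
  have r0_int: "integrable lborel r\<^sub>0"
  proof (rule lborel_integrable_continuous_support[where R=R])
    show "continuous_on UNIV r\<^sub>0"
      unfolding r\<^sub>0_def
      by (intro continuous_on_mult continuous_on_sum continuous_on_const continuous_on_norm contcol
          continuous_on_vec_lambda Cc_continuous[OF Cc_partial[OF V]])
  qed (simp add: r\<^sub>0_def col_def \<phi>0 flip: zero_vec_def)
  have r_lim: "(\<lambda>n. LINT x|lborel. r n x) \<longlonglongrightarrow> (LINT x|lborel. r\<^sub>0 x)"
  proof (rule integral_dominated_convergence[where w="\<lambda>x. L * (\<Sum>i\<in>UNIV. (\<Sum>k\<in>UNIV. BD i k) * norm (col i x))"])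
    show "integrable lborel (\<lambda>x. L * (\<Sum>i\<in>UNIV. (\<Sum>k\<in>UNIV. BD i k) * norm (col i x)))"
      by (intro integrable_mult_right Bochner_Integration.integrable_sum colnorm)
    show "r n \<in> borel_measurable lborel" for n using r_int by (rule borel_measurable_integrable)
    show "r\<^sub>0 \<in> borel_measurable lborel" using r0_int by (rule borel_measurable_integrable)
    show "AE x in lborel. (\<lambda>n. r n x) \<longlonglongrightarrow> r\<^sub>0 x"
      by (auto simp: r_def r\<^sub>0_def intro!: tendsto_intros q_lim)
    have "\<bar>r n x\<bar> \<le> L * (\<Sum>i\<in>UNIV. (\<Sum>k\<in>UNIV. BD i k) * norm (col i x))" for n x
    proof -
      have "\<bar>r n x\<bar> = r n x" unfolding r_def using L by (intro abs_of_nonneg mult_nonneg_nonneg sum_nonneg) auto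
      also have "\<dots> \<le> L * (\<Sum>i\<in>UNIV. (\<Sum>k\<in>UNIV. BD i k) * norm (col i x))"
        unfolding r_def by (intro mult_left_mono[OF _ L] sum_mono mult_right_mono q_bound norm_ge_zero)
      finally show ?thesis .
    qed
    then show "AE x in lborel. norm (r n x) \<le> L * (\<Sum>i\<in>UNIV. (\<Sum>k\<in>UNIV. BD i k) * norm (col i x))" for n
      by simp
  qed
  have t_lim: "(\<lambda>n. \<Sum>j\<in>UNIV. \<Sum>i\<in>UNIV. LINT x|lborel. t n j i x)
      \<longlonglongrightarrow> (\<Sum>j\<in>UNIV. \<Sum>i\<in>UNIV. - (LINT x|lborel. F (V x) $ j * partial i (\<lambda>x. \<phi> x $ j $ i) x))"
    unfolding t_def h_def
    by (intro tendsto_sum difference_quotient_integral_tendsto[OF _ FB \<phi>c] continuous_on_component contFV)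
  have "\<bar>\<Sum>j\<in>UNIV. \<Sum>i\<in>UNIV. - (LINT x|lborel. F (V x) $ j * partial i (\<lambda>x. \<phi> x $ j $ i) x)\<bar>
      \<le> (LINT x|lborel. r\<^sub>0 x)"
  proof (rule LIMSEQ_le[OF tendsto_rabs[OF t_lim] r_lim])
    have "\<bar>\<Sum>j\<in>UNIV. \<Sum>i\<in>UNIV. LINT x|lborel. t n j i x\<bar> \<le> (LINT x|lborel. r n x)" for n
    proof -
      have "(\<Sum>j\<in>UNIV. \<Sum>i\<in>UNIV. LINT x|lborel. t n j i x) = (LINT x|lborel. (\<Sum>j\<in>UNIV. \<Sum>i\<in>UNIV. t n j i x))"
        using t_int by simp
      also have "\<bar>\<dots>\<bar> \<le> (LINT x|lborel. \<bar>\<Sum>j\<in>UNIV. \<Sum>i\<in>UNIV. t n j i x\<bar>)" by (rule integral_abs_bound)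
      also have "\<dots> \<le> (LINT x|lborel. r n x)"
        by (intro integral_mono integrable_abs Bochner_Integration.integrable_sum t_int r_int t_le)
      finally show ?thesis .
    qed
    then show "\<exists>N. \<forall>n\<ge>N. \<bar>\<Sum>j\<in>UNIV. \<Sum>i\<in>UNIV. LINT x|lborel. t n j i x\<bar> \<le> (LINT x|lborel. r n x)" by blast
  qed
  also have "(LINT x|lborel. r\<^sub>0 x) \<le> (LINT x|lborel. L * (norm (\<chi> k. gradient (\<lambda>x. V x $ k) x) * norm (\<phi> x)))"
  proof (rule integral_mono)
    have cg: "continuous_on UNIV (\<lambda>x. (\<chi> k. gradient (\<lambda>x. V x $ k) x))"
      unfolding gradient_def by (intro continuous_on_vec_lambda Cc_continuous[OF Cc_partial[OF V]])
    have "continuous_on UNIV (\<lambda>x. \<chi> j. \<chi> i. \<phi> x $ j $ i)" by (intro continuous_on_vec_lambda cont\<phi>)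
    then have "continuous_on UNIV \<phi>" by simp
    with cg show "integrable lborel (\<lambda>x. L * (norm (\<chi> k. gradient (\<lambda>x. V x $ k) x) * norm (\<phi> x)))"
      by (intro lborel_integrable_continuous_support[where R=R] continuous_on_mult continuous_on_const
          continuous_on_norm) (simp_all add: \<phi>0)
    show "integrable lborel r\<^sub>0" by (rule r0_int)
  qed (rule r0_le)
  finally show ?thesis by (simp add: sum_negf)
qed

lemma L2_norm_fun: "f \<in> L2 \<Omega> \<Longrightarrow> (\<lambda>x. norm (f x)) \<in> L2 \<Omega>"
  by (auto simp: L2_def)

lemma L2_norm_norm: "L2_norm \<Omega> (\<lambda>x. norm (f x)) = L2_norm \<Omega> f"
  by (rule L2_norm_cong) simp

context bounded_open_set
begin

lemma L2_norm_matrix: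
  fixes J :: "real^'d \<Rightarrow> real^'k::finite^'m::finite"
  assumes "J \<in> L2 \<Omega>"
  shows "(L2_norm \<Omega> J)\<^sup>2 = (\<Sum>k\<in>UNIV. \<Sum>i\<in>UNIV. (L2_norm \<Omega> (\<lambda>x. J x $ k $ i))\<^sup>2)"
  unfolding L2_norm_vec[OF assms] L2_norm_vec[OF L2_nth[OF assms]] ..

lemma Lipschitz_L2:
  fixes F :: "'a::euclidean_space \<Rightarrow> 'b::euclidean_space"
  assumes F: "\<And>y z. norm (F y - F z) \<le> L * norm (y - z)" "L \<ge> 0" and U: "U \<in> L2 \<Omega>"
  shows "(\<lambda>x. F (U x)) \<in> L2 \<Omega>"
proof (rule L2_bound_fun)
  have "F \<in> borel_measurable borel"
    by (rule borel_measurable_continuous_onI[OF Lipschitz_continuous[OF F]])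
  then show "(\<lambda>x. F (U x)) \<in> borel_measurable (lebesgue_on \<Omega>)"
    using L2_measurable[OF U] by (rule measurable_compose[rotated])
  show "(\<lambda>x. norm (F 0) + L *\<^sub>R norm (U x)) \<in> L2 \<Omega>"
    by (intro L2_add L2_const L2_cmult L2_norm_fun U)
  fix x
  have "norm (F (U x)) \<le> norm (F 0) + norm (F (U x) - F 0)" using norm_triangle_sub by blast
  also have "\<dots> \<le> norm (F 0) + L * norm (U x)" using F(1)[of "U x" 0] by simp
  finally show "norm (F (U x)) \<le> norm (norm (F 0) + L *\<^sub>R norm (U x))" by simp
qed

lemma Lipschitz_L2_norm_diff:
  fixes F :: "'a::euclidean_space \<Rightarrow> 'b::euclidean_space"
  assumes F: "\<And>y z. norm (F y - F z) \<le> L * norm (y - z)" "L \<ge> 0"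
    and U: "U \<in> L2 \<Omega>" and V: "V \<in> L2 \<Omega>"
  shows "L2_norm \<Omega> (\<lambda>x. F (V x) - F (U x)) \<le> L * L2_norm \<Omega> (\<lambda>x. V x - U x)"
proof -
  have "L2_norm \<Omega> (\<lambda>x. F (V x) - F (U x)) \<le> L2_norm \<Omega> (\<lambda>x. L *\<^sub>R (V x - U x))"
  proof (rule L2_norm_mono)
    show "(\<lambda>x. F (V x) - F (U x)) \<in> borel_measurable (lebesgue_on \<Omega>)"
      by (rule L2_measurable[OF L2_diff[OF Lipschitz_L2[OF F V] Lipschitz_L2[OF F U]]])
    show "(\<lambda>x. L *\<^sub>R (V x - U x)) \<in> L2 \<Omega>" by (rule L2_cmult[OF L2_diff[OF V U]])
    show "norm (F (V x) - F (U x)) \<le> norm (L *\<^sub>R (V x - U x))" for x using F by simp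
  qed
  then show ?thesis using F(2) by (simp only: L2_norm_scaleR abs_of_nonneg)
qed

text \<open>Composition with an \<open>L\<close>-Lipschitz map multiplies the Dirichlet seminorm by at most \<open>L\<close>.
  For the mollified map the difference quotient estimate applies, because near the support of the
  test field its derivative is the mollified weak gradient.\<close>

theorem Lipschitz_weak_jacobian:
  fixes F :: "real^'m::finite \<Rightarrow> real^'n::finite" and U :: "real^'d \<Rightarrow> real^'m"
    and J :: "real^'d \<Rightarrow> real^'d^'m"
  assumes F: "\<And>y z. norm (F y - F z) \<le> L * norm (y - z)" "L \<ge> 0"
    and U: "\<And>k. has_weak_gradient \<Omega> (\<lambda>x. U x $ k) (\<lambda>x. J x $ k)"
  obtains G :: "real^'d \<Rightarrow> real^'d^'n" where
    "\<And>j. has_weak_gradient \<Omega> (\<lambda>x. F (U x) $ j) (\<lambda>x. G x $ j)" "G \<in> L2 \<Omega>"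
    "L2_norm \<Omega> G \<le> L * L2_norm \<Omega> J"
proof -
  have UL: "U \<in> L2 \<Omega>" and JL: "J \<in> L2 \<Omega>"
    using has_weak_gradient_L2[OF U] L2_vec_iff by blast+
  note Uk = L2_nth[OF UL] and Jki = L2_nth[OF L2_nth[OF JL]]
  obtain \<delta> and \<rho> :: "nat \<Rightarrow> real^'d \<Rightarrow> real"
    where mol: "\<And>n. mollifier (\<delta> n) (\<rho> n)" and \<delta>: "\<delta> \<longlonglongrightarrow> 0" "\<And>n. \<delta> n > 0"
    using mollifier_sequence by blast
  define V where "V n x = (\<chi> k. conv (\<rho> n) (\<lambda>x. U x $ k) x)" for n x
  define JV where "JV n x = (\<chi> k. \<chi> i. conv (\<rho> n) (\<lambda>x. J x $ k $ i) x)" for n x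
  have Vk: "(\<lambda>x. V n x $ k) = conv (\<rho> n) (\<lambda>x. U x $ k)" for n k by (simp add: V_def)
  have VCc: "(\<lambda>x. V n x $ k) \<in> Cc_infinity UNIV" for n k
    unfolding Vk
  proof (rule conv_Cc[OF mol L2_integrable[OF Uk]])
    show "compact (closure \<Omega>)" using bounded_set by (simp add: compact_closure)
  qed (use closure_subset in auto)
  have VL: "V n \<in> L2 \<Omega>" for n unfolding L2_vec_iff Vk using conv_L2(1)[OF mol Uk] by simp
  have JVL: "JV n \<in> L2 \<Omega>" for n
    unfolding L2_vec_iff JV_def using conv_L2(1)[OF mol Jki] by simp
  have JV_norm: "L2_norm \<Omega> (JV n) \<le> L2_norm \<Omega> J" for n
  proof -
    have "(L2_norm \<Omega> (JV n))\<^sup>2 = (\<Sum>k\<in>UNIV. \<Sum>i\<in>UNIV. (L2_norm \<Omega> (conv (\<rho> n) (\<lambda>x. J x $ k $ i)))\<^sup>2)"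
      unfolding L2_norm_matrix[OF JVL] by (simp add: JV_def)
    also have "\<dots> \<le> (\<Sum>k\<in>UNIV. \<Sum>i\<in>UNIV. (L2_norm \<Omega> (\<lambda>x. J x $ k $ i))\<^sup>2)"
      by (intro sum_mono power_mono conv_L2(2)[OF mol Jki] L2_norm_ge_0)
    also have "\<dots> = (L2_norm \<Omega> J)\<^sup>2"
      by (rule L2_norm_matrix[OF JL, symmetric])
    finally show ?thesis by (rule power2_le_imp_le[OF _ L2_norm_ge_0])
  qed
  have V_lim: "(\<lambda>n. L2_norm \<Omega> (\<lambda>x. V n x - U x)) \<longlonglongrightarrow> 0"
  proof (rule L2_norm_vec_tendsto_0)
    show "(\<lambda>n. L2_norm \<Omega> (\<lambda>x. (V n x - U x) $ k)) \<longlonglongrightarrow> 0" for k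
      using conv_tendsto_L2[OF mol \<delta>(1) Uk] by (simp add: V_def)
  qed (intro L2_diff VL UL)
  have FUL: "(\<lambda>x. F (U x)) \<in> L2 \<Omega>" and FVL: "(\<lambda>x. F (V n x)) \<in> L2 \<Omega>" for n
    by (rule Lipschitz_L2[OF F UL], rule Lipschitz_L2[OF F VL])
  have "(\<lambda>n. L * L2_norm \<Omega> (\<lambda>x. V n x - U x)) \<longlonglongrightarrow> 0"
    using tendsto_mult_right_zero[OF V_lim] .
  then have FV_lim: "(\<lambda>n. L2_norm \<Omega> (\<lambda>x. F (V n x) - F (U x))) \<longlonglongrightarrow> 0"
    by (rule Lim_null_comparison[rotated])
       (use Lipschitz_L2_norm_diff[OF F UL VL] in \<open>auto simp: L2_norm_ge_0\<close>)
  have FVj_lim: "(\<lambda>n. L2_norm \<Omega> (\<lambda>x. F (V n x) $ j - F (U x) $ j)) \<longlonglongrightarrow> 0" for j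
    using FV_lim
  proof (rule Lim_null_comparison[rotated])
    have "L2_norm \<Omega> (\<lambda>x. F (V n x) $ j - F (U x) $ j) \<le> L2_norm \<Omega> (\<lambda>x. F (V n x) - F (U x))" for n
    proof (rule L2_norm_mono)
      show "norm (F (V n x) $ j - F (U x) $ j) \<le> norm (F (V n x) - F (U x))" for x
        using component_le_norm_cart[of "F (V n x) - F (U x)" j] by simp
    qed (intro L2_measurable L2_diff L2_nth FVL FUL)+
    then show "\<forall>\<^sub>F n in sequentially. norm (L2_norm \<Omega> (\<lambda>x. F (V n x) $ j - F (U x) $ j))
        \<le> L2_norm \<Omega> (\<lambda>x. F (V n x) - F (U x))" by (simp add: L2_norm_ge_0)
  qed
  have contV: "continuous_on UNIV (V n)" for n
    using Cc_continuous[OF VCc] by (intro continuous_on_vec_lambda[of UNIV "\<lambda>k x. V n x $ k", simplified])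
  have contFV: "continuous_on UNIV (\<lambda>x. F (V n x))" for n
    by (rule continuous_on_compose2[OF Lipschitz_continuous[OF F] contV]) auto
  have bound: "\<bar>\<Sum>j\<in>UNIV. \<Sum>i\<in>UNIV. L2_inner \<Omega> (\<lambda>x. F (U x) $ j) (partial i (\<lambda>x. \<phi> x $ j $ i))\<bar>
      \<le> (L * L2_norm \<Omega> J) * L2_norm \<Omega> \<phi>"
    if \<phi>: "\<phi> \<in> test_fields \<Omega>" for \<phi> :: "real^'d \<Rightarrow> real^'d^'n"
  proof -
    have \<phi>c: "(\<lambda>x. \<phi> x $ j $ i) \<in> Cc_infinity \<Omega>" for j i
      by (rule test_field_component_Cc[OF test_field_row[OF \<phi>]])
    have \<phi>L: "\<phi> \<in> L2 \<Omega>" by (rule test_fields_L2[OF \<phi>])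
    have cont\<phi>: "continuous_on UNIV \<phi>"
      using Cc_continuous[OF \<phi>c]
      by (intro continuous_on_vec_lambda[of UNIV "\<lambda>j x. \<phi> x $ j", simplified]
          continuous_on_vec_lambda[of UNIV "\<lambda>i x. \<phi> x $ j $ i" for j, simplified])
    obtain C where C: "compact C" "C \<subseteq> \<Omega>" "\<And>x. x \<notin> C \<Longrightarrow> \<phi> x = 0"
      using test_fields_bounded_support[OF \<phi>] by metis
    obtain e where e: "e > 0" "(\<Union>x\<in>C. ball x e) \<subseteq> \<Omega>"
      using compact_subset_open_imp_ball_epsilon_subset[OF C(1) open_set C(2)] by metis
    have "\<forall>\<^sub>F n in sequentially. \<delta> n < e" using order_tendstoD(2)[OF \<delta>(1) e(1)] .
    then have ev: "\<forall>\<^sub>F n in sequentially.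
        \<bar>\<Sum>j\<in>UNIV. \<Sum>i\<in>UNIV. L2_inner \<Omega> (\<lambda>x. F (V n x) $ j) (partial i (\<lambda>x. \<phi> x $ j $ i))\<bar>
          \<le> (L * L2_norm \<Omega> J) * L2_norm \<Omega> \<phi>"
    proof eventually_elim
      fix n assume n: "\<delta> n < e"
      let ?g = "\<lambda>x. L * (norm (\<chi> k. gradient (\<lambda>x. V n x $ k) x) * norm (\<phi> x))"
      have cg: "continuous_on UNIV ?g"
        unfolding gradient_def
        by (intro continuous_on_mult continuous_on_const continuous_on_norm cont\<phi>
            continuous_on_vec_lambda Cc_continuous[OF Cc_partial[OF VCc]])
      have 1: "L2_inner \<Omega> (\<lambda>x. F (V n x) $ j) (partial i (\<lambda>x. \<phi> x $ j $ i))
          = (LINT x|lborel. F (V n x) $ j * partial i (\<lambda>x. \<phi> x $ j $ i) x)" for j i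
        unfolding L2_inner_def inner_real_def
      proof (rule lebesgue_on_integral_eq_lborel[OF open_set])
        show "(\<lambda>x. F (V n x) $ j * partial i (\<lambda>x. \<phi> x $ j $ i) x) \<in> borel_measurable borel"
          by (intro borel_measurable_continuous_onI continuous_on_mult continuous_on_component contFV
              Cc_continuous[OF Cc_partial[OF \<phi>c]])
      qed (simp add: Cc_outside[OF Cc_partial[OF \<phi>c]])
      have grad: "(\<chi> k. gradient (\<lambda>x. V n x $ k) x) = JV n x" if "x \<in> C" for x
      proof -
        have "cball x (\<delta> n) \<subseteq> \<Omega>" using n e(2) that by (force simp: subset_iff)
        then have "partial i (\<lambda>x. V n x $ k) x = conv (\<rho> n) (\<lambda>x. J x $ k $ i) x" for k i
          unfolding Vk using partial_conv_weak_gradient[OF mol Uk] U by (simp add: has_weak_gradient_def)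
        then show ?thesis by (simp add: gradient_def JV_def)
      qed
      have "\<bar>\<Sum>j\<in>UNIV. \<Sum>i\<in>UNIV. L2_inner \<Omega> (\<lambda>x. F (V n x) $ j) (partial i (\<lambda>x. \<phi> x $ j $ i))\<bar>
          \<le> (LINT x|lborel. ?g x)"
        unfolding 1 by (rule Lipschitz_difference_quotient_estimate[OF F VCc \<phi>])
      also have "\<dots> = (LINT x|lebesgue_on \<Omega>. ?g x)"
        using C by (intro lebesgue_on_integral_eq_lborel[OF open_set, symmetric]
            borel_measurable_continuous_onI[OF cg]) auto
      also have "\<dots> = (LINT x|lebesgue_on \<Omega>. L * (norm (JV n x) \<bullet> norm (\<phi> x)))"
      proof (rule Bochner_Integration.integral_cong[OF refl])
        fix x show "?g x = L * (norm (JV n x) \<bullet> norm (\<phi> x))"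
          using grad[of x] C(3)[of x] by (cases "x \<in> C") auto
      qed
      also have "\<dots> = L * L2_inner \<Omega> (\<lambda>x. norm (JV n x)) (\<lambda>x. norm (\<phi> x))"
        by (simp add: L2_inner_def)
      also have "\<dots> \<le> L * (L2_norm \<Omega> J * L2_norm \<Omega> \<phi>)"
      proof (rule mult_left_mono[OF _ F(2)])
        have "L2_inner \<Omega> (\<lambda>x. norm (JV n x)) (\<lambda>x. norm (\<phi> x)) \<le> L2_norm \<Omega> (JV n) * L2_norm \<Omega> \<phi>"
          using L2_inner_Cauchy_Schwarz[OF L2_norm_fun[OF JVL] L2_norm_fun[OF \<phi>L], of n]
          by (simp add: L2_norm_norm)
        also have "\<dots> \<le> L2_norm \<Omega> J * L2_norm \<Omega> \<phi>"
          by (intro mult_right_mono JV_norm L2_norm_ge_0)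
        finally show "L2_inner \<Omega> (\<lambda>x. norm (JV n x)) (\<lambda>x. norm (\<phi> x)) \<le> L2_norm \<Omega> J * L2_norm \<Omega> \<phi>" .
      qed
      finally show "\<bar>\<Sum>j\<in>UNIV. \<Sum>i\<in>UNIV. L2_inner \<Omega> (\<lambda>x. F (V n x) $ j) (partial i (\<lambda>x. \<phi> x $ j $ i))\<bar>
          \<le> (L * L2_norm \<Omega> J) * L2_norm \<Omega> \<phi>" by (simp add: mult.assoc)
    qed
    have "(\<lambda>n. \<bar>\<Sum>j\<in>UNIV. \<Sum>i\<in>UNIV. L2_inner \<Omega> (\<lambda>x. F (V n x) $ j) (partial i (\<lambda>x. \<phi> x $ j $ i))\<bar>)
        \<longlonglongrightarrow> \<bar>\<Sum>j\<in>UNIV. \<Sum>i\<in>UNIV. L2_inner \<Omega> (\<lambda>x. F (U x) $ j) (partial i (\<lambda>x. \<phi> x $ j $ i))\<bar>"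
      by (intro tendsto_rabs tendsto_sum L2_inner_tendsto_left FVj_lim L2_nth[OF FVL] L2_nth[OF FUL]
          Cc_L2[OF Cc_partial[OF \<phi>c]])
    then show ?thesis by (rule tendsto_upperbound[OF _ ev]) simp
  qed
  obtain G :: "real^'d \<Rightarrow> real^'d^'n" where
    G: "\<And>j. has_weak_gradient \<Omega> (\<lambda>x. F (U x) $ j) (\<lambda>x. G x $ j)" "G \<in> L2 \<Omega>"
    "L2_norm \<Omega> G \<le> \<bar>L * L2_norm \<Omega> J\<bar>"
    using weak_jacobian_exists[OF FUL bound] by blast
  have "\<bar>L * L2_norm \<Omega> J\<bar> = L * L2_norm \<Omega> J" using F(2) L2_norm_ge_0[of \<Omega> J] by simp
  then show thesis using that[OF G(1,2)] G(3) by simp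
qed

corollary Lipschitz_weak_gradient:
  fixes F :: "real^'m::finite \<Rightarrow> real" and U :: "real^'d \<Rightarrow> real^'m"
    and J :: "real^'d \<Rightarrow> real^'d^'m"
  assumes F: "\<And>y z. \<bar>F y - F z\<bar> \<le> L * norm (y - z)" "L \<ge> 0"
    and U: "\<And>k. has_weak_gradient \<Omega> (\<lambda>x. U x $ k) (\<lambda>x. J x $ k)"
  obtains g where "has_weak_gradient \<Omega> (\<lambda>x. F (U x)) g" "L2_norm \<Omega> g \<le> L * L2_norm \<Omega> J"
proof -
  define F1 :: "real^'m \<Rightarrow> real^1" where "F1 y = (\<chi> _. F y)" for y
  have "norm (F1 y - F1 z) \<le> L * norm (y - z)" for y z
    using F(1)[of y z] by (simp add: F1_def norm_vec_def L2_set_def)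
  then obtain G :: "real^'d \<Rightarrow> real^'d^1" where G:
    "\<And>j. has_weak_gradient \<Omega> (\<lambda>x. F1 (U x) $ j) (\<lambda>x. G x $ j)" "G \<in> L2 \<Omega>"
    "L2_norm \<Omega> G \<le> L * L2_norm \<Omega> J"
    using Lipschitz_weak_jacobian[OF _ F(2) U] by blast
  have "has_weak_gradient \<Omega> (\<lambda>x. F (U x)) (\<lambda>x. G x $ 1)" using G(1)[of 1] by (simp add: F1_def)
  moreover have "(L2_norm \<Omega> (\<lambda>x. G x $ 1))\<^sup>2 = (L2_norm \<Omega> G)\<^sup>2" by (simp add: L2_norm_vec[OF G(2)])
  then have "L2_norm \<Omega> (\<lambda>x. G x $ 1) = L2_norm \<Omega> G" by (simp add: power2_eq_iff_nonneg L2_norm_ge_0)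
  ultimately show thesis using that G(3) by simp
qed

end

section \<open>Functions with zero boundary values\<close>

context bounded_open_set
begin

lemma H1_0_H1: "f \<in> H1_0 \<Omega> \<Longrightarrow> f \<in> H1 \<Omega>"
  by (simp add: H1_0_def)

lemma H1_L2: "f \<in> H1 \<Omega> \<Longrightarrow> f \<in> L2 \<Omega>" "f \<in> H1 \<Omega> \<Longrightarrow> weak_grad \<Omega> f \<in> L2 \<Omega>"
  using H1_weak_grad has_weak_gradient_L2 by blast+

lemma gradient_L2: "\<phi> \<in> Cc_infinity \<Omega> \<Longrightarrow> gradient \<phi> \<in> L2 \<Omega>"
  by (intro test_fields_L2 gradient_test_field)

lemma H1_norm_diff_Cc:
  assumes "f \<in> H1 \<Omega>" "\<phi> \<in> Cc_infinity \<Omega>"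
  shows "H1_norm \<Omega> (\<lambda>x. f x - \<phi> x)
    = L2_norm \<Omega> (\<lambda>x. (\<phi> x, gradient \<phi> x) - (f x, weak_grad \<Omega> f x))"
proof -
  note wg = has_weak_gradient_diff[OF H1_weak_grad[OF assms(1)] has_weak_gradient_Cc[OF assms(2)]]
  note L = H1_L2[OF assms(1)] Cc_L2[OF assms(2)] gradient_L2[OF assms(2)]
  have "(H1_norm \<Omega> (\<lambda>x. f x - \<phi> x))\<^sup>2
      = (L2_norm \<Omega> (\<lambda>x. f x - \<phi> x))\<^sup>2 + (L2_norm \<Omega> (weak_grad \<Omega> (\<lambda>x. f x - \<phi> x)))\<^sup>2"
    unfolding H1_norm_def L2_norm_square_integral by (simp add: integral_nonneg_AE)
  also have "\<dots> = (L2_norm \<Omega> (\<lambda>x. \<phi> x - f x))\<^sup>2 + (L2_norm \<Omega> (\<lambda>x. gradient \<phi> x - weak_grad \<Omega> f x))\<^sup>2"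
    by (simp add: L2_norm_weak_grad[OF wg] L2_norm_minus_commute[of \<Omega> f \<phi>]
        L2_norm_minus_commute[of \<Omega> "weak_grad \<Omega> f" "gradient \<phi>"])
  also have "\<dots> = (L2_norm \<Omega> (\<lambda>x. (\<phi> x - f x, gradient \<phi> x - weak_grad \<Omega> f x)))\<^sup>2"
    by (rule L2_norm_Pair[symmetric]) (intro L2_diff L)+
  finally have "(H1_norm \<Omega> (\<lambda>x. f x - \<phi> x))\<^sup>2
      = (L2_norm \<Omega> (\<lambda>x. (\<phi> x, gradient \<phi> x) - (f x, weak_grad \<Omega> f x)))\<^sup>2" by simp
  then show ?thesis
    by (rule power2_eq_imp_eq) (simp_all add: L2_norm_ge_0 H1_norm_def integral_nonneg_AE)
qed

lemma gradient_add:
  assumes "\<phi> \<in> Cc_infinity S" "\<psi> \<in> Cc_infinity S"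
  shows "gradient (\<lambda>x. \<phi> x + \<psi> x) = (\<lambda>x. gradient \<phi> x + gradient \<psi> x)"
  by (simp add: gradient_def fun_eq_iff vec_eq_iff partial_add Cc_differentiable[OF assms(1)]
      Cc_differentiable[OF assms(2)])

lemma gradient_cmult:
  assumes "\<phi> \<in> Cc_infinity S"
  shows "gradient (\<lambda>x. c * \<phi> x) = (\<lambda>x. c *\<^sub>R gradient \<phi> x)"
  by (simp add: gradient_def fun_eq_iff vec_eq_iff partial_mult Cc_differentiable[OF assms]
      partial_eq[OF has_derivative_const])

lemma L2_norm_Pair_ge:
  assumes "f \<in> L2 \<Omega>" "g \<in> L2 \<Omega>"
  shows "L2_norm \<Omega> f \<le> L2_norm \<Omega> (\<lambda>x. (f x, g x))" "L2_norm \<Omega> g \<le> L2_norm \<Omega> (\<lambda>x. (f x, g x))"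
  using L2_norm_Pair[OF assms]
  by (auto intro!: power2_le_imp_le[OF _ L2_norm_ge_0])

lemma L2_norm_tendsto_0_bound:
  assumes "\<And>n. L2_norm \<Omega> (f n) \<le> b n" "b \<longlonglongrightarrow> 0"
  shows "(\<lambda>n. L2_norm \<Omega> (f n)) \<longlonglongrightarrow> 0"
  by (rule Lim_null_comparison[OF always_eventually assms(2)]) (simp add: assms(1) L2_norm_ge_0)

lemma H1_0_approximation:
  assumes "f \<in> H1_0 \<Omega>" "e > 0"
  obtains \<phi> where "\<phi> \<in> Cc_infinity \<Omega>" "L2_norm \<Omega> (\<lambda>x. \<phi> x - f x) < e"
    "L2_norm \<Omega> (\<lambda>x. gradient \<phi> x - weak_grad \<Omega> f x) < e"
proof -
  have f: "f \<in> H1 \<Omega>" using assms(1) by (rule H1_0_H1)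
  obtain \<phi> where \<phi>: "\<phi> \<in> Cc_infinity \<Omega>" "H1_norm \<Omega> (\<lambda>x. f x - \<phi> x) < e"
    using assms by (auto simp: H1_0_def)
  then show thesis
    using that[OF \<phi>(1)] L2_norm_Pair_ge[OF L2_diff[OF Cc_L2[OF \<phi>(1)] H1_L2(1)[OF f]]
        L2_diff[OF gradient_L2[OF \<phi>(1)] H1_L2(2)[OF f]]]
      H1_norm_diff_Cc[OF f \<phi>(1)] by simp
qed

text \<open>Strong convergence of the gradients is not needed for zero boundary values: if test
  functions converge in \<open>L\<^sup>2\<close> and their gradients are bounded, the gradients converge weakly, and
  the weak limit of the pairs is a strong limit of other such pairs.\<close>

theorem H1_0I_test_functions:
  assumes f: "f \<in> H1 \<Omega>" and \<phi>: "\<And>n::nat. \<phi> n \<in> Cc_infinity \<Omega>"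
    and lim: "(\<lambda>n. L2_norm \<Omega> (\<lambda>x. \<phi> n x - f x)) \<longlonglongrightarrow> 0"
    and bound: "\<And>n. L2_norm \<Omega> (gradient (\<phi> n)) \<le> B"
  shows "f \<in> H1_0 \<Omega>"
proof -
  note L = H1_L2[OF f] and wg = H1_weak_grad[OF f]
  define V :: "(real^'d \<Rightarrow> real \<times> (real^'d)) set" where
    "V = {\<lambda>x. (\<psi> x, gradient \<psi> x) | \<psi>. \<psi> \<in> Cc_infinity \<Omega>}"
  obtain B0 where B0: "\<And>n. L2_norm \<Omega> (\<phi> n) \<le> B0"
  proof -
    have "(\<lambda>n. L2_norm \<Omega> (\<phi> n)) \<longlonglongrightarrow> L2_norm \<Omega> f"
      by (rule L2_norm_tendsto[OF Cc_L2[OF \<phi>] L(1) lim])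
    then have "Bseq (\<lambda>n. L2_norm \<Omega> (\<phi> n))" by (rule convergent_imp_Bseq[OF convergentI])
    then show thesis using that unfolding Bseq_def by (metis abs_le_D1 real_norm_def)
  qed
  obtain w where w: "\<And>n::nat. w n \<in> V"
    "(\<lambda>n. L2_norm \<Omega> (\<lambda>x. w n x - (f x, weak_grad \<Omega> f x))) \<longlonglongrightarrow> 0"
  proof (rule weak_closure_L2[of V "\<lambda>n x. (\<phi> n x, gradient (\<phi> n) x)" "sqrt (B0\<^sup>2 + B\<^sup>2)"
        "\<lambda>x. (f x, weak_grad \<Omega> f x)"])
    show "V \<subseteq> L2 \<Omega>" by (auto simp: V_def intro: L2_Pair Cc_L2 gradient_L2)
    show "(\<lambda>x. p x + q x) \<in> V" if pq: "p \<in> V" "q \<in> V" for p q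
    proof -
      obtain \<psi> \<xi> where "\<psi> \<in> Cc_infinity \<Omega>" "p = (\<lambda>x. (\<psi> x, gradient \<psi> x))"
        "\<xi> \<in> Cc_infinity \<Omega>" "q = (\<lambda>x. (\<xi> x, gradient \<xi> x))" using pq by (auto simp: V_def)
      then show ?thesis
        unfolding V_def by (auto simp: gradient_add intro!: exI[of _ "\<lambda>x. \<psi> x + \<xi> x"] Cc_add)
    qed
    show "(\<lambda>x. c *\<^sub>R p x) \<in> V" if p: "p \<in> V" for c p
    proof -
      obtain \<psi> where "\<psi> \<in> Cc_infinity \<Omega>" "p = (\<lambda>x. (\<psi> x, gradient \<psi> x))"
        using p by (auto simp: V_def)
      then show ?thesis
        unfolding V_def by (auto simp: gradient_cmult intro!: exI[of _ "\<lambda>x. c * \<psi> x"] Cc_cmult)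
    qed
    show "(\<lambda>x. (\<phi> n x, gradient (\<phi> n) x)) \<in> V" for n using \<phi> by (auto simp: V_def)
    show "L2_norm \<Omega> (\<lambda>x. (\<phi> n x, gradient (\<phi> n) x)) \<le> sqrt (B0\<^sup>2 + B\<^sup>2)" for n
      using L2_norm_Pair[OF Cc_L2[OF \<phi>] gradient_L2[OF \<phi>], of n]
        power_mono[OF B0[of n] L2_norm_ge_0, of 2] power_mono[OF bound[of n] L2_norm_ge_0, of 2]
      by (intro real_le_rsqrt) simp
    show "(\<lambda>x. (f x, weak_grad \<Omega> f x)) \<in> L2 \<Omega>" by (rule L2_Pair[OF L])
    fix \<Phi> :: "real^'d \<Rightarrow> real \<times> (real^'d)" assume \<Phi>: "\<Phi> \<in> test_fields \<Omega>"
    define p q where "p x = fst (\<Phi> x)" and "q x = snd (\<Phi> x)" for x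
    have \<Phi>_eq: "\<Phi> = (\<lambda>x. (p x, q x))" by (simp add: p_def q_def)
    have comp: "(\<lambda>x. \<Phi> x \<bullet> (u, v)) \<in> Cc_infinity \<Omega>" if "(u, v) \<in> Basis" for u v
      using \<Phi> that by (auto simp: test_fields_def)
    have "(1::real, 0::real^'d) \<in> Basis" by (simp add: Basis_prod_def)
    from comp[OF this] have p: "p \<in> Cc_infinity \<Omega>" by (simp add: p_def[abs_def] inner_Pair_0)
    have "(0::real, axis i (1::real)) \<in> Basis" for i :: 'd by (simp add: Basis_prod_def axis_in_Basis_iff)
    from comp[OF this] have qi: "(\<lambda>x. q x $ i) \<in> Cc_infinity \<Omega>" for i
      by (simp add: q_def inner_Pair_0 inner_axis)
    then have qL: "q \<in> L2 \<Omega>" using L2_vec_iff Cc_L2 by blast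
    have grad: "L2_inner \<Omega> g q = - (\<Sum>i\<in>UNIV. L2_inner \<Omega> h (partial i (\<lambda>x. q x $ i)))"
      if "has_weak_gradient \<Omega> h g" for h g
      using has_weak_gradientD[OF that qi] has_weak_gradient_L2(2)[OF that]
      by (simp add: L2_inner_vec qL sum_negf)
    have "(\<lambda>n. L2_inner \<Omega> (\<phi> n) p + - (\<Sum>i\<in>UNIV. L2_inner \<Omega> (\<phi> n) (partial i (\<lambda>x. q x $ i))))
        \<longlonglongrightarrow> L2_inner \<Omega> f p + - (\<Sum>i\<in>UNIV. L2_inner \<Omega> f (partial i (\<lambda>x. q x $ i)))"
      by (intro tendsto_add tendsto_minus tendsto_sum L2_inner_tendsto_left Cc_L2[OF \<phi>] L(1) lim
          Cc_L2[OF p] Cc_L2[OF Cc_partial[OF qi]])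
    then show "(\<lambda>n. L2_inner \<Omega> (\<lambda>x. (\<phi> n x, gradient (\<phi> n) x)) \<Phi>)
        \<longlonglongrightarrow> L2_inner \<Omega> (\<lambda>x. (f x, weak_grad \<Omega> f x)) \<Phi>"
      unfolding \<Phi>_eq L2_inner_Pair[OF Cc_L2[OF \<phi>] gradient_L2[OF \<phi>] Cc_L2[OF p] qL]
        L2_inner_Pair[OF L Cc_L2[OF p] qL] grad[OF has_weak_gradient_Cc[OF \<phi>]] grad[OF wg] .
  qed blast
  have "\<exists>\<psi>\<in>Cc_infinity \<Omega>. H1_norm \<Omega> (\<lambda>x. f x - \<psi> x) < e" if e: "e > 0" for e
  proof -
    obtain n where n: "L2_norm \<Omega> (\<lambda>x. w n x - (f x, weak_grad \<Omega> f x)) < e"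
      using order_tendstoD(2)[OF w(2) e] by (auto simp: eventually_sequentially)
    obtain \<psi> where "\<psi> \<in> Cc_infinity \<Omega>" "w n = (\<lambda>x. (\<psi> x, gradient \<psi> x))"
      using w(1)[of n] by (auto simp: V_def)
    then show ?thesis using n H1_norm_diff_Cc[OF f, of \<psi>] by (intro bexI[of _ \<psi>]) simp_all
  qed
  then show ?thesis using f by (simp add: H1_0_def)
qed

theorem H1_0_closed:
  assumes f: "f \<in> H1 \<Omega>" and fn: "\<And>n::nat. fn n \<in> H1_0 \<Omega>"
    and lim: "(\<lambda>n. L2_norm \<Omega> (\<lambda>x. fn n x - f x)) \<longlonglongrightarrow> 0"
    and bound: "\<And>n. L2_norm \<Omega> (weak_grad \<Omega> (fn n)) \<le> B"
  shows "f \<in> H1_0 \<Omega>"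
proof -
  have "\<forall>n. \<exists>\<phi>. \<phi> \<in> Cc_infinity \<Omega> \<and> L2_norm \<Omega> (\<lambda>x. \<phi> x - fn n x) < inverse (real (Suc n))
      \<and> L2_norm \<Omega> (\<lambda>x. gradient \<phi> x - weak_grad \<Omega> (fn n) x) < inverse (real (Suc n))"
    using H1_0_approximation[OF fn] by (metis inverse_positive_iff_positive of_nat_0_less_iff zero_less_Suc)
  then obtain \<phi> where \<phi>: "\<And>n. \<phi> n \<in> Cc_infinity \<Omega>"
    "\<And>n. L2_norm \<Omega> (\<lambda>x. \<phi> n x - fn n x) < inverse (real (Suc n))"
    "\<And>n. L2_norm \<Omega> (\<lambda>x. gradient (\<phi> n) x - weak_grad \<Omega> (fn n) x) < inverse (real (Suc n))" by metis
  note L = H1_L2[OF H1_0_H1[OF fn]]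
  show ?thesis
  proof (rule H1_0I_test_functions[OF f \<phi>(1)])
    have "L2_norm \<Omega> (\<lambda>x. \<phi> n x - f x) \<le> inverse (real (Suc n)) + L2_norm \<Omega> (\<lambda>x. fn n x - f x)" for n
      using L2_norm_triangle_diff[OF Cc_L2[OF \<phi>(1)] L(1) H1_L2(1)[OF f], of n n] \<phi>(2)[of n] by simp
    moreover have "(\<lambda>n. inverse (real (Suc n)) + L2_norm \<Omega> (\<lambda>x. fn n x - f x)) \<longlonglongrightarrow> 0"
      using tendsto_add[OF LIMSEQ_inverse_real_of_nat lim] by simp
    ultimately show "(\<lambda>n. L2_norm \<Omega> (\<lambda>x. \<phi> n x - f x)) \<longlonglongrightarrow> 0"
      by (rule L2_norm_tendsto_0_bound)
    show "L2_norm \<Omega> (gradient (\<phi> n)) \<le> B + 1" for n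
    proof -
      have "inverse (real (Suc n)) \<le> 1" by (simp add: field_simps)
      then show ?thesis
        using L2_norm_diff_le[OF gradient_L2[OF \<phi>(1)] L(2), of n n] \<phi>(3)[of n] bound[of n] by linarith
    qed
  qed
qed

lemma H1_cmult: "f \<in> H1 \<Omega> \<Longrightarrow> (\<lambda>x. c * f x) \<in> H1 \<Omega>"
  using has_weak_gradient_cmult H1_iff by blast

lemma H1_add: "f \<in> H1 \<Omega> \<Longrightarrow> g \<in> H1 \<Omega> \<Longrightarrow> (\<lambda>x. f x + g x) \<in> H1 \<Omega>"
  using has_weak_gradient_add H1_iff by blast

lemma H1_0_sequence:
  assumes "f \<in> H1_0 \<Omega>"
  obtains \<phi> where "\<And>n::nat. \<phi> n \<in> Cc_infinity \<Omega>" "(\<lambda>n. L2_norm \<Omega> (\<lambda>x. \<phi> n x - f x)) \<longlonglongrightarrow> 0"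
    "(\<lambda>n. L2_norm \<Omega> (\<lambda>x. gradient (\<phi> n) x - weak_grad \<Omega> f x)) \<longlonglongrightarrow> 0"
    "\<And>n. L2_norm \<Omega> (gradient (\<phi> n)) \<le> L2_norm \<Omega> (weak_grad \<Omega> f) + 1"
proof -
  have "\<forall>n. \<exists>\<phi>. \<phi> \<in> Cc_infinity \<Omega> \<and> L2_norm \<Omega> (\<lambda>x. \<phi> x - f x) < inverse (real (Suc n))
      \<and> L2_norm \<Omega> (\<lambda>x. gradient \<phi> x - weak_grad \<Omega> f x) < inverse (real (Suc n))"
    using H1_0_approximation[OF assms] by (metis inverse_positive_iff_positive of_nat_0_less_iff zero_less_Suc)
  then obtain \<phi> where \<phi>: "\<And>n. \<phi> n \<in> Cc_infinity \<Omega>"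
    "\<And>n. L2_norm \<Omega> (\<lambda>x. \<phi> n x - f x) < inverse (real (Suc n))"
    "\<And>n. L2_norm \<Omega> (\<lambda>x. gradient (\<phi> n) x - weak_grad \<Omega> f x) < inverse (real (Suc n))" by metis
  show thesis
  proof (rule that[of \<phi>])
    show "(\<lambda>n. L2_norm \<Omega> (\<lambda>x. \<phi> n x - f x)) \<longlonglongrightarrow> 0"
      using less_imp_le[OF \<phi>(2)] LIMSEQ_inverse_real_of_nat by (rule L2_norm_tendsto_0_bound)
    show "(\<lambda>n. L2_norm \<Omega> (\<lambda>x. gradient (\<phi> n) x - weak_grad \<Omega> f x)) \<longlonglongrightarrow> 0"
      using less_imp_le[OF \<phi>(3)] LIMSEQ_inverse_real_of_nat by (rule L2_norm_tendsto_0_bound)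
    show "L2_norm \<Omega> (gradient (\<phi> n)) \<le> L2_norm \<Omega> (weak_grad \<Omega> f) + 1" for n
    proof -
      have "inverse (real (Suc n)) \<le> 1" by (simp add: field_simps)
      then show ?thesis
        using L2_norm_diff_le[OF gradient_L2[OF \<phi>(1)] H1_L2(2)[OF H1_0_H1[OF assms]], of n] \<phi>(3)[of n]
        by linarith
    qed
  qed (rule \<phi>(1))
qed

lemma H1_0_add:
  assumes "f \<in> H1_0 \<Omega>" "g \<in> H1_0 \<Omega>"
  shows "(\<lambda>x. f x + g x) \<in> H1_0 \<Omega>"
proof -
  obtain \<phi> where \<phi>: "\<And>n::nat. \<phi> n \<in> Cc_infinity \<Omega>" "(\<lambda>n. L2_norm \<Omega> (\<lambda>x. \<phi> n x - f x)) \<longlonglongrightarrow> 0"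
    "\<And>n. L2_norm \<Omega> (gradient (\<phi> n)) \<le> L2_norm \<Omega> (weak_grad \<Omega> f) + 1"
    by (rule H1_0_sequence[OF assms(1)], rule that)
  obtain \<psi> where \<psi>: "\<And>n::nat. \<psi> n \<in> Cc_infinity \<Omega>" "(\<lambda>n. L2_norm \<Omega> (\<lambda>x. \<psi> n x - g x)) \<longlonglongrightarrow> 0"
    "\<And>n. L2_norm \<Omega> (gradient (\<psi> n)) \<le> L2_norm \<Omega> (weak_grad \<Omega> g) + 1"
    by (rule H1_0_sequence[OF assms(2)], rule that)
  note f = H1_0_H1[OF assms(1)] and g = H1_0_H1[OF assms(2)]
  show ?thesis
  proof (rule H1_0I_test_functions[OF H1_add[OF f g] Cc_add[OF \<phi>(1) \<psi>(1)]])
    have "L2_norm \<Omega> (\<lambda>x. (\<phi> n x + \<psi> n x) - (f x + g x))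
        \<le> L2_norm \<Omega> (\<lambda>x. \<phi> n x - f x) + L2_norm \<Omega> (\<lambda>x. \<psi> n x - g x)" for n
      using L2_norm_triangle[OF L2_diff[OF Cc_L2[OF \<phi>(1)[of n]] H1_L2(1)[OF f]]
          L2_diff[OF Cc_L2[OF \<psi>(1)[of n]] H1_L2(1)[OF g]]] by (simp add: algebra_simps)
    moreover have "(\<lambda>n. L2_norm \<Omega> (\<lambda>x. \<phi> n x - f x) + L2_norm \<Omega> (\<lambda>x. \<psi> n x - g x)) \<longlonglongrightarrow> 0"
      using tendsto_add[OF \<phi>(2) \<psi>(2)] by simp
    ultimately show "(\<lambda>n. L2_norm \<Omega> (\<lambda>x. (\<phi> n x + \<psi> n x) - (f x + g x))) \<longlonglongrightarrow> 0"
      by (rule L2_norm_tendsto_0_bound)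
    show "L2_norm \<Omega> (gradient (\<lambda>x. \<phi> n x + \<psi> n x))
        \<le> (L2_norm \<Omega> (weak_grad \<Omega> f) + 1) + (L2_norm \<Omega> (weak_grad \<Omega> g) + 1)" for n
      unfolding gradient_add[OF \<phi>(1) \<psi>(1)]
      using L2_norm_triangle[OF gradient_L2[OF \<phi>(1)[of n]] gradient_L2[OF \<psi>(1)[of n]]] \<phi>(3)[of n] \<psi>(3)[of n]
      by linarith
  qed
qed

lemma H1_0_cmult:
  assumes "f \<in> H1_0 \<Omega>"
  shows "(\<lambda>x. c * f x) \<in> H1_0 \<Omega>"
proof -
  obtain \<phi> where \<phi>: "\<And>n::nat. \<phi> n \<in> Cc_infinity \<Omega>" "(\<lambda>n. L2_norm \<Omega> (\<lambda>x. \<phi> n x - f x)) \<longlonglongrightarrow> 0"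
    "\<And>n. L2_norm \<Omega> (gradient (\<phi> n)) \<le> L2_norm \<Omega> (weak_grad \<Omega> f) + 1"
    by (rule H1_0_sequence[OF assms], rule that)
  show ?thesis
  proof (rule H1_0I_test_functions[OF H1_cmult[OF H1_0_H1[OF assms]] Cc_cmult[OF \<phi>(1)]])
    have "L2_norm \<Omega> (\<lambda>x. c * \<phi> n x - c * f x) = \<bar>c\<bar> * L2_norm \<Omega> (\<lambda>x. \<phi> n x - f x)" for n
      using L2_norm_scaleR[of \<Omega> c "\<lambda>x. \<phi> n x - f x"] by (simp add: right_diff_distrib)
    then show "(\<lambda>n. L2_norm \<Omega> (\<lambda>x. c * \<phi> n x - c * f x)) \<longlonglongrightarrow> 0"
      using tendsto_mult_right_zero[OF \<phi>(2)] by simp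
    show "L2_norm \<Omega> (gradient (\<lambda>x. c * \<phi> n x)) \<le> \<bar>c\<bar> * (L2_norm \<Omega> (weak_grad \<Omega> f) + 1)" for n
      unfolding gradient_cmult[OF \<phi>(1)] L2_norm_scaleR by (intro mult_left_mono \<phi>(3)) simp
  qed
qed

lemma H1_0_diff: "f \<in> H1_0 \<Omega> \<Longrightarrow> g \<in> H1_0 \<Omega> \<Longrightarrow> (\<lambda>x. f x - g x) \<in> H1_0 \<Omega>"
  using H1_0_add[OF _ H1_0_cmult[of g "-1"]] by simp

lemma H1_0_sum:
  "(\<And>i. i \<in> I \<Longrightarrow> f i \<in> H1_0 \<Omega>) \<Longrightarrow> finite I \<Longrightarrow> I \<noteq> {} \<Longrightarrow> (\<lambda>x. \<Sum>i\<in>I. f i x) \<in> H1_0 \<Omega>"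
proof (induction I rule: infinite_finite_induct)
  case (insert i I)
  then show ?case by (cases "I = {}") (auto intro: H1_0_add)
qed auto

lemma H1_0_cong:
  assumes "\<And>x. x \<in> \<Omega> \<Longrightarrow> f x = f' x" "f \<in> H1_0 \<Omega>"
  shows "f' \<in> H1_0 \<Omega>"
proof -
  obtain \<phi> where \<phi>: "\<And>n::nat. \<phi> n \<in> Cc_infinity \<Omega>" "(\<lambda>n. L2_norm \<Omega> (\<lambda>x. \<phi> n x - f x)) \<longlonglongrightarrow> 0"
    "\<And>n. L2_norm \<Omega> (gradient (\<phi> n)) \<le> L2_norm \<Omega> (weak_grad \<Omega> f) + 1"
    by (rule H1_0_sequence[OF assms(2)], rule that)
  have "f' \<in> H1 \<Omega>"
    using has_weak_gradient_cong[OF assms(1) H1_weak_grad[OF H1_0_H1[OF assms(2)]]] H1_iff[of f'] by blast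
  moreover have "L2_norm \<Omega> (\<lambda>x. \<phi> n x - f' x) = L2_norm \<Omega> (\<lambda>x. \<phi> n x - f x)" for n
    by (rule L2_norm_cong) (simp add: assms(1))
  ultimately show ?thesis using H1_0I_test_functions[OF _ \<phi>(1) _ \<phi>(3)] \<phi>(2) by simp
qed

text \<open>The mollified functions are test functions with bounded gradients.\<close>

lemma H1_0_compact_support:
  assumes f: "f \<in> H1 \<Omega>" and C: "compact C" "C \<subseteq> \<Omega>" "\<And>x. x \<in> \<Omega> \<Longrightarrow> x \<notin> C \<Longrightarrow> f x = 0"
  shows "f \<in> H1_0 \<Omega>"
proof -
  note L = H1_L2[OF f] and wg = H1_weak_grad[OF f]
  let ?g = "weak_grad \<Omega> f"
  obtain e where e: "e > 0" "(\<Union>x\<in>C. ball x e) \<subseteq> \<Omega>"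
    using compact_subset_open_imp_ball_epsilon_subset[OF C(1) open_set C(2)] by metis
  obtain \<delta>' and \<rho>' :: "nat \<Rightarrow> real^'d \<Rightarrow> real"
    where mol': "\<And>n. mollifier (\<delta>' n) (\<rho>' n)" and \<delta>': "\<delta>' \<longlonglongrightarrow> 0" "\<And>n. \<delta>' n > 0"
    by (rule mollifier_sequence, rule that)
  obtain N where N: "\<And>n. n \<ge> N \<Longrightarrow> \<delta>' n < e / 2"
    using order_tendstoD(2)[OF \<delta>'(1), of "e / 2"] e(1) by (auto simp: eventually_sequentially)
  define \<delta> where "\<delta> n = \<delta>' (n + N)" for n
  define \<rho> where "\<rho> n = \<rho>' (n + N)" for n
  have mol: "mollifier (\<delta> n) (\<rho> n)" and small: "\<delta> n < e / 2" and pos: "\<delta> n > 0" for n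
    using mol' N \<delta>'(2) by (auto simp: \<delta>_def \<rho>_def)
  have \<delta>: "\<delta> \<longlonglongrightarrow> 0" unfolding \<delta>_def by (rule LIMSEQ_ignore_initial_segment[OF \<delta>'(1)])
  have fi: "integrable (lebesgue_on \<Omega>) f" by (rule L2_integrable[OF L(1)])
  have sup: "f y \<noteq> 0 \<Longrightarrow> y \<in> C" if "y \<in> \<Omega>" for y using C(3) that by blast
  show ?thesis
  proof (rule H1_0I_test_functions[OF f])
    show "conv (\<rho> n) f \<in> Cc_infinity \<Omega>" for n
    proof (rule conv_Cc[OF mol fi C(1) sup])
      fix x y assume "y \<in> C" "dist x y \<le> \<delta> n"
      then have "x \<in> ball y e" using small[of n] e(1) by (simp add: dist_commute)
      then show "x \<in> \<Omega>" using e(2) \<open>y \<in> C\<close> by blast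
    qed
    then have gL: "gradient (conv (\<rho> n) f) \<in> L2 \<Omega>" for n by (rule gradient_L2)
    show "(\<lambda>n. L2_norm \<Omega> (\<lambda>x. conv (\<rho> n) f x - f x)) \<longlonglongrightarrow> 0"
      by (rule conv_tendsto_L2[OF mol \<delta> L(1)])
    show "L2_norm \<Omega> (gradient (conv (\<rho> n) f)) \<le> L2_norm \<Omega> ?g" for n
    proof (rule power2_le_imp_le[OF _ L2_norm_ge_0])
      have le: "\<bar>partial i (conv (\<rho> n) f) x\<bar> \<le> \<bar>conv (\<rho> n) (\<lambda>y. ?g y $ i) x\<bar>" if x: "x \<in> \<Omega>" for i x
      proof (cases "\<exists>y\<in>C. dist y x \<le> \<delta> n")
        case True
        then obtain y where y: "y \<in> C" "dist y x \<le> \<delta> n" by blast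
        have "cball x (\<delta> n) \<subseteq> ball y e"
        proof
          fix z assume "z \<in> cball x (\<delta> n)"
          then have "dist y z < e" using y(2) small[of n] dist_triangle[of y z x] by simp
          then show "z \<in> ball y e" by simp
        qed
        then have sub: "cball x (\<delta> n) \<subseteq> \<Omega>" using e(2) y(1) by blast
        have "is_weak_gradient \<Omega> f ?g" using wg by (simp add: has_weak_gradient_def)
        from partial_conv_weak_gradient[OF mol L(1) this sub, of i] show ?thesis by simp
      next
        case False
        have "conv (\<rho> n) f \<in> Cc_infinity {z. \<exists>y\<in>C. dist y z \<le> \<delta> n}"
          by (rule conv_Cc[OF mol fi C(1) sup]) (auto simp: dist_commute)
        then have "partial i (conv (\<rho> n) f) x = 0"
          using False by (intro Cc_outside[OF Cc_partial]) auto
        then show ?thesis by simp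
      qed
      have "L2_norm \<Omega> (\<lambda>x. gradient (conv (\<rho> n) f) x $ i) \<le> L2_norm \<Omega> (\<lambda>x. ?g x $ i)" for i
      proof -
        have c: "conv (\<rho> n) (\<lambda>y. ?g y $ i) \<in> L2 \<Omega>" by (rule conv_L2(1)[OF mol L2_nth[OF L(2)]])
        have "L2_norm \<Omega> (\<lambda>x. gradient (conv (\<rho> n) f) x $ i) \<le> L2_norm \<Omega> (conv (\<rho> n) (\<lambda>y. ?g y $ i))"
          by (rule L2_norm_mono[OF L2_measurable[OF L2_nth[OF gL]] c]) (use le in \<open>simp add: gradient_def\<close>)
        then show ?thesis using conv_L2(2)[OF mol L2_nth[OF L(2)], of n i] by linarith
      qed
      then show "(L2_norm \<Omega> (gradient (conv (\<rho> n) f)))\<^sup>2 \<le> (L2_norm \<Omega> ?g)\<^sup>2"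
        unfolding L2_norm_vec[OF gL] L2_norm_vec[OF L(2)] by (intro sum_mono power_mono L2_norm_ge_0)
    qed
  qed
qed

text \<open>Domination by a function with zero boundary values: for test functions \<open>h\<^sub>n\<close> tending to \<open>h\<close>,
  the functions \<open>min g \<bar>h\<^sub>n\<bar>\<close> have compact support, bounded gradients, and tend to \<open>g\<close>.\<close>

theorem H1_0_sandwich:
  assumes g: "g \<in> H1 \<Omega>" and h: "h \<in> H1_0 \<Omega>" and le: "\<And>x. x \<in> \<Omega> \<Longrightarrow> 0 \<le> g x \<and> g x \<le> h x"
  shows "g \<in> H1_0 \<Omega>"
proof -
  obtain \<phi> where \<phi>: "\<And>n::nat. \<phi> n \<in> Cc_infinity \<Omega>" "(\<lambda>n. L2_norm \<Omega> (\<lambda>x. \<phi> n x - h x)) \<longlonglongrightarrow> 0"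
    "\<And>n. L2_norm \<Omega> (gradient (\<phi> n)) \<le> L2_norm \<Omega> (weak_grad \<Omega> h) + 1"
    by (rule H1_0_sequence[OF h], rule that)
  define F :: "real^bool \<Rightarrow> real" where "F y = min (y $ True) \<bar>y $ False\<bar>" for y
  have F: "\<bar>F y - F z\<bar> \<le> 1 * norm (y - z)" for y z
  proof -
    have "\<bar>y $ b - z $ b\<bar> \<le> norm (y - z)" for b
      using component_le_norm_cart[of "y - z" b] by simp
    from this[of True] this[of False] show ?thesis
      unfolding F_def by (auto simp: min_def abs_if split: if_splits)
  qed
  define k where "k n x = min (g x) \<bar>\<phi> n x\<bar>" for n x
  note gw = H1_weak_grad[OF g]
  have kw: "\<exists>w. has_weak_gradient \<Omega> (k n) w
      \<and> L2_norm \<Omega> w \<le> L2_norm \<Omega> (weak_grad \<Omega> g) + (L2_norm \<Omega> (weak_grad \<Omega> h) + 1)" for n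
  proof -
    define U :: "real^'d \<Rightarrow> real^bool" where "U x = (\<chi> b. if b then g x else \<phi> n x)" for x
    define J :: "real^'d \<Rightarrow> real^'d^bool" where
      "J x = (\<chi> b. if b then weak_grad \<Omega> g x else gradient (\<phi> n) x)" for x
    have U: "has_weak_gradient \<Omega> (\<lambda>x. U x $ b) (\<lambda>x. J x $ b)" for b
      using gw has_weak_gradient_Cc[OF \<phi>(1)[of n]] by (cases b) (simp_all add: U_def J_def)
    have JL: "J \<in> L2 \<Omega>" using has_weak_gradient_L2(2)[OF U] L2_vec_iff by blast
    obtain w where w: "has_weak_gradient \<Omega> (\<lambda>x. F (U x)) w" "L2_norm \<Omega> w \<le> 1 * L2_norm \<Omega> J"
      using Lipschitz_weak_gradient[OF F _ U] by auto
    have "(L2_norm \<Omega> J)\<^sup>2 = (L2_norm \<Omega> (weak_grad \<Omega> g))\<^sup>2 + (L2_norm \<Omega> (gradient (\<phi> n)))\<^sup>2"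
      unfolding L2_norm_vec[OF JL] by (simp add: UNIV_bool J_def)
    also have "\<dots> \<le> (L2_norm \<Omega> (weak_grad \<Omega> g) + L2_norm \<Omega> (gradient (\<phi> n)))\<^sup>2"
      by (simp add: power2_sum L2_norm_ge_0)
    finally have "L2_norm \<Omega> J \<le> L2_norm \<Omega> (weak_grad \<Omega> g) + L2_norm \<Omega> (gradient (\<phi> n))"
      by (rule power2_le_imp_le) (simp add: L2_norm_ge_0)
    moreover have "(\<lambda>x. F (U x)) = k n" by (simp add: fun_eq_iff F_def U_def k_def)
    ultimately show ?thesis using w \<phi>(3)[of n] by (intro exI[of _ w]) auto
  qed
  then have kH: "k n \<in> H1 \<Omega>" for n using H1_iff by blast
  show ?thesis
  proof (rule H1_0_closed[OF g])
    show "k n \<in> H1_0 \<Omega>" for n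
    proof -
      obtain C where C: "compact C" "C \<subseteq> \<Omega>" "\<And>x. x \<notin> C \<Longrightarrow> \<phi> n x = 0"
        using Cc_support[OF \<phi>(1)] by metis
      show ?thesis
      proof (rule H1_0_compact_support[OF kH C(1,2)])
        show "k n x = 0" if "x \<in> \<Omega>" "x \<notin> C" for x
          using le[OF that(1)] C(3)[OF that(2)] by (simp add: k_def)
      qed
    qed
    show "L2_norm \<Omega> (weak_grad \<Omega> (k n)) \<le> L2_norm \<Omega> (weak_grad \<Omega> g) + (L2_norm \<Omega> (weak_grad \<Omega> h) + 1)" for n
      using kw[of n] L2_norm_weak_grad by metis
    have "L2_norm \<Omega> (\<lambda>x. k n x - g x) \<le> L2_norm \<Omega> (\<lambda>x. \<phi> n x - h x)" for n
    proof (rule L2_norm_mono)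
      show "(\<lambda>x. k n x - g x) \<in> borel_measurable (lebesgue_on \<Omega>)"
        by (rule L2_measurable[OF L2_diff[OF H1_L2(1)[OF kH] H1_L2(1)[OF g]]])
      show "(\<lambda>x. \<phi> n x - h x) \<in> L2 \<Omega>" by (rule L2_diff[OF Cc_L2[OF \<phi>(1)] H1_L2(1)[OF H1_0_H1[OF h]]])
      show "norm (k n x - g x) \<le> norm (\<phi> n x - h x)" if "x \<in> \<Omega>" for x
        using le[OF that] by (auto simp: k_def min_def)
    qed
    then show "(\<lambda>n. L2_norm \<Omega> (\<lambda>x. k n x - g x)) \<longlonglongrightarrow> 0"
      using \<phi>(2) by (rule L2_norm_tendsto_0_bound)
  qed
qed

text \<open>For a test function \<open>\<phi>\<close>, integration by parts gives \<open>\<integral> \<phi> = - \<integral> x\<^sub>i \<partial>\<^sub>i \<phi>\<close>.  For test functions tending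
  to a constant, the right-hand side tends to zero, since the gradients do.\<close>

lemma nonzero_constant_not_H1_0:
  assumes "\<Omega> \<noteq> {}" "c \<noteq> 0"
  shows "(\<lambda>x. c) \<notin> H1_0 \<Omega>"
proof
  assume c: "(\<lambda>x. c) \<in> H1_0 \<Omega>"
  obtain \<phi> where \<phi>: "\<And>n::nat. \<phi> n \<in> Cc_infinity \<Omega>" "(\<lambda>n. L2_norm \<Omega> (\<lambda>x. \<phi> n x - c)) \<longlonglongrightarrow> 0"
    "(\<lambda>n. L2_norm \<Omega> (\<lambda>x. gradient (\<phi> n) x - weak_grad \<Omega> (\<lambda>x. c) x)) \<longlonglongrightarrow> 0"
    by (rule H1_0_sequence[OF c], rule that)
  have wg0: "has_weak_gradient \<Omega> (\<lambda>x. c) (\<lambda>x. 0)"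
    by (rule has_weak_gradientI[OF L2_const L2_const])
       (use integral_partial_eq_0 in \<open>simp add: L2_inner_def\<close>)
  fix i :: 'd
  have xL: "(\<lambda>x. x $ i) \<in> L2 \<Omega>"
  proof -
    obtain B where "\<And>x. x \<in> \<Omega> \<Longrightarrow> norm x \<le> B" using bounded_set by (auto simp: bounded_iff)
    then show ?thesis
      by (intro L2_bounded[where B=B] borel_imp_lebesgue_on)
         (auto intro: order_trans[OF component_le_norm_cart])
  qed
  have ibp: "L2_inner \<Omega> (\<phi> n) (\<lambda>x. 1) = - L2_inner \<Omega> (\<lambda>x. gradient (\<phi> n) x $ i) (\<lambda>x. x $ i)" for n
  proof -
    note d = Cc_differentiable[OF \<phi>(1)[of n]]
    have xd: "((\<lambda>x::real^'d. x $ i) has_derivative (\<lambda>x. x $ i)) (at x)" for x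
      by (intro bounded_linear_imp_has_derivative bounded_linear_vec_nth)
    have "partial i (\<lambda>x. x $ i * \<phi> n x) x = x $ i * partial i (\<phi> n) x + \<phi> n x" for x
      using partial_mult[OF differentiableI[OF xd[of x]] d[of x], of i] partial_eq[OF xd[of x], of i]
      by (simp add: axis_def)
    moreover have "(\<lambda>x. x $ i * \<phi> n x) \<in> Cc_infinity \<Omega>" by (rule Cc_mult_smooth[OF \<phi>(1) Ck_component])
    ultimately have "0 = (LINT x|lebesgue_on \<Omega>. partial i (\<phi> n) x \<bullet> (x $ i) + \<phi> n x \<bullet> 1)"
      using integral_partial_eq_0[of "\<lambda>x. x $ i * \<phi> n x" i] by (simp add: mult.commute)
    also have "\<dots> = L2_inner \<Omega> (partial i (\<phi> n)) (\<lambda>x. x $ i) + L2_inner \<Omega> (\<phi> n) (\<lambda>x. 1)"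
      unfolding L2_inner_def
      by (intro Bochner_Integration.integral_add L2_inner_integrable xL L2_const Cc_L2[OF \<phi>(1)]
          Cc_L2[OF Cc_partial[OF \<phi>(1)]])
    finally show ?thesis by (simp add: gradient_def)
  qed
  have wL: "weak_grad \<Omega> (\<lambda>x. c) \<in> L2 \<Omega>" by (rule H1_L2(2)[OF H1_0_H1[OF c]])
  have "(\<lambda>n. L2_norm \<Omega> (gradient (\<phi> n))) \<longlonglongrightarrow> L2_norm \<Omega> (weak_grad \<Omega> (\<lambda>x. c))"
    by (rule L2_norm_tendsto[OF gradient_L2[OF \<phi>(1)] wL \<phi>(3)])
  also have "L2_norm \<Omega> (weak_grad \<Omega> (\<lambda>x. c)) = 0"
    unfolding L2_norm_weak_grad[OF wg0] by (simp add: L2_norm_def L2_inner_def)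
  finally have "(\<lambda>n. L2_norm \<Omega> (gradient (\<phi> n)) * L2_norm \<Omega> (\<lambda>x. x $ i)) \<longlonglongrightarrow> 0"
    by (rule tendsto_mult_left_zero)
  then have "(\<lambda>n. L2_inner \<Omega> (\<phi> n) (\<lambda>x. 1)) \<longlonglongrightarrow> 0"
  proof (rule Lim_null_comparison[rotated])
    have "\<bar>L2_inner \<Omega> (\<phi> n) (\<lambda>x. 1)\<bar> \<le> L2_norm \<Omega> (gradient (\<phi> n)) * L2_norm \<Omega> (\<lambda>x. x $ i)" for n
    proof -
      note gL = gradient_L2[OF \<phi>(1)[of n]]
      have "\<bar>L2_inner \<Omega> (\<phi> n) (\<lambda>x. 1)\<bar> \<le> L2_norm \<Omega> (\<lambda>x. gradient (\<phi> n) x $ i) * L2_norm \<Omega> (\<lambda>x. x $ i)"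
        unfolding ibp using L2_inner_Cauchy_Schwarz[OF L2_nth[OF gL] xL] by simp
      also have "\<dots> \<le> L2_norm \<Omega> (gradient (\<phi> n)) * L2_norm \<Omega> (\<lambda>x. x $ i)"
        by (intro mult_right_mono L2_norm_ge_0 L2_norm_mono[OF L2_measurable[OF L2_nth[OF gL]] gL])
           (simp add: component_le_norm_cart)
      finally show ?thesis .
    qed
    then show "\<forall>\<^sub>F n in sequentially. norm (L2_inner \<Omega> (\<phi> n) (\<lambda>x. 1))
        \<le> L2_norm \<Omega> (gradient (\<phi> n)) * L2_norm \<Omega> (\<lambda>x. x $ i)" by simp
  qed
  moreover have "(\<lambda>n. L2_inner \<Omega> (\<phi> n) (\<lambda>x. 1)) \<longlonglongrightarrow> L2_inner \<Omega> (\<lambda>x. c) (\<lambda>x. 1)"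
    by (rule L2_inner_tendsto_left[OF Cc_L2[OF \<phi>(1)] L2_const L2_const \<phi>(2)])
  ultimately have "L2_inner \<Omega> (\<lambda>x. c) (\<lambda>x. 1) = 0" by (rule LIMSEQ_unique[symmetric])
  then have "measure (lebesgue_on \<Omega>) \<Omega> = 0" using assms(2) by (simp add: L2_inner_def)
  moreover have "\<Omega> \<in> lmeasurable" using open_set bounded_set by (simp add: bounded_set_imp_lmeasurable)
  ultimately have "measure lebesgue \<Omega> = 0" by (simp add: measure_restrict_space fmeasurableD)
  then have "negligible \<Omega>" using \<open>\<Omega> \<in> lmeasurable\<close> by (simp add: negligible_iff_measure)
  then show False using open_not_negligible[OF open_set assms(1)] by simp
qed

end

section \<open>The closed convex hull of the boundary values\<close>

text \<open>The pointwise maximum of the functions \<open>g 0, \<dots>, g n\<close>.\<close>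

primrec max_upto :: "(nat \<Rightarrow> 'a \<Rightarrow> real) \<Rightarrow> nat \<Rightarrow> 'a \<Rightarrow> real" where
  "max_upto g 0 y = g 0 y"
| "max_upto g (Suc n) y = max (max_upto g n y) (g (Suc n) y)"

lemma max_upto_Lipschitz:
  assumes "\<And>k. \<bar>g k y - g k z\<bar> \<le> B"
  shows "\<bar>max_upto g n y - max_upto g n z\<bar> \<le> B"
proof (induction n)
  case (Suc n)
  then show ?case using assms[of "Suc n"] by (auto simp: max_def abs_if split: if_splits)
qed (simp add: assms)

lemma max_upto_ge: "k \<le> n \<Longrightarrow> g k y \<le> max_upto g n y"
  by (induction n) (auto simp: le_Suc_eq)

lemma max_upto_le: "(\<And>k. g k y \<le> B) \<Longrightarrow> max_upto g n y \<le> B"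
  by (induction n) auto

lemma max_upto_le_sum:
  assumes "\<And>k. 0 \<le> g k y"
  shows "max_upto g n y \<le> (\<Sum>k\<le>n. g k y)"
proof (induction n)
  case (Suc n)
  have "0 \<le> (\<Sum>k\<le>n. g k y)" by (intro sum_nonneg assms)
  then show ?case using Suc assms[of "Suc n"] by simp
qed simp

lemma max_upto_nonneg: "(\<And>k. 0 \<le> g k y) \<Longrightarrow> 0 \<le> max_upto g n y"
  using max_upto_ge[of 0 n g y] by (meson le0 order_trans)

lemma positive_part_Lipschitz:
  fixes \<nu> :: "'a::real_inner"
  shows "\<bar>max 0 (\<nu> \<bullet> y - a) - max 0 (\<nu> \<bullet> z - a)\<bar> \<le> norm \<nu> * norm (y - z)"
proof -
  have "\<bar>\<nu> \<bullet> y - \<nu> \<bullet> z\<bar> \<le> norm \<nu> * norm (y - z)"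
    using Cauchy_Schwarz_ineq2[of \<nu> "y - z"] by (simp add: inner_diff_right)
  then show ?thesis by (auto simp: max_def abs_if split: if_splits)
qed

text \<open>The excess of \<open>y\<close> over the half-space that supports \<open>K\<close> at the projection of \<open>z\<close> is at most
  the distance from \<open>y\<close> to \<open>K\<close>, and at least this distance minus \<open>2 \<bar>y - z\<bar>\<close>.  Hence the distance is
  the supremum of the excesses over a dense set of points \<open>z\<close>.  For \<open>z \<in> K\<close> the normal is
  \<open>sgn 0 = 0\<close>, and the half-space is the whole space.\<close>

lemma closest_point_excess:
  fixes K :: "'a::euclidean_space set"
  assumes K: "convex K" "closed K" "K \<noteq> {}"
  defines "\<nu> \<equiv> \<lambda>z. sgn (z - closest_point K z)"
  shows "\<And>y. y \<in> K \<Longrightarrow> \<nu> z \<bullet> y \<le> \<nu> z \<bullet> closest_point K z"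
    and "\<nu> z \<bullet> y - \<nu> z \<bullet> closest_point K z \<le> norm (y - closest_point K y)"
    and "norm (y - closest_point K y) - 2 * norm (y - z) \<le> \<nu> z \<bullet> y - \<nu> z \<bullet> closest_point K z"
proof -
  let ?P = "closest_point K"
  have n1: "norm (\<nu> z) \<le> 1" for z by (simp add: \<nu>_def norm_sgn)
  have nle: "\<nu> z \<bullet> x \<le> norm x" for z x
    using norm_cauchy_schwarz[of "\<nu> z" x] mult_right_mono[OF n1[of z] norm_ge_zero[of x]] by linarith
  show 1: "\<nu> z \<bullet> y \<le> \<nu> z \<bullet> ?P z" if "y \<in> K" for y z
  proof -
    have "(z - ?P z) \<bullet> (y - ?P z) \<le> 0" by (rule closest_point_dot[OF K(1,2) that])
    then have "\<nu> z \<bullet> (y - ?P z) \<le> 0"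
      by (simp add: \<nu>_def sgn_div_norm mult_nonneg_nonpos)
    then show ?thesis by (simp add: inner_diff_right)
  qed
  show "\<nu> z \<bullet> y - \<nu> z \<bullet> ?P z \<le> norm (y - ?P y)"
    using 1[OF closest_point_in_set[OF K(2,3)], of z y] nle[of z "y - ?P y"]
    by (simp add: inner_diff_right)
  have "\<nu> z \<bullet> (z - ?P z) = norm (z - ?P z)"
    by (cases "z = ?P z")
       (simp_all add: \<nu>_def sgn_div_norm power2_norm_eq_inner[symmetric] power2_eq_square)
  moreover have "norm (y - ?P y) \<le> norm (y - z) + norm (z - ?P z)"
  proof -
    have "dist y (?P y) \<le> dist y (?P z)"
      by (rule closest_point_le[OF K(2) closest_point_in_set[OF K(2,3)]])
    then show ?thesis using dist_triangle[of y "?P z" z] by (simp add: dist_norm)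
  qed
  moreover have "\<nu> z \<bullet> (z - y) \<le> norm (y - z)" using nle[of z "z - y"] by (simp add: norm_minus_commute)
  ultimately show "norm (y - ?P y) - 2 * norm (y - z) \<le> \<nu> z \<bullet> y - \<nu> z \<bullet> ?P z"
    by (simp add: inner_diff_right)
qed

lemma closest_point_residual_Lipschitz:
  fixes K :: "'a::euclidean_space set"
  assumes "convex K" "closed K" "K \<noteq> {}"
  shows "norm ((y - closest_point K y) - (z - closest_point K z)) \<le> 2 * norm (y - z)"
  using closest_point_lipschitz[OF assms, of y z]
    norm_triangle_ineq4[of "y - z" "closest_point K y - closest_point K z"]
  by (simp add: dist_norm algebra_simps)

lemma boundary_hull_closed_convex: "closed (boundary_hull \<Omega> V)" "convex (boundary_hull \<Omega> V)"
proof -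
  show "closed (boundary_hull \<Omega> V)"
    unfolding boundary_hull_def by (rule closed_Inter) (auto intro: closed_halfspace_le)
  show "convex (boundary_hull \<Omega> V)"
    unfolding boundary_hull_def by (rule convex_Inter) (auto intro: convex_halfspace_le)
qed

text \<open>The half-spaces that contain the boundary values of \<open>V\<close>, as pairs of a normal vector
  (of arbitrary length, possibly zero) and an offset.\<close>

definition boundary_halfspaces ::
  "(real^'d::finite) set \<Rightarrow> (real^'d \<Rightarrow> real^'m::finite) \<Rightarrow> ((real^'m) \<times> real) set" where
  "boundary_halfspaces \<Omega> V = {(\<nu>, a). (\<lambda>x. max 0 (\<nu> \<bullet> V x - a)) \<in> H1_0 \<Omega>}"

lemma H1_vec_weak_jac:
  assumes "U \<in> H1_vec \<Omega>"
  shows "has_weak_gradient \<Omega> (\<lambda>x. U x $ k) (\<lambda>x. weak_jac \<Omega> U x $ k)"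
proof -
  have "(\<lambda>x. U x $ k) \<in> H1 \<Omega>" using assms by (simp add: H1_vec_def)
  from H1_weak_grad[OF this] show ?thesis by (simp add: weak_jac_def)
qed

context bounded_open_set
begin

lemma H1_vec_L2:
  assumes "U \<in> H1_vec \<Omega>"
  shows "U \<in> L2 \<Omega>" "weak_jac \<Omega> U \<in> L2 \<Omega>"
  using has_weak_gradient_L2[OF H1_vec_weak_jac[OF assms]] L2_vec_iff by blast+

lemma Lipschitz_H1:
  fixes F :: "real^'m::finite \<Rightarrow> real"
  assumes "\<And>y z. \<bar>F y - F z\<bar> \<le> L * norm (y - z)" "L \<ge> 0" "U \<in> H1_vec \<Omega>"
  shows "(\<lambda>x. F (U x)) \<in> H1 \<Omega>"
    "L2_norm \<Omega> (weak_grad \<Omega> (\<lambda>x. F (U x))) \<le> L * L2_norm \<Omega> (weak_jac \<Omega> U)"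
proof -
  obtain g where g: "has_weak_gradient \<Omega> (\<lambda>x. F (U x)) g" "L2_norm \<Omega> g \<le> L * L2_norm \<Omega> (weak_jac \<Omega> U)"
    using Lipschitz_weak_gradient[OF assms(1,2) H1_vec_weak_jac[OF assms(3)]] by blast
  then show "(\<lambda>x. F (U x)) \<in> H1 \<Omega>" using H1_iff by blast
  show "L2_norm \<Omega> (weak_grad \<Omega> (\<lambda>x. F (U x))) \<le> L * L2_norm \<Omega> (weak_jac \<Omega> U)"
    using g L2_norm_weak_grad by simp
qed

lemma positive_part_H1:
  fixes U :: "real^'d \<Rightarrow> real^'m::finite"
  assumes "U \<in> H1_vec \<Omega>"
  shows "(\<lambda>x. max 0 (\<nu> \<bullet> U x - a)) \<in> H1 \<Omega>"
    "L2_norm \<Omega> (weak_grad \<Omega> (\<lambda>x. max 0 (\<nu> \<bullet> U x - a))) \<le> norm \<nu> * L2_norm \<Omega> (weak_jac \<Omega> U)"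
  using Lipschitz_H1[of "\<lambda>y. max 0 (\<nu> \<bullet> y - a)" "norm \<nu>" U] positive_part_Lipschitz assms by auto

lemma H1_0_zero: "(\<lambda>x. 0) \<in> H1_0 \<Omega>"
proof (rule H1_0I_test_functions[where \<phi>="\<lambda>n x. 0" and B="L2_norm \<Omega> (gradient (\<lambda>x. 0))"])
  show "(\<lambda>x. 0) \<in> H1 \<Omega>" using has_weak_gradient_Cc[OF Cc_zero] H1_iff by blast
qed (simp_all add: Cc_zero L2_norm_def L2_inner_def)

end

text \<open>The domain has to be nonempty, since otherwise all constants have zero boundary values and
  the hull of the boundary values is empty.\<close>

locale sobolev_map = bounded_open_set \<Omega> for \<Omega> :: "(real^'d::finite) set" +
  fixes U :: "real^'d \<Rightarrow> real^'m::finite"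
  assumes nonempty: "\<Omega> \<noteq> {}" and U: "U \<in> H1_vec \<Omega>"
begin

lemma boundary_halfspaces_add:
  assumes "(\<nu>, a) \<in> boundary_halfspaces \<Omega> U" "(\<mu>, b) \<in> boundary_halfspaces \<Omega> U"
  shows "(\<nu> + \<mu>, a + b) \<in> boundary_halfspaces \<Omega> U"
proof -
  have "(\<lambda>x. max 0 (\<nu> \<bullet> U x - a) + max 0 (\<mu> \<bullet> U x - b)) \<in> H1_0 \<Omega>"
    using assms by (intro H1_0_add) (auto simp: boundary_halfspaces_def)
  then have "(\<lambda>x. max 0 ((\<nu> + \<mu>) \<bullet> U x - (a + b))) \<in> H1_0 \<Omega>"
    by (rule H1_0_sandwich[OF positive_part_H1(1)[OF U]]) (auto simp: inner_add_left max_def)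
  then show ?thesis by (simp add: boundary_halfspaces_def)
qed

lemma boundary_halfspaces_scaleR:
  assumes "(\<nu>, a) \<in> boundary_halfspaces \<Omega> U" "c \<ge> 0"
  shows "(c *\<^sub>R \<nu>, c * a) \<in> boundary_halfspaces \<Omega> U"
proof -
  have "max 0 ((c *\<^sub>R \<nu>) \<bullet> U x - c * a) = c * max 0 (\<nu> \<bullet> U x - a)" for x
    using assms(2) max_mult_distrib_left[of c 0 "\<nu> \<bullet> U x - a"] by (simp add: algebra_simps)
  then show ?thesis
    using H1_0_cmult[of "\<lambda>x. max 0 (\<nu> \<bullet> U x - a)" c] assms(1) by (simp add: boundary_halfspaces_def)
qed

lemma boundary_halfspaces_0_iff: "(0, a) \<in> boundary_halfspaces \<Omega> U \<longleftrightarrow> 0 \<le> a"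
proof (cases "0 \<le> a")
  case True
  then have "(\<lambda>x::real^'d. max 0 ((0::real^'m) \<bullet> U x - a)) = (\<lambda>x. 0)" by auto
  then show ?thesis using H1_0_zero True by (simp add: boundary_halfspaces_def)
next
  case False
  then have "(\<lambda>x::real^'d. max 0 ((0::real^'m) \<bullet> U x - a)) = (\<lambda>x. - a)" by auto
  then show ?thesis
    using nonzero_constant_not_H1_0[OF nonempty, of "- a"] False by (simp add: boundary_halfspaces_def)
qed

text \<open>The gradients of \<open>(\<nu> \<bullet> U - a)\<^sup>+\<close> are bounded as long as the normals \<open>\<nu>\<close> are; so zero boundary
  values persist in the limit.\<close>

lemma closed_boundary_halfspaces: "closed (boundary_halfspaces \<Omega> U)"
  unfolding closed_sequential_limits
proof (intro allI impI)
  fix s l assume "(\<forall>n. s n \<in> boundary_halfspaces \<Omega> U) \<and> s \<longlonglongrightarrow> l"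
  then have s: "\<And>n. s n \<in> boundary_halfspaces \<Omega> U" and sl: "s \<longlonglongrightarrow> l" by auto
  define \<nu> a where "\<nu> n = fst (s n)" and "a n = snd (s n)" for n
  have \<nu>: "\<nu> \<longlonglongrightarrow> fst l" and a: "a \<longlonglongrightarrow> snd l"
    unfolding \<nu>_def a_def using sl by (auto intro: tendsto_intros)
  obtain B where B: "\<And>n. norm (\<nu> n) \<le> B"
    using convergent_imp_Bseq[OF convergentI[OF \<nu>]] by (auto simp: Bseq_def)
  have "(\<lambda>x. max 0 (fst l \<bullet> U x - snd l)) \<in> H1_0 \<Omega>"
  proof (rule H1_0_closed[OF positive_part_H1(1)[OF U]])
    show fn: "(\<lambda>x. max 0 (\<nu> n \<bullet> U x - a n)) \<in> H1_0 \<Omega>" for n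
      using s[of n] by (simp add: boundary_halfspaces_def \<nu>_def a_def case_prod_beta)
    show "L2_norm \<Omega> (weak_grad \<Omega> (\<lambda>x. max 0 (\<nu> n \<bullet> U x - a n))) \<le> B * L2_norm \<Omega> (weak_jac \<Omega> U)" for n
      using positive_part_H1(2)[OF U, of "\<nu> n" "a n"] mult_right_mono[OF B L2_norm_ge_0]
      by (rule order_trans)
    let ?d = "\<lambda>n. norm (\<nu> n - fst l) * L2_norm \<Omega> U + \<bar>a n - snd l\<bar> * L2_norm \<Omega> (\<lambda>x. 1::real)"
    have "L2_norm \<Omega> (\<lambda>x. max 0 (\<nu> n \<bullet> U x - a n) - max 0 (fst l \<bullet> U x - snd l)) \<le> ?d n" for n
    proof -
      note UL = H1_vec_L2(1)[OF U]
      have m: "L2_norm \<Omega> (\<lambda>x. max 0 (\<nu> n \<bullet> U x - a n) - max 0 (fst l \<bullet> U x - snd l))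
          \<le> L2_norm \<Omega> (\<lambda>x. norm (\<nu> n - fst l) *\<^sub>R norm (U x) + \<bar>a n - snd l\<bar> *\<^sub>R (1::real))"
      proof (rule L2_norm_mono)
        show "(\<lambda>x. max 0 (\<nu> n \<bullet> U x - a n) - max 0 (fst l \<bullet> U x - snd l)) \<in> borel_measurable (lebesgue_on \<Omega>)"
          by (intro L2_measurable L2_diff H1_L2(1) positive_part_H1(1) U)
        show "(\<lambda>x. norm (\<nu> n - fst l) *\<^sub>R norm (U x) + \<bar>a n - snd l\<bar> *\<^sub>R (1::real)) \<in> L2 \<Omega>"
          by (intro L2_add L2_cmult L2_norm_fun UL L2_const)
        fix x
        have "\<bar>(\<nu> n - fst l) \<bullet> U x\<bar> \<le> norm (\<nu> n - fst l) * norm (U x)" by (rule Cauchy_Schwarz_ineq2)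
        then have "\<bar>(\<nu> n \<bullet> U x - a n) - (fst l \<bullet> U x - snd l)\<bar>
            \<le> norm (\<nu> n - fst l) * norm (U x) + \<bar>a n - snd l\<bar>"
          by (simp add: inner_diff_left)
        then show "norm (max 0 (\<nu> n \<bullet> U x - a n) - max 0 (fst l \<bullet> U x - snd l))
            \<le> norm (norm (\<nu> n - fst l) *\<^sub>R norm (U x) + \<bar>a n - snd l\<bar> *\<^sub>R (1::real))"
          by (auto simp: max_def abs_if split: if_splits)
      qed
      also have "\<dots> \<le> L2_norm \<Omega> (\<lambda>x. norm (\<nu> n - fst l) *\<^sub>R norm (U x)) + L2_norm \<Omega> (\<lambda>x. \<bar>a n - snd l\<bar> *\<^sub>R (1::real))"
        by (intro L2_norm_triangle L2_cmult L2_norm_fun UL L2_const)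
      also have "\<dots> = ?d n" unfolding L2_norm_scaleR L2_norm_norm by simp
      finally show ?thesis .
    qed
    moreover have "?d \<longlonglongrightarrow> 0"
    proof -
      have "?d \<longlonglongrightarrow> norm (fst l - fst l) * L2_norm \<Omega> U + \<bar>snd l - snd l\<bar> * L2_norm \<Omega> (\<lambda>x. 1::real)"
        by (intro tendsto_intros \<nu> a)
      then show ?thesis by simp
    qed
    ultimately show "(\<lambda>n. L2_norm \<Omega> (\<lambda>x. max 0 (\<nu> n \<bullet> U x - a n) - max 0 (fst l \<bullet> U x - snd l))) \<longlonglongrightarrow> 0"
      by (rule L2_norm_tendsto_0_bound)
  qed
  then show "l \<in> boundary_halfspaces \<Omega> U" by (simp add: boundary_halfspaces_def case_prod_beta)
qed

lemma convex_boundary_halfspaces: "convex (boundary_halfspaces \<Omega> U)"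
proof (rule convexI)
  fix p q :: "(real^'m) \<times> real" and s t :: real
  assume pq: "p \<in> boundary_halfspaces \<Omega> U" "q \<in> boundary_halfspaces \<Omega> U" and "0 \<le> s" "0 \<le> t" "s + t = 1"
  obtain \<nu> a \<mu> b where "p = (\<nu>, a)" "q = (\<mu>, b)" by (cases p, cases q) auto
  then show "s *\<^sub>R p + t *\<^sub>R q \<in> boundary_halfspaces \<Omega> U"
    using boundary_halfspaces_add[OF boundary_halfspaces_scaleR[of \<nu> a s] boundary_halfspaces_scaleR[of \<mu> b t]]
      pq \<open>0 \<le> s\<close> \<open>0 \<le> t\<close> by simp
qed

lemma boundary_hull_iff:
  "y \<in> boundary_hull \<Omega> U \<longleftrightarrow> (\<forall>(\<nu>, a) \<in> boundary_halfspaces \<Omega> U. \<nu> \<bullet> y \<le> a)"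
proof
  assume "\<forall>(\<nu>, a) \<in> boundary_halfspaces \<Omega> U. \<nu> \<bullet> y \<le> a"
  then show "y \<in> boundary_hull \<Omega> U" by (auto simp: boundary_hull_def boundary_halfspaces_def)
next
  assume y: "y \<in> boundary_hull \<Omega> U"
  have "\<nu> \<bullet> y \<le> a" if na: "(\<nu>, a) \<in> boundary_halfspaces \<Omega> U" for \<nu> a
  proof (cases "\<nu> = 0")
    case True
    then show ?thesis using na boundary_halfspaces_0_iff by simp
  next
    case False
    then have p: "1 / norm \<nu> > 0" by simp
    have "(\<lambda>x. max 0 (((1 / norm \<nu>) *\<^sub>R \<nu>) \<bullet> U x - (1 / norm \<nu>) * a)) \<in> H1_0 \<Omega>"
      using boundary_halfspaces_scaleR[OF na less_imp_le[OF p]] by (simp add: boundary_halfspaces_def)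
    moreover have "norm ((1 / norm \<nu>) *\<^sub>R \<nu>) = 1" using False by simp
    ultimately have "((1 / norm \<nu>) *\<^sub>R \<nu>) \<bullet> y \<le> (1 / norm \<nu>) * a"
      using y unfolding boundary_hull_def by blast
    then show ?thesis using False by (simp add: divide_right_mono field_simps)
  qed
  then show "\<forall>(\<nu>, a) \<in> boundary_halfspaces \<Omega> U. \<nu> \<bullet> y \<le> a" by blast
qed

text \<open>Separating a pair outside the closed convex cone of half-spaces from this cone.\<close>

lemma separate_boundary_halfspaces:
  assumes "(\<nu>\<^sub>0, a\<^sub>0) \<notin> boundary_halfspaces \<Omega> U"
  obtains p s where "\<And>\<nu> a. (\<nu>, a) \<in> boundary_halfspaces \<Omega> U \<Longrightarrow> 0 \<le> p \<bullet> \<nu> + s * a"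
    "p \<bullet> \<nu>\<^sub>0 + s * a\<^sub>0 < 0" "0 \<le> s"
proof -
  obtain c b where c: "c \<bullet> (\<nu>\<^sub>0, a\<^sub>0) < b" "\<And>x. x \<in> boundary_halfspaces \<Omega> U \<Longrightarrow> b < c \<bullet> x"
    using separating_hyperplane_closed_point[OF convex_boundary_halfspaces closed_boundary_halfspaces assms]
    by blast
  define p s where "p = fst c" and "s = snd c"
  have c_eq: "c \<bullet> (\<nu>, a) = p \<bullet> \<nu> + s * a" for \<nu> a by (cases c) (simp add: p_def s_def)
  have "b < 0" using c(2)[of "(0, 0)"] boundary_halfspaces_0_iff[of 0] c_eq[of 0 0] by simp
  have nonneg: "0 \<le> p \<bullet> \<nu> + s * a" if na: "(\<nu>, a) \<in> boundary_halfspaces \<Omega> U" for \<nu> a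
  proof (rule ccontr)
    assume neg: "\<not> ?thesis"
    define t where "t = b / (p \<bullet> \<nu> + s * a)"
    have "t \<ge> 0" using neg \<open>b < 0\<close> by (simp add: t_def divide_nonpos_neg less_imp_le)
    from c(2)[OF boundary_halfspaces_scaleR[OF na this]]
    have "b < t * (p \<bullet> \<nu> + s * a)" by (simp add: c_eq algebra_simps)
    then show False using neg by (simp add: t_def)
  qed
  show thesis
  proof (rule that[of p s])
    show "p \<bullet> \<nu>\<^sub>0 + s * a\<^sub>0 < 0" using c(1) \<open>b < 0\<close> by (simp add: c_eq)
    show "0 \<le> s" using nonneg[of 0 1] boundary_halfspaces_0_iff[of 1] by simp
  qed (rule nonneg)
qed

lemma separator_in_hull:
  assumes "\<And>\<nu> a. (\<nu>, a) \<in> boundary_halfspaces \<Omega> U \<Longrightarrow> 0 \<le> p \<bullet> \<nu> + s * a" "s > 0"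
  shows "(- 1 / s) *\<^sub>R p \<in> boundary_hull \<Omega> U"
  unfolding boundary_hull_iff
proof safe
  fix \<nu> a assume "(\<nu>, a) \<in> boundary_halfspaces \<Omega> U"
  from assms(1)[OF this] assms(2) show "\<nu> \<bullet> ((- 1 / s) *\<^sub>R p) \<le> a"
    by (simp add: inner_commute field_simps)
qed

lemma boundary_hull_nonempty: "boundary_hull \<Omega> U \<noteq> {}"
proof -
  have "(0, - 1) \<notin> boundary_halfspaces \<Omega> U" using boundary_halfspaces_0_iff[of "- 1"] by simp
  from separate_boundary_halfspaces[OF this]
  obtain p s where p: "\<And>\<nu> a. (\<nu>, a) \<in> boundary_halfspaces \<Omega> U \<Longrightarrow> 0 \<le> p \<bullet> \<nu> + s * a"
    "p \<bullet> 0 + s * (- 1) < 0" "0 \<le> s" by blast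
  then have "(- 1 / s) *\<^sub>R p \<in> boundary_hull \<Omega> U" by (intro separator_in_hull) auto
  then show ?thesis by blast
qed

text \<open>Every half-space containing the hull contains the boundary values: the closed convex cone of
  half-spaces is its own bipolar.\<close>

lemma halfspace_superset_hull:
  assumes "\<And>y. y \<in> boundary_hull \<Omega> U \<Longrightarrow> \<nu>\<^sub>0 \<bullet> y \<le> a\<^sub>0"
  shows "(\<nu>\<^sub>0, a\<^sub>0) \<in> boundary_halfspaces \<Omega> U"
proof (rule ccontr)
  assume "(\<nu>\<^sub>0, a\<^sub>0) \<notin> boundary_halfspaces \<Omega> U"
  from separate_boundary_halfspaces[OF this]
  obtain p s where p: "\<And>\<nu> a. (\<nu>, a) \<in> boundary_halfspaces \<Omega> U \<Longrightarrow> 0 \<le> p \<bullet> \<nu> + s * a"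
    "p \<bullet> \<nu>\<^sub>0 + s * a\<^sub>0 < 0" "0 \<le> s" by blast
  show False
  proof (cases "s = 0")
    case False
    then have s: "s > 0" using p(3) by simp
    have "\<nu>\<^sub>0 \<bullet> ((- 1 / s) *\<^sub>R p) \<le> a\<^sub>0" using assms separator_in_hull[OF p(1) s] by blast
    then show False using p(2) s by (simp add: inner_commute field_simps)
  next
    case True
    \<comment> \<open>Here \<open>- p\<close> is a direction of recession of the hull along which the half-space is left.\<close>
    obtain y where y: "y \<in> boundary_hull \<Omega> U" using boundary_hull_nonempty by blast
    have q: "p \<bullet> \<nu>\<^sub>0 < 0" using p(2) True by simp
    have "y - t *\<^sub>R p \<in> boundary_hull \<Omega> U" if "t \<ge> 0" for t
      unfolding boundary_hull_iff
    proof safe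
      fix \<nu> a assume na: "(\<nu>, a) \<in> boundary_halfspaces \<Omega> U"
      have "\<nu> \<bullet> y \<le> a" using y na unfolding boundary_hull_iff by blast
      moreover have "0 \<le> t * (\<nu> \<bullet> p)" using p(1)[OF na] True that by (simp add: inner_commute)
      ultimately show "\<nu> \<bullet> (y - t *\<^sub>R p) \<le> a" by (simp add: inner_diff_right)
    qed
    then have le: "\<nu>\<^sub>0 \<bullet> y - t * (p \<bullet> \<nu>\<^sub>0) \<le> a\<^sub>0" if "t \<ge> 0" for t
      using assms[of "y - t *\<^sub>R p"] that by (simp add: inner_diff_right inner_commute)
    define t where "t = (\<bar>a\<^sub>0 - \<nu>\<^sub>0 \<bullet> y\<bar> + 1) / (- (p \<bullet> \<nu>\<^sub>0))"
    have "t \<ge> 0" unfolding t_def using q by (intro divide_nonneg_pos) auto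
    moreover have "t * (p \<bullet> \<nu>\<^sub>0) = - (\<bar>a\<^sub>0 - \<nu>\<^sub>0 \<bullet> y\<bar> + 1)" using q by (simp add: t_def)
    ultimately show False using le[of t] by simp
  qed
qed

text \<open>The closed convex hull of the boundary values of \<open>U\<close> and the projection onto it.\<close>

abbreviation "bhull \<equiv> boundary_hull \<Omega> U"
abbreviation "proj \<equiv> closest_point bhull"

lemmas bhull_props = boundary_hull_closed_convex(2,1)[of \<Omega> U] boundary_hull_nonempty

text \<open>The distance to the hull is the increasing limit of maxima of finitely many functions
  \<open>(\<nu> \<bullet> U - a)\<^sup>+\<close>, all of them \<open>1\<close>-Lipschitz functions of \<open>U\<close>.\<close>

theorem distance_to_hull_H1_0: "(\<lambda>x. norm (U x - proj (U x))) \<in> H1_0 \<Omega>"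
proof -
  obtain D :: "(real^'m) set" where D: "countable D" "\<And>X. open X \<Longrightarrow> X \<noteq> {} \<Longrightarrow> \<exists>d\<in>D. d \<in> X"
    using countable_dense_setE by metis
  have "D \<noteq> {}" using D(2)[of UNIV] by auto
  define z where "z = from_nat_into D"
  have z_dense: "\<exists>k. norm (y - z k) < e" if e: "e > 0" for y e
  proof -
    have "y \<in> ball y e" using e by simp
    then obtain d where "d \<in> D" "d \<in> ball y e" using D(2)[OF open_ball, of y e] by blast
    moreover obtain k where "z k = d"
      unfolding z_def using from_nat_into_surj[OF D(1) \<open>d \<in> D\<close>] by blast
    ultimately show ?thesis by (auto simp: dist_norm)
  qed
  define \<nu> where "\<nu> k = sgn (z k - proj (z k))" for k
  define g where "g k y = max 0 (\<nu> k \<bullet> y - \<nu> k \<bullet> proj (z k))" for k y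
  define f where "f = max_upto g"
  define d where "d y = norm (y - proj y)" for y
  note ex = closest_point_excess[OF bhull_props]
  have g0: "0 \<le> g k y" for k y by (simp add: g_def)
  have g_le: "g k y \<le> d y" for k y using ex(2)[of "z k" y] by (simp add: g_def \<nu>_def d_def)
  have g_ge: "d y - 2 * norm (y - z k) \<le> g k y" for k y
    using ex(3)[of y "z k"] by (simp add: g_def \<nu>_def d_def)
  have gLip: "\<bar>g k y - g k y'\<bar> \<le> norm (y - y')" for k y y'
  proof -
    have "norm (\<nu> k) \<le> 1" by (simp add: \<nu>_def norm_sgn)
    then show ?thesis
      using positive_part_Lipschitz[of "\<nu> k" y "\<nu> k \<bullet> proj (z k)" y']
        mult_right_mono[of "norm (\<nu> k)" 1 "norm (y - y')"] by (simp add: g_def)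
  qed
  have fLip: "\<bar>f n y - f n y'\<bar> \<le> 1 * norm (y - y')" for n y y'
    unfolding f_def using max_upto_Lipschitz[of g y y', OF gLip] by simp
  have f0: "0 \<le> f n y" for n y unfolding f_def by (rule max_upto_nonneg, rule g0)
  have f_le: "f n y \<le> d y" for n y unfolding f_def by (rule max_upto_le) (rule g_le)
  have dLip: "\<bar>d y - d y'\<bar> \<le> 2 * norm (y - y')" for y y'
    unfolding d_def
    using norm_triangle_ineq3[of "y - proj y" "y' - proj y'"] closest_point_residual_Lipschitz[OF bhull_props, of y y']
    by linarith
  have dH: "(\<lambda>x. d (U x)) \<in> H1 \<Omega>" by (rule Lipschitz_H1(1)[OF dLip _ U]) simp
  have fH: "(\<lambda>x. f n (U x)) \<in> H1 \<Omega>"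
    "L2_norm \<Omega> (weak_grad \<Omega> (\<lambda>x. f n (U x))) \<le> 1 * L2_norm \<Omega> (weak_jac \<Omega> U)" for n
    by (rule Lipschitz_H1(1)[OF fLip _ U], simp) (rule Lipschitz_H1(2)[OF fLip _ U], simp)
  have f_lim: "(\<lambda>n. f n y) \<longlonglongrightarrow> d y" for y
  proof (rule LIMSEQ_I)
    fix e :: real assume e: "e > 0"
    obtain k where k: "norm (y - z k) < e / 2" using z_dense[of "e / 2" y] e by auto
    have "norm (f n y - d y) < e" if "n \<ge> k" for n
      using g_ge[of y k] f_le[of n y] max_upto_ge[OF that, of g y] k by (simp add: f_def)
    then show "\<exists>N. \<forall>n\<ge>N. norm (f n y - d y) < e" by blast
  qed
  have "(\<lambda>x. d (U x)) \<in> H1_0 \<Omega>"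
  proof (rule H1_0_closed[OF dH _ _ fH(2)])
    show "(\<lambda>x. f n (U x)) \<in> H1_0 \<Omega>" for n
    proof (rule H1_0_sandwich[OF fH(1)])
      have "(\<nu> k, \<nu> k \<bullet> proj (z k)) \<in> boundary_halfspaces \<Omega> U" for k
        using ex(1)[of _ "z k"] unfolding \<nu>_def by (rule halfspace_superset_hull)
      then show "(\<lambda>x. \<Sum>k\<le>n. g k (U x)) \<in> H1_0 \<Omega>"
        by (intro H1_0_sum) (auto simp: g_def boundary_halfspaces_def)
      show "0 \<le> f n (U x) \<and> f n (U x) \<le> (\<Sum>k\<le>n. g k (U x))" for x
        using f0 max_upto_le_sum[of g "U x", OF g0] by (simp add: f_def)
    qed
    have "(\<lambda>n. LINT x|lebesgue_on \<Omega>. (norm (f n (U x) - d (U x)))\<^sup>2) \<longlonglongrightarrow> (LINT x|lebesgue_on \<Omega>. 0)"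
    proof (rule integral_dominated_convergence[where w="\<lambda>x. (norm (d (U x)))\<^sup>2"])
      show "integrable (lebesgue_on \<Omega>) (\<lambda>x. (norm (d (U x)))\<^sup>2)"
        by (rule L2_integrable_square[OF H1_L2(1)[OF dH]])
      show "(\<lambda>x. (norm (f n (U x) - d (U x)))\<^sup>2) \<in> borel_measurable (lebesgue_on \<Omega>)" for n
        by (rule borel_measurable_integrable[OF L2_integrable_square[OF L2_diff[OF H1_L2(1)[OF fH(1)] H1_L2(1)[OF dH]]]])
      show "AE x in lebesgue_on \<Omega>. (\<lambda>n. (norm (f n (U x) - d (U x)))\<^sup>2) \<longlonglongrightarrow> 0"
      proof (rule AE_I2)
        fix x
        have "(\<lambda>n. (norm (f n (U x) - d (U x)))\<^sup>2) \<longlonglongrightarrow> (norm (d (U x) - d (U x)))\<^sup>2"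
          by (intro tendsto_intros f_lim)
        then show "(\<lambda>n. (norm (f n (U x) - d (U x)))\<^sup>2) \<longlonglongrightarrow> 0" by simp
      qed
      show "AE x in lebesgue_on \<Omega>. norm ((norm (f n (U x) - d (U x)))\<^sup>2) \<le> (norm (d (U x)))\<^sup>2" for n
      proof (rule AE_I2)
        fix x
        have "\<bar>f n (U x) - d (U x)\<bar> \<le> \<bar>d (U x)\<bar>" using f0[of n "U x"] f_le[of n "U x"] by linarith
        then show "norm ((norm (f n (U x) - d (U x)))\<^sup>2) \<le> (norm (d (U x)))\<^sup>2"
          by (simp add: abs_le_square_iff)
      qed
    qed simp
    then have "(\<lambda>n. sqrt ((L2_norm \<Omega> (\<lambda>x. f n (U x) - d (U x)))\<^sup>2)) \<longlonglongrightarrow> sqrt 0"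
      unfolding L2_norm_square_integral by (intro tendsto_real_sqrt) simp
    then show "(\<lambda>n. L2_norm \<Omega> (\<lambda>x. f n (U x) - d (U x))) \<longlonglongrightarrow> 0" by (simp add: L2_norm_ge_0)
  qed
  then show ?thesis by (simp add: d_def)
qed

text \<open>The positive and negative parts of the components of \<open>proj U - U\<close> are dominated by the distance
  to the hull.\<close>

lemma projection_residual_H1_0: "(\<lambda>x. (proj (U x) - U x) $ j) \<in> H1_0 \<Omega>"
proof -
  have part: "(\<lambda>x. max 0 (c * (proj (U x) - U x) $ j)) \<in> H1_0 \<Omega>" if c: "\<bar>c\<bar> = 1" for c
  proof (rule H1_0_sandwich[OF _ distance_to_hull_H1_0])
    define F where "F y = max 0 (c * (proj y - y) $ j)" for y
    have "\<bar>F y - F y'\<bar> \<le> 2 * norm (y - y')" for y y'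
    proof -
      let ?r = "(y - proj y) - (y' - proj y')"
      have "\<bar>c * (proj y - y) $ j - c * (proj y' - y') $ j\<bar> = \<bar>?r $ j\<bar>"
      proof -
        have "c * (proj y - y) $ j - c * (proj y' - y') $ j = - c * (?r $ j)" by (simp add: algebra_simps)
        then show ?thesis using c by (simp add: abs_mult)
      qed
      also have "\<dots> \<le> 2 * norm (y - y')"
        by (rule order_trans[OF component_le_norm_cart closest_point_residual_Lipschitz[OF bhull_props]])
      finally show ?thesis unfolding F_def by (auto simp: max_def abs_if split: if_splits)
    qed
    then have "(\<lambda>x. F (U x)) \<in> H1 \<Omega>" by (rule Lipschitz_H1(1)[OF _ _ U]) simp
    then show "(\<lambda>x. max 0 (c * (proj (U x) - U x) $ j)) \<in> H1 \<Omega>" by (simp add: F_def)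
    fix x
    have "c * (proj (U x) - U x) $ j \<le> \<bar>c * (proj (U x) - U x) $ j\<bar>" by (rule abs_ge_self)
    also have "\<dots> \<le> norm (U x - proj (U x))"
      using component_le_norm_cart[of "proj (U x) - U x" j] c by (simp add: abs_mult norm_minus_commute)
    finally show "0 \<le> max 0 (c * (proj (U x) - U x) $ j) \<and> max 0 (c * (proj (U x) - U x) $ j) \<le> norm (U x - proj (U x))"
      by simp
  qed
  have "(\<lambda>x. max 0 (1 * (proj (U x) - U x) $ j) - max 0 ((- 1) * (proj (U x) - U x) $ j)) \<in> H1_0 \<Omega>"
    by (intro H1_0_diff part) auto
  moreover have "max 0 (1 * (proj (U x) - U x) $ j) - max 0 ((- 1) * (proj (U x) - U x) $ j) = (proj (U x) - U x) $ j" for x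
    by (auto simp: max_def)
  ultimately show ?thesis by simp
qed

end

section \<open>Projection onto the hull and the best approximation property\<close>

context bounded_open_set
begin

lemma weak_jac_AE:
  fixes V :: "real^'d \<Rightarrow> real^'m::finite"
  assumes "\<And>j. has_weak_gradient \<Omega> (\<lambda>x. V x $ j) (\<lambda>x. G x $ j)"
  shows "AE x in lebesgue_on \<Omega>. weak_jac \<Omega> V x = G x"
proof -
  have "AE x in lebesgue_on \<Omega>. \<forall>j\<in>UNIV. weak_grad \<Omega> (\<lambda>y. V y $ j) x = G x $ j"
    by (intro AE_finite_allI weak_grad_AE assms) auto
  then show ?thesis by eventually_elim (simp add: weak_jac_def vec_eq_iff)
qed

lemma H1_vecI:
  assumes "\<And>j. has_weak_gradient \<Omega> (\<lambda>x. V x $ j) (\<lambda>x. G x $ j)"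
  shows "V \<in> H1_vec \<Omega>"
  using assms H1_iff by (auto simp: H1_vec_def)

lemma L2_norm_weak_jac:
  fixes V :: "real^'d \<Rightarrow> real^'m::finite"
  assumes "\<And>j. has_weak_gradient \<Omega> (\<lambda>x. V x $ j) (\<lambda>x. G x $ j)"
  shows "L2_norm \<Omega> (weak_jac \<Omega> V) = L2_norm \<Omega> G"
proof (rule L2_norm_cong_AE[OF weak_jac_AE[OF assms]])
  show "weak_jac \<Omega> V \<in> borel_measurable (lebesgue_on \<Omega>)"
    by (rule L2_measurable[OF H1_vec_L2(2)[OF H1_vecI[OF assms]]])
  have "G \<in> L2 \<Omega>" using has_weak_gradient_L2(2)[OF assms] L2_vec_iff by blast
  then show "G \<in> borel_measurable (lebesgue_on \<Omega>)" by (rule L2_measurable)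
qed

lemma energy_norm_eq: "energy_norm \<Omega> V = L2_norm \<Omega> (weak_jac \<Omega> V)"
  by (simp add: energy_norm_def L2_norm_def L2_inner_def power2_norm_eq_inner)

text \<open>The Pythagorean identity for a weakly harmonic map and a competitor with the same
  boundary values.\<close>

lemma weakly_harmonic_Pythagoras:
  fixes u W :: "real^'d \<Rightarrow> real^'m::finite"
  assumes u: "u \<in> H1_vec \<Omega>" and W: "W \<in> H1_vec \<Omega>"
    and weak: "\<And>v. v \<in> H1_0_vec \<Omega> \<Longrightarrow> L2_inner \<Omega> (weak_jac \<Omega> u) (weak_jac \<Omega> v) = 0"
    and bd: "(\<lambda>x. u x - W x) \<in> H1_0_vec \<Omega>"
  shows "(L2_norm \<Omega> (weak_jac \<Omega> (\<lambda>x. u x - W x)))\<^sup>2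
    = (L2_norm \<Omega> (weak_jac \<Omega> W))\<^sup>2 - (L2_norm \<Omega> (weak_jac \<Omega> u))\<^sup>2"
proof -
  let ?a = "weak_jac \<Omega> u" and ?b = "weak_jac \<Omega> W" and ?d = "weak_jac \<Omega> (\<lambda>x. u x - W x)"
  have wg: "has_weak_gradient \<Omega> (\<lambda>x. (u x - W x) $ j) (\<lambda>x. (?a x - ?b x) $ j)" for j
    using has_weak_gradient_diff[OF H1_vec_weak_jac[OF u] H1_vec_weak_jac[OF W], of j j] by simp
  note aL = H1_vec_L2(2)[OF u] and bL = H1_vec_L2(2)[OF W] and dL = H1_vec_L2(2)[OF H1_vecI[OF wg]]
  have "L2_inner \<Omega> ?a ?d = L2_inner \<Omega> ?a (\<lambda>x. ?a x - ?b x)"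
    unfolding L2_inner_def
  proof (rule integral_cong_AE)
    show "AE x in lebesgue_on \<Omega>. ?a x \<bullet> ?d x = ?a x \<bullet> (?a x - ?b x)"
      using weak_jac_AE[OF wg] by eventually_elim simp
  qed (intro borel_measurable_integrable L2_inner_integrable aL bL dL L2_diff)+
  then have "L2_inner \<Omega> ?a (\<lambda>x. ?a x - ?b x) = 0" using weak[OF bd] by simp
  then have ab: "L2_inner \<Omega> ?a ?a = L2_inner \<Omega> ?b ?a"
    using L2_inner_diff_left[OF aL bL aL] by (simp add: L2_inner_commute)
  have "(L2_norm \<Omega> ?d)\<^sup>2 = L2_inner \<Omega> (\<lambda>x. ?a x - ?b x) (\<lambda>x. ?a x - ?b x)"
    unfolding L2_norm_weak_jac[OF wg] by (rule L2_norm_square)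
  also have "\<dots> = L2_inner \<Omega> ?a (\<lambda>x. ?a x - ?b x) - L2_inner \<Omega> ?b (\<lambda>x. ?a x - ?b x)"
    by (rule L2_inner_diff_left[OF aL bL L2_diff[OF aL bL]])
  also have "L2_inner \<Omega> ?b (\<lambda>x. ?a x - ?b x) = L2_inner \<Omega> ?b ?a - L2_inner \<Omega> ?b ?b"
    using L2_inner_diff_left[OF aL bL bL] by (simp add: L2_inner_commute)
  also have "L2_inner \<Omega> ?a (\<lambda>x. ?a x - ?b x) = L2_inner \<Omega> ?a ?a - L2_inner \<Omega> ?b ?a"
    using L2_inner_diff_left[OF aL bL aL] by (simp add: L2_inner_commute)
  finally show ?thesis using ab by (simp add: L2_norm_square)
qed

end

theorem mainTheorem3:
  fixes \<Omega> :: "(real^'d::finite) set"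
    and u U U\<^sub>s :: "real^'d \<Rightarrow> real^'m::finite"
    and K :: "(real^'m) set"
  assumes domain: "open \<Omega>" "connected \<Omega>" "\<Omega> \<noteq> {}" "bounded \<Omega>"
    and u: "u \<in> H1_vec \<Omega>"
    and weakly_harmonic:
      "\<And>v. v \<in> H1_0_vec \<Omega> \<Longrightarrow>
         (LINT x|lebesgue_on \<Omega>. weak_jac \<Omega> u x \<bullet> weak_jac \<Omega> v x) = 0"
    and U: "U \<in> H1_vec \<Omega>"
    and K: "K = boundary_hull \<Omega> U"
    and U\<^sub>s: "\<And>x. x \<in> \<Omega> \<Longrightarrow> U\<^sub>s x = closest_point K (U x)"
  shows "U\<^sub>s \<in> H1_vec \<Omega>
    \<and> (AE x in lebesgue_on \<Omega>. U\<^sub>s x \<in> boundary_hull \<Omega> U\<^sub>s)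
    \<and> (\<lambda>x. U\<^sub>s x - U x) \<in> H1_0_vec \<Omega>
    \<and> (1/2) * (LINT x|lebesgue_on \<Omega>. (norm (weak_jac \<Omega> U\<^sub>s x))\<^sup>2)
        \<le> (1/2) * (LINT x|lebesgue_on \<Omega>. (norm (weak_jac \<Omega> U x))\<^sup>2)
    \<and> ((\<lambda>x. u x - U x) \<in> H1_0_vec \<Omega> \<longrightarrow>
        energy_norm \<Omega> (\<lambda>x. u x - U\<^sub>s x) \<le> energy_norm \<Omega> (\<lambda>x. u x - U x))"
proof -
  interpret sobolev_map \<Omega> U using domain U by unfold_locales auto
  note Kp = bhull_props[folded K]
  have Lip: "norm (closest_point K y - closest_point K z) \<le> 1 * norm (y - z)" for y z
    using closest_point_lipschitz[OF Kp, of y z] by (simp add: dist_norm)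
  obtain G :: "real^'d \<Rightarrow> real^'d^'m" where
    G: "\<And>j. has_weak_gradient \<Omega> (\<lambda>x. closest_point K (U x) $ j) (\<lambda>x. G x $ j)"
      "L2_norm \<Omega> G \<le> 1 * L2_norm \<Omega> (weak_jac \<Omega> U)"
    using Lipschitz_weak_jacobian[OF Lip _ H1_vec_weak_jac[OF U]] by auto
  have Gs: "has_weak_gradient \<Omega> (\<lambda>x. U\<^sub>s x $ j) (\<lambda>x. G x $ j)" for j
    by (rule has_weak_gradient_cong[OF _ G(1)]) (simp add: U\<^sub>s)
  have UsH: "U\<^sub>s \<in> H1_vec \<Omega>" using Gs by (rule H1_vecI)
  have energy: "L2_norm \<Omega> (weak_jac \<Omega> U\<^sub>s) \<le> L2_norm \<Omega> (weak_jac \<Omega> U)"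
    using G(2) L2_norm_weak_jac[OF Gs] by simp
  have bd: "(\<lambda>x. U\<^sub>s x - U x) \<in> H1_0_vec \<Omega>"
    unfolding H1_0_vec_def
  proof safe
    fix j
    show "(\<lambda>x. (U\<^sub>s x - U x) $ j) \<in> H1_0 \<Omega>"
      by (rule H1_0_cong[OF _ projection_residual_H1_0[of j]]) (simp add: U\<^sub>s K)
  qed
  \<comment> \<open>\<open>U\<^sub>s\<close> and \<open>U\<close> have the same boundary values, so a half-space containing those of \<open>U\<^sub>s\<close>
    contains those of \<open>U\<close>.\<close>
  have hull: "K \<subseteq> boundary_hull \<Omega> U\<^sub>s"
  proof
    fix y assume y: "y \<in> K"
    have "\<nu> \<bullet> y \<le> a" if \<nu>: "norm \<nu> = 1" and h: "(\<lambda>x. max 0 (\<nu> \<bullet> U\<^sub>s x - a)) \<in> H1_0 \<Omega>" for \<nu> a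
    proof -
      have "(\<lambda>x. max 0 (\<nu> \<bullet> U x - a)) \<in> H1_0 \<Omega>"
      proof (rule H1_0_sandwich[OF positive_part_H1(1)[OF U] H1_0_add[OF h distance_to_hull_H1_0]])
        fix x assume x: "x \<in> \<Omega>"
        have "\<nu> \<bullet> (U x - U\<^sub>s x) \<le> norm (U x - U\<^sub>s x)"
          using norm_cauchy_schwarz[of \<nu> "U x - U\<^sub>s x"] \<nu> by simp
        then show "0 \<le> max 0 (\<nu> \<bullet> U x - a) \<and> max 0 (\<nu> \<bullet> U x - a)
            \<le> max 0 (\<nu> \<bullet> U\<^sub>s x - a) + norm (U x - closest_point (boundary_hull \<Omega> U) (U x))"
          using U\<^sub>s[OF x] K by (simp add: inner_diff_right max_def)
      qed
      then show ?thesis using y \<nu> unfolding K boundary_hull_def by blast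
    qed
    then show "y \<in> boundary_hull \<Omega> U\<^sub>s" by (auto simp: boundary_hull_def)
  qed
  have in_hull: "AE x in lebesgue_on \<Omega>. U\<^sub>s x \<in> boundary_hull \<Omega> U\<^sub>s"
  proof (rule AE_I2)
    fix x assume "x \<in> space (lebesgue_on \<Omega>)"
    then have "U\<^sub>s x \<in> K" using U\<^sub>s closest_point_in_set[OF Kp(2,3)] by simp
    then show "U\<^sub>s x \<in> boundary_hull \<Omega> U\<^sub>s" using hull by blast
  qed
  have best: "energy_norm \<Omega> (\<lambda>x. u x - U\<^sub>s x) \<le> energy_norm \<Omega> (\<lambda>x. u x - U x)"
    if uU: "(\<lambda>x. u x - U x) \<in> H1_0_vec \<Omega>"
  proof -
    have "(\<lambda>x. u x - U\<^sub>s x) \<in> H1_0_vec \<Omega>"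
      unfolding H1_0_vec_def
    proof safe
      fix j
      have "(\<lambda>x. (u x - U x) $ j - (U\<^sub>s x - U x) $ j) \<in> H1_0 \<Omega>"
        using uU bd by (intro H1_0_diff) (auto simp: H1_0_vec_def)
      then show "(\<lambda>x. (u x - U\<^sub>s x) $ j) \<in> H1_0 \<Omega>" by simp
    qed
    have pyth: "(L2_norm \<Omega> (weak_jac \<Omega> (\<lambda>x. u x - W x)))\<^sup>2
        = (L2_norm \<Omega> (weak_jac \<Omega> W))\<^sup>2 - (L2_norm \<Omega> (weak_jac \<Omega> u))\<^sup>2"
      if "W \<in> H1_vec \<Omega>" "(\<lambda>x. u x - W x) \<in> H1_0_vec \<Omega>" for W
      by (rule weakly_harmonic_Pythagoras[OF u that(1) _ that(2)])
         (simp add: L2_inner_def weakly_harmonic)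
    have "(energy_norm \<Omega> (\<lambda>x. u x - U\<^sub>s x))\<^sup>2 \<le> (energy_norm \<Omega> (\<lambda>x. u x - U x))\<^sup>2"
      unfolding energy_norm_eq pyth[OF UsH \<open>(\<lambda>x. u x - U\<^sub>s x) \<in> H1_0_vec \<Omega>\<close>] pyth[OF U uU]
      using power_mono[OF energy L2_norm_ge_0, of 2] by simp
    then show ?thesis by (rule power2_le_imp_le) (simp add: energy_norm_eq L2_norm_ge_0)
  qed
  show ?thesis
    using UsH in_hull bd best power_mono[OF energy L2_norm_ge_0, of 2]
    by (simp add: L2_norm_square_integral)
qed

end
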